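(* Let $\Bbbk$ be a field of characteristic $0$, let $\mathfrak g$ be a finite dimensional Lie algebra over $\Bbbk$, and let $R=U(\mathfrak g)$ be its universal enveloping algebra. Suppose $G$ is a finite small subgroup of $\operatorname{Aut}_{Lie}(\mathfrak g)$. Then there is a natural isomorphism of algebras $R\ast G\cong \operatorname{End}_{R^G}(R)$.
   Context: $\operatorname{Aut}_{Lie}(\mathfrak g)\subseteq \mathrm{GL}(\mathfrak g)$ is the group of Lie algebra automorphisms of $\mathfrak g$; it acts on $U(\mathfrak g)$ by algebra automorphisms. A pseudo-reflection of a finite dimensional vector space $V$ is a non-identity element of $\mathrm{GL}(V)$ of finite order that fixes a hyperplane (codimension-one subspace) of $V$ pointwise. A finite subgroup $G\subseteq\mathrm{GL}(V)$ is small if it contains no pseudo-reflection (here $V=\mathfrak g$). $R\ast G$ is the skew group algebra, $R^G$ the fixed subring, and $R$ is a right $R^G$-module by multiplication. "Natural isomorphism" means that the natural algebra map $R\ast G\to\operatorname{End}_{R^G}(R)$, $r\ast g\mapsto (x\mapsto r\,g(x))$, is an isomorphism. *)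

theory Defs
  imports Complex_Main "HOL-Algebra.QuotRing" "HOL-Algebra.Module" "HOL-Library.Poly_Mapping"
begin

section \<open>Finite dimensional Lie algebras and their automorphisms\<close>

locale lie_algebra = vector_space scale
  for scale :: "'k::field \<Rightarrow> 'g::ab_group_add \<Rightarrow> 'g" +
  fixes bracket :: "'g \<Rightarrow> 'g \<Rightarrow> 'g"
  assumes bracket_linear_right: "Vector_Spaces.linear scale scale (\<lambda>y. bracket x y)"
    and bracket_linear_left: "Vector_Spaces.linear scale scale (\<lambda>x. bracket x y)"
    and bracket_alternating: "bracket x x = 0"
    and jacobi: "bracket x (bracket y z) + bracket y (bracket z x) + bracket z (bracket x y) = 0"

locale finite_dimensional_lie_algebra = lie_algebra +
  assumes finite_dimensional: "\<exists>B. finite_dimensional_vector_space scale B"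

definition general_linear :: "('k::field \<Rightarrow> 'v::ab_group_add \<Rightarrow> 'v) \<Rightarrow> ('v \<Rightarrow> 'v) set"
  where "general_linear scale = {f. bij f \<and> Vector_Spaces.linear scale scale f}"

definition lie_aut_group ::
  "('k::field \<Rightarrow> 'g::ab_group_add \<Rightarrow> 'g) \<Rightarrow> ('g \<Rightarrow> 'g \<Rightarrow> 'g) \<Rightarrow> ('g \<Rightarrow> 'g) monoid"
  where "lie_aut_group scale bracket =
    \<lparr>carrier = {f \<in> general_linear scale. \<forall>x y. f (bracket x y) = bracket (f x) (f y)},
     mult = (\<circ>), one = id\<rparr>"

definition hyperplane :: "('k::field \<Rightarrow> 'v::ab_group_add \<Rightarrow> 'v) \<Rightarrow> 'v set \<Rightarrow> bool"
  where "hyperplane scale H \<longleftrightarrow>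
    module.subspace scale H \<and> vector_space.dim scale H + 1 = vector_space.dim scale UNIV"

definition pseudo_reflection :: "('k::field \<Rightarrow> 'v::ab_group_add \<Rightarrow> 'v) \<Rightarrow> ('v \<Rightarrow> 'v) \<Rightarrow> bool"
  where "pseudo_reflection scale f \<longleftrightarrow>
    f \<in> general_linear scale \<and> f \<noteq> id \<and> (\<exists>n>0. f ^^ n = id) \<and>
    (\<exists>H. hyperplane scale H \<and> (\<forall>x\<in>H. f x = x))"

definition small :: "('k::field \<Rightarrow> 'v::ab_group_add \<Rightarrow> 'v) \<Rightarrow> ('v \<Rightarrow> 'v) set \<Rightarrow> bool"
  where "small scale G \<longleftrightarrow> \<not> (\<exists>f\<in>G. pseudo_reflection scale f)"


section \<open>Associative algebras\<close>

text \<open>Algebras are rings with a scalar multiplication by the field \<open>'k\<close>; they need not be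
  commutative, unlike the algebras of \<^theory>\<open>HOL-Algebra.Module\<close>, of which only the record type
  is used.\<close>

locale k_algebra = ring A for A :: "('k::field, 'a) module" (structure) +
  assumes smult_closed: "x \<in> carrier A \<Longrightarrow> c \<odot> x \<in> carrier A"
    and smult_add_left: "x \<in> carrier A \<Longrightarrow> (c + d) \<odot> x = c \<odot> x \<oplus> d \<odot> x"
    and smult_add_right:
      "x \<in> carrier A \<Longrightarrow> y \<in> carrier A \<Longrightarrow> c \<odot> (x \<oplus> y) = c \<odot> x \<oplus> c \<odot> y"
    and smult_smult: "x \<in> carrier A \<Longrightarrow> (c * d) \<odot> x = c \<odot> (d \<odot> x)"
    and smult_one: "x \<in> carrier A \<Longrightarrow> 1 \<odot> x = x"
    and smult_mult_left:
      "x \<in> carrier A \<Longrightarrow> y \<in> carrier A \<Longrightarrow> (c \<odot> x) \<otimes> y = c \<odot> (x \<otimes> y)"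
    and smult_mult_right:
      "x \<in> carrier A \<Longrightarrow> y \<in> carrier A \<Longrightarrow> x \<otimes> (c \<odot> y) = c \<odot> (x \<otimes> y)"

definition algebra_iso ::
  "('k::field, 'a) module \<Rightarrow> ('k, 'b) module \<Rightarrow> ('a \<Rightarrow> 'b) \<Rightarrow> bool"
  where "algebra_iso A B \<phi> \<longleftrightarrow>
    k_algebra A \<and> k_algebra B \<and> \<phi> \<in> ring_iso A B \<and>
    (\<forall>c. \<forall>x\<in>carrier A. \<phi> (c \<odot>\<^bsub>A\<^esub> x) = c \<odot>\<^bsub>B\<^esub> \<phi> x)"


section \<open>The universal enveloping algebra\<close>

text \<open>Words are wrapped in a type of their own so that concatenation can be declared as the
  (additively written) monoid operation which \<^theory>\<open>HOL-Library.Poly_Mapping\<close> expects for its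
  convolution product; \<open>'g free_monoid \<Rightarrow>\<^sub>0 'k\<close> is then the free associative algebra on the
  set \<open>'g\<close>.\<close>

datatype 'g free_monoid = Word (letters: "'g list")

instantiation free_monoid :: (type) monoid_add
begin

definition "0 = Word []"

definition "v + w = Word (letters v @ letters w)"

instance
  by standard (simp_all add: zero_free_monoid_def plus_free_monoid_def)

end

type_synonym ('k, 'g) free_alg = "'g free_monoid \<Rightarrow>\<^sub>0 'k"

definition free_algebra :: "('k::field, ('k, 'g) free_alg) module"
  where "free_algebra =
    \<lparr>carrier = UNIV, mult = (*), one = 1, zero = 0, add = (+),
     smult = (\<lambda>c p. Poly_Mapping.map ((*) c) p)\<rparr>"

definition generator :: "'g \<Rightarrow> ('k::field, 'g) free_alg"
  where "generator x = Poly_Mapping.single (Word [x]) 1"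

text \<open>The first two families of relations make \<open>generator\<close> linear: the free associative algebra on
  the underlying set of \<open>\<gg>\<close> modulo these two families is the tensor algebra of \<open>\<gg>\<close>.\<close>

definition enveloping_relations ::
  "('k::field \<Rightarrow> 'g::ab_group_add \<Rightarrow> 'g) \<Rightarrow> ('g \<Rightarrow> 'g \<Rightarrow> 'g) \<Rightarrow> ('k, 'g) free_alg set"
  where "enveloping_relations scale bracket =
    {generator (x + y) - generator x - generator y | x y. True} \<union>
    {generator (scale c x) - c \<odot>\<^bsub>free_algebra\<^esub> generator x | c x. True} \<union>
    {generator x * generator y - generator y * generator x - generator (bracket x y) | x y. True}"

definition enveloping_ideal ::
  "('k::field \<Rightarrow> 'g::ab_group_add \<Rightarrow> 'g) \<Rightarrow> ('g \<Rightarrow> 'g \<Rightarrow> 'g) \<Rightarrow> ('k, 'g) free_alg set"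
  where "enveloping_ideal scale bracket =
    Idl\<^bsub>free_algebra\<^esub> (enveloping_relations scale bracket)"

definition universal_enveloping_algebra ::
  "('k::field \<Rightarrow> 'g::ab_group_add \<Rightarrow> 'g) \<Rightarrow> ('g \<Rightarrow> 'g \<Rightarrow> 'g) \<Rightarrow> ('k, ('k, 'g) free_alg set) module"
  where "universal_enveloping_algebra scale bracket =
    (let I = enveloping_ideal scale bracket; Q = free_algebra Quot I in
     \<lparr>carrier = carrier Q, mult = mult Q, one = one Q, zero = zero Q, add = add Q,
      smult = (\<lambda>c X. \<Union>p\<in>X. I +>\<^bsub>free_algebra\<^esub> (c \<odot>\<^bsub>free_algebra\<^esub> p))\<rparr>)"

definition free_algebra_map :: "('g \<Rightarrow> 'g) \<Rightarrow> ('k::field, 'g) free_alg \<Rightarrow> ('k, 'g) free_alg"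
  where "free_algebra_map f p =
    (\<Sum>w\<in>Poly_Mapping.keys p. Poly_Mapping.single (map_free_monoid f w) (Poly_Mapping.lookup p w))"

text \<open>For a Lie algebra automorphism \<open>f\<close>, the map \<open>free_algebra_map f\<close> preserves the enveloping
  ideal; the next function is the map that it induces on cosets.\<close>

definition enveloping_map ::
  "('k::field \<Rightarrow> 'g::ab_group_add \<Rightarrow> 'g) \<Rightarrow> ('g \<Rightarrow> 'g \<Rightarrow> 'g) \<Rightarrow>
   ('g \<Rightarrow> 'g) \<Rightarrow> ('k, 'g) free_alg set \<Rightarrow> ('k, 'g) free_alg set"
  where "enveloping_map scale bracket f X =
    (\<Union>p\<in>X. enveloping_ideal scale bracket +>\<^bsub>free_algebra\<^esub> free_algebra_map f p)"


section \<open>Skew group algebras and the natural map\<close>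

definition fixed_subring :: "('k, 'a) module \<Rightarrow> 'h set \<Rightarrow> ('h \<Rightarrow> 'a \<Rightarrow> 'a) \<Rightarrow> 'a set"
  where "fixed_subring R G act = {r \<in> carrier R. \<forall>g\<in>G. act g r = r}"

text \<open>The function \<open>u\<close> stands for the formal sum of the \<open>u g \<ast> g\<close> over \<open>g\<close> in \<open>G\<close>, where \<open>G\<close> is
  finite. The product is the bilinear extension of \<open>(r \<ast> g) (s \<ast> h) = r g(s) \<ast> g h\<close>.\<close>

definition skew_group_algebra ::
  "('k, 'a) module \<Rightarrow> 'h monoid \<Rightarrow> ('h \<Rightarrow> 'a \<Rightarrow> 'a) \<Rightarrow> ('k, 'h \<Rightarrow> 'a) module"
  where "skew_group_algebra R G act =
    \<lparr>carrier = carrier G \<rightarrow>\<^sub>E carrier R,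
     mult = (\<lambda>u v. \<lambda>g\<in>carrier G.
       \<Oplus>\<^bsub>R\<^esub>h\<in>carrier G. u h \<otimes>\<^bsub>R\<^esub> act h (v (inv\<^bsub>G\<^esub> h \<otimes>\<^bsub>G\<^esub> g))),
     one = (\<lambda>g\<in>carrier G. if g = \<one>\<^bsub>G\<^esub> then \<one>\<^bsub>R\<^esub> else \<zero>\<^bsub>R\<^esub>),
     zero = (\<lambda>g\<in>carrier G. \<zero>\<^bsub>R\<^esub>),
     add = (\<lambda>u v. \<lambda>g\<in>carrier G. u g \<oplus>\<^bsub>R\<^esub> v g),
     smult = (\<lambda>c u. \<lambda>g\<in>carrier G. c \<odot>\<^bsub>R\<^esub> u g)\<rparr>"

text \<open>Endomorphisms of \<open>R\<close> as a right module over its subring \<open>S\<close>; functions on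
  \<open>R\<close> are extensional, so that they are determined by their values on the carrier.\<close>

definition right_endomorphism_algebra ::
  "('k, 'a) module \<Rightarrow> 'a set \<Rightarrow> ('k, 'a \<Rightarrow> 'a) module"
  where "right_endomorphism_algebra R S =
    \<lparr>carrier = {\<phi> \<in> carrier R \<rightarrow>\<^sub>E carrier R.
       (\<forall>x\<in>carrier R. \<forall>y\<in>carrier R. \<phi> (x \<oplus>\<^bsub>R\<^esub> y) = \<phi> x \<oplus>\<^bsub>R\<^esub> \<phi> y) \<and>
       (\<forall>x\<in>carrier R. \<forall>s\<in>S. \<phi> (x \<otimes>\<^bsub>R\<^esub> s) = \<phi> x \<otimes>\<^bsub>R\<^esub> s)},
     mult = (\<lambda>\<phi> \<psi>. compose (carrier R) \<phi> \<psi>),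
     one = (\<lambda>x\<in>carrier R. x),
     zero = (\<lambda>x\<in>carrier R. \<zero>\<^bsub>R\<^esub>),
     add = (\<lambda>\<phi> \<psi>. \<lambda>x\<in>carrier R. \<phi> x \<oplus>\<^bsub>R\<^esub> \<psi> x),
     smult = (\<lambda>c \<phi>. \<lambda>x\<in>carrier R. c \<odot>\<^bsub>R\<^esub> \<phi> x)\<rparr>"

definition natural_map ::
  "('k, 'a) module \<Rightarrow> 'h monoid \<Rightarrow> ('h \<Rightarrow> 'a \<Rightarrow> 'a) \<Rightarrow> ('h \<Rightarrow> 'a) \<Rightarrow> 'a \<Rightarrow> 'a"
  where "natural_map R G act u =
    (\<lambda>x\<in>carrier R. \<Oplus>\<^bsub>R\<^esub>g\<in>carrier G. u g \<otimes>\<^bsub>R\<^esub> act g x)"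

end

theory Submission
  imports Defs "HOL-Library.Multiset"
begin

text \<open>The enveloping algebra \<open>R\<close> is filtered, and by the Poincare-Birkhoff-Witt theorem (proved by
  Jacobson's straightening argument) its associated graded ring is a polynomial ring \<open>S\<close> on which
  \<open>G\<close> acts linearly. For \<open>S\<close>, an endomorphism \<open>\<psi>\<close> over the invariants becomes a combination of group
  elements after composition with \<open>\<Prod>g\<noteq>1. g (a g) - a g\<close>, for any choice of linear forms \<open>a g\<close>.
  Since \<open>G\<close> contains no pseudo-reflection, each \<open>(g - 1) V\<close> contains two independent vectors; these are
  coprime linear forms, so the factors can be cancelled one after the other. An endomorphism of \<open>R\<close>
  over \<open>R\<^sup>G\<close> raises degrees by a bounded amount, because \<open>S\<close> is generated in bounded degrees over its
  invariants. Its leading symbol is an endomorphism of \<open>S\<close>; lifting the representation of the symbol and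
  subtracting lowers the degree, and endomorphisms of negative degree vanish. Injectivity follows by
  taking leading symbols from the independence of distinct automorphisms of a domain.\<close>

text \<open>The Poincare-Birkhoff-Witt bijection is used to leave the quotient ring altogether: the
  product of \<open>R\<close> and the group action become operations \<open>star\<close> and
  \<open>twist\<close> on polynomials in \<open>d\<close> variables. The filtration is then the
  ordinary degree and symbols are homogeneous parts; of the Lie algebra, the main argument only sees
  that the leading terms of \<open>star\<close> and \<open>twist\<close> are the commutative product
  and the linear action. The obstacle is that a linear map over the fixed ring carries no
  information about degrees, so its leading symbol makes sense only after a uniform bound has been
  found. Every product of \<open>card G\<close> linear forms lies in the ideal generated by the
  invariants of positive degree; averaging over \<open>G\<close> lifts these invariants to fixed
  elements of \<open>R\<close> with the same leading term, and linearity over those controls all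
  high degrees by finitely many low ones. Characteristic \<open>0\<close> enters through division by
  \<open>card G\<close>, in this ideal membership and in the averaging.\<close>

abbreviation lookup where "lookup \<equiv> Poly_Mapping.lookup"

abbreviation single where "single \<equiv> Poly_Mapping.single"

abbreviation keys where "keys \<equiv> Poly_Mapping.keys"

section \<open>Linear extension of maps on monomials\<close>

text \<open>Only a monoid of monomials is assumed, so that scalars are handled alike in the
  commutative polynomial ring and in the free associative algebra: scaling becomes multiplication by
  a central element.\<close>

definition cst :: "'k::comm_ring_1 \<Rightarrow> ('m::monoid_add \<Rightarrow>\<^sub>0 'k)"
  where "cst c = single 0 c"

lemma cst_0 [simp]: "cst 0 = 0"
  by (simp add: cst_def)

lemma cst_1 [simp]: "cst 1 = 1"
  by (simp add: cst_def)

lemma cst_add: "cst (a + b) = cst a + cst b"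
  by (simp add: cst_def single_add)

lemma cst_uminus: "cst (- a) = - cst a"
  by (simp add: cst_def single_uminus)

lemma cst_mult: "cst (a * b) = cst a * cst b"
  by (simp add: cst_def mult_single)

lemma cst_sum: "cst (sum f A) = (\<Sum>x\<in>A. cst (f x))"
  by (induction A rule: infinite_finite_induct) (simp_all add: cst_add)

lemma cst_mult_single: "cst c * single m a = single m (c * a)"
  by (simp add: cst_def mult_single)

lemma poly_mapping_induct [case_names zero single add]:
  assumes "P 0" "\<And>m c. P (single m c)" "\<And>p q. P p \<Longrightarrow> P q \<Longrightarrow> P (p + q)"
  shows "P p"
proof (induction p rule: update_induct)
  case const
  then show ?case using assms(1) by simp
next
  case (update f a b)
  have "Poly_Mapping.update a b f = f + single a b"
    using update(1)
    by (intro poly_mapping_eqI) (auto simp: lookup_update lookup_add lookup_single when_def in_keys_iff)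
  then show ?case using assms(2,3) update by metis
qed

lemma cst_commute: "cst c * p = p * (cst c :: 'm::monoid_add \<Rightarrow>\<^sub>0 'k::comm_ring_1)"
  by (induction p rule: poly_mapping_induct)
     (simp_all add: cst_def mult_single distrib_left distrib_right mult.commute)

lemma cst_left_commute: "p * (cst c * q) = cst c * (p * (q :: 'm::monoid_add \<Rightarrow>\<^sub>0 'k::comm_ring_1))"
  by (metis cst_commute mult.assoc)

lemma lookup_cst_mult: "lookup (cst c * p) m = c * lookup p m"
  by (induction p rule: poly_mapping_induct)
     (simp_all add: cst_mult_single distrib_left lookup_add lookup_single when_def)

text \<open>The linear map with prescribed values on monomials. Substitutions, homogeneous parts,
  normal forms and symbols are all instances, so their linearity is proved once here.\<close>

definition lext :: "('m \<Rightarrow> ('n::monoid_add \<Rightarrow>\<^sub>0 'k)) \<Rightarrow> ('m \<Rightarrow>\<^sub>0 'k::comm_ring_1) \<Rightarrow> ('n \<Rightarrow>\<^sub>0 'k)"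
  where "lext h p = (\<Sum>m\<in>keys p. cst (lookup p m) * h m)"

lemma lext_superset:
  assumes "finite A" "keys p \<subseteq> A"
  shows "lext h p = (\<Sum>m\<in>A. cst (lookup p m) * h m)"
  unfolding lext_def using assms by (intro sum.mono_neutral_left) (auto simp: in_keys_iff)

lemma lext_zero [simp]: "lext h 0 = 0"
  by (simp add: lext_def)

lemma lext_add: "lext h (p + q) = lext h p + lext h q"
proof -
  let ?A = "keys p \<union> keys q"
  have "lext h r = (\<Sum>m\<in>?A. cst (lookup r m) * h m)" if "keys r \<subseteq> ?A" for r
    using that by (intro lext_superset) simp_all
  from this[of p] this[of q] this[of "p + q"] show ?thesis
    using keys_add[of p q] by (simp add: lookup_add cst_add distrib_right sum.distrib)
qed

lemma lext_single: "lext h (single m c) = cst c * h m"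
  by (cases "c = 0") (simp_all add: lext_def)

lemma lext_cst_mult: "lext h (cst c * p) = cst c * lext h p"
  by (induction p rule: poly_mapping_induct)
     (simp_all add: lext_add lext_single cst_mult_single cst_mult distrib_left mult.assoc)

lemma lext_uminus: "lext h (- p) = - lext h p"
  by (metis add.right_inverse eq_neg_iff_add_eq_0 lext_add lext_zero neg_eq_iff_add_eq_0)

lemma lext_diff: "lext h (p - q) = lext h p - lext h q"
  by (metis add_uminus_conv_diff lext_add lext_uminus)

lemma lext_sum: "lext h (sum f A) = (\<Sum>x\<in>A. lext h (f x))"
  by (induction A rule: infinite_finite_induct) (simp_all add: lext_add)

lemma lext_mult:
  assumes "\<And>m n. h (m + n) = h m * h n"
  shows "lext h (p * q) = lext h p * lext h q"
proof (induction p rule: poly_mapping_induct)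
  case (single m c)
  show ?case
  proof (induction q rule: poly_mapping_induct)
    case (single n e)
    show ?case
      by (simp add: mult_single lext_single assms cst_mult)
         (metis cst_left_commute mult.assoc)
  qed (simp_all add: lext_add distrib_left)
qed (simp_all add: lext_add distrib_right)

lemma lext_eqI:
  assumes "\<And>m. m \<in> keys p \<Longrightarrow> h m = h' m"
  shows "lext h p = lext h' p"
  unfolding lext_def using assms by (intro sum.cong) auto

lemma lext_id: "lext (\<lambda>m. single m 1) p = p"
  by (induction p rule: poly_mapping_induct)
     (simp_all add: lext_add lext_single cst_mult_single)

lemma lext_lext: "lext h (lext h' p) = lext (\<lambda>m. lext h (h' m)) p"
  by (simp add: lext_def[of h'] lext_def[of "\<lambda>m. lext h (h' m)"] lext_sum lext_cst_mult)

section \<open>Polynomials in countably many variables\<close>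

type_synonym 'k mpoly = "(nat \<Rightarrow>\<^sub>0 nat) \<Rightarrow>\<^sub>0 'k"

definition Var :: "nat \<Rightarrow> 'k::comm_ring_1 mpoly"
  where "Var i = single (single i 1) 1"

definition monom_subst :: "(nat \<Rightarrow> 'k::comm_ring_1 mpoly) \<Rightarrow> (nat \<Rightarrow>\<^sub>0 nat) \<Rightarrow> 'k mpoly"
  where "monom_subst f m = (\<Prod>i\<in>keys m. f i ^ lookup m i)"

definition subst :: "(nat \<Rightarrow> 'k::comm_ring_1 mpoly) \<Rightarrow> 'k mpoly \<Rightarrow> 'k mpoly"
  where "subst f = lext (monom_subst f)"

lemma monom_subst_superset:
  assumes "finite A" "keys m \<subseteq> A"
  shows "monom_subst f m = (\<Prod>i\<in>A. f i ^ lookup m i)"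
  unfolding monom_subst_def using assms by (intro prod.mono_neutral_left) (auto simp: in_keys_iff)

lemma monom_subst_add: "monom_subst f (m + n) = monom_subst f m * monom_subst f n"
proof -
  let ?A = "keys m \<union> keys n"
  have "monom_subst f r = (\<Prod>i\<in>?A. f i ^ lookup r i)" if "keys r \<subseteq> ?A" for r
    using that by (intro monom_subst_superset) simp_all
  from this[of m] this[of n] this[of "m + n"] show ?thesis
    using keys_add[of m n] by (simp add: lookup_add power_add prod.distrib)
qed

lemma subst_add: "subst f (p + q) = subst f p + subst f q"
  by (simp add: subst_def lext_add)

lemma subst_sum: "subst f (sum h A) = (\<Sum>x\<in>A. subst f (h x))"
  by (simp add: subst_def lext_sum)

lemma subst_mult: "subst f (p * q) = subst f p * subst f q"
  by (simp add: subst_def lext_mult monom_subst_add)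

lemma subst_cst [simp]: "subst f (cst c) = cst c"
  by (simp add: subst_def cst_def lext_single monom_subst_def mult_single)

lemma subst_0 [simp]: "subst f 0 = 0"
  by (simp add: subst_def)

lemma subst_1 [simp]: "subst f 1 = 1"
  using subst_cst[of f 1] by simp

lemma subst_Var [simp]: "subst f (Var i) = f i"
  by (simp add: subst_def Var_def lext_single monom_subst_def)

definition mdegree :: "(nat \<Rightarrow>\<^sub>0 nat) \<Rightarrow> nat"
  where "mdegree m = (\<Sum>i\<in>keys m. lookup m i)"

lemma mdegree_superset:
  assumes "finite A" "keys m \<subseteq> A"
  shows "mdegree m = (\<Sum>i\<in>A. lookup m i)"
  unfolding mdegree_def using assms by (intro sum.mono_neutral_left) (auto simp: in_keys_iff)

lemma mdegree_add: "mdegree (m + n) = mdegree m + mdegree n"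
proof -
  let ?A = "keys m \<union> keys n"
  have "mdegree r = (\<Sum>i\<in>?A. lookup r i)" if "keys r \<subseteq> ?A" for r
    using that by (intro mdegree_superset) simp_all
  from this[of m] this[of n] this[of "m + n"] show ?thesis
    using keys_add[of m n] by (simp add: lookup_add sum.distrib)
qed

lemma mdegree_0 [simp]: "mdegree 0 = 0"
  by (simp add: mdegree_def)

lemma mdegree_single [simp]: "mdegree (single i n) = n"
  by (simp add: mdegree_def)

definition word_monom :: "nat list \<Rightarrow> (nat \<Rightarrow>\<^sub>0 nat)"
  where "word_monom w = (\<Sum>i\<leftarrow>w. single i 1)"

lemma word_monom_simps [simp]:
  "word_monom [] = 0"
  "word_monom (i # w) = single i 1 + word_monom w"
  "word_monom (u @ v) = word_monom u + word_monom v"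
  by (simp_all add: word_monom_def)

lemma mdegree_word_monom [simp]: "mdegree (word_monom w) = length w"
  by (induction w) (simp_all add: mdegree_add)

lemma lookup_word_monom: "lookup (word_monom w) i = count (mset w) i"
  by (induction w) (simp_all add: lookup_add lookup_single when_def)

lemma word_monom_eq_iff: "word_monom u = word_monom v \<longleftrightarrow> mset u = mset v"
  by (simp add: poly_mapping_eq_iff fun_eq_iff lookup_word_monom multiset_eq_iff)

lemma keys_word_monom: "keys (word_monom w) = set w"
  by (auto simp: in_keys_iff lookup_word_monom)

lemma exists_sorted_word: "\<exists>w. sorted w \<and> word_monom w = m"
proof -
  have "\<exists>w. word_monom w = m"
  proof (induction m rule: update_induct)
    case const
    then show ?case by (intro exI[of _ "[]"]) simp
  next
    case (update f a b)
    then obtain w where w: "word_monom w = f" by blast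
    have "word_monom (replicate b a) = single a b"
      by (induction b) (simp_all flip: single_add)
    moreover have "Poly_Mapping.update a b f = single a b + f"
      using update(1)
      by (intro poly_mapping_eqI) (auto simp: lookup_update lookup_add lookup_single when_def in_keys_iff)
    ultimately show ?case
      using w by (intro exI[of _ "replicate b a @ w"]) simp
  qed
  then obtain w where "word_monom w = m" by blast
  then show ?thesis
    by (intro exI[of _ "sort w"]) (metis word_monom_eq_iff mset_sort sorted_sort)
qed

text \<open>Choosing the increasing word for each monomial is the choice of the
  Poincare-Birkhoff-Witt basis.\<close>

definition sorted_word :: "(nat \<Rightarrow>\<^sub>0 nat) \<Rightarrow> nat list"
  where "sorted_word m = (SOME w. sorted w \<and> word_monom w = m)"

lemma sorted_sorted_word: "sorted (sorted_word m)"
  and monom_of_sorted_word [simp]: "word_monom (sorted_word m) = m"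
  using someI_ex[OF exists_sorted_word[of m]] by (simp_all add: sorted_word_def)

lemma sorted_word_word_monom: "sorted w \<Longrightarrow> sorted_word (word_monom w) = w"
  by (metis monom_of_sorted_word word_monom_eq_iff properties_for_sort sorted_sorted_word)

lemma length_sorted_word [simp]: "length (sorted_word m) = mdegree m"
  by (metis mdegree_word_monom monom_of_sorted_word)

lemma single_word_monom:
  "single (word_monom w) 1 = (\<Prod>i\<leftarrow>w. Var i)"
proof (induction w)
  case (Cons i w)
  have "single (word_monom (i # w)) (1::'a) = Var i * single (word_monom w) 1"
    by (simp add: Var_def mult_single)
  then show ?case using Cons by simp
qed simp

text \<open>The variable case supplies a monomial of \<open>p\<close> in which the variable occurs,
  so that an induction can exploit a bound on the variables of \<open>p\<close>.\<close>

lemma mpoly_induct [case_names cst Var add mult]: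
  fixes p :: "'k::comm_ring_1 mpoly"
  assumes cst: "\<And>c. P (cst c)" and Var: "\<And>i m. m \<in> keys p \<Longrightarrow> i \<in> keys m \<Longrightarrow> P (Var i)"
    and add: "\<And>p q. P p \<Longrightarrow> P q \<Longrightarrow> P (p + q)" and mult: "\<And>p q. P p \<Longrightarrow> P q \<Longrightarrow> P (p * q)"
  shows "P p"
proof -
  have word: "P (\<Prod>i\<leftarrow>w. Var i)" if "\<And>i. i \<in> set w \<Longrightarrow> P (Var i)" for w
    using that cst[of 1] by (induction w) (auto intro: mult)
  have "P (single m 1)" if "m \<in> keys p" for m
    using word[of "sorted_word m"] Var[OF that] keys_word_monom[of "sorted_word m"]
    by (simp flip: single_word_monom)
  note mono = this
  have "P (\<Sum>m\<in>A. cst (lookup p m) * single m 1)" if "A \<subseteq> keys p" for A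
    using finite_subset[OF that finite_keys] that cst[of 0]
    by (induction A rule: finite_induct) (auto intro!: add mult cst mono)
  from this[of "keys p"] show ?thesis
    using lext_id[of p] by (simp add: lext_def)
qed

lemma subst_subst: "subst f (subst h p) = subst (\<lambda>i. subst f (h i)) p"
  by (induction p rule: mpoly_induct) (simp_all add: subst_add subst_mult)

text \<open>Both substitutions are ring homomorphisms, and modulo \<open>a\<close> they agree on the
  variables. This is the form of the factor theorem that later turns the vanishing of a substitution
  into divisibility by a linear form.\<close>

lemma dvd_subst_diff:
  assumes "\<And>i. a dvd f i - h i"
  shows "a dvd subst f p - subst h p"
proof (induction p rule: mpoly_induct)
  case (add p q)
  have "subst f (p + q) - subst h (p + q) = (subst f p - subst h p) + (subst f q - subst h q)"
    by (simp add: subst_add)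
  then show ?case using add by (metis dvd_add)
next
  case (mult p q)
  have "subst f (p * q) - subst h (p * q) =
      (subst f p - subst h p) * subst f q + subst h p * (subst f q - subst h q)"
    by (simp add: subst_mult algebra_simps)
  then show ?case using mult by (metis dvd_add dvd_mult dvd_mult2)
qed (simp_all add: assms)

text \<open>Degrees are integers because the symbol of a linear map may lower degrees.\<close>

definition hpart :: "int \<Rightarrow> 'k::comm_ring_1 mpoly \<Rightarrow> 'k mpoly"
  where "hpart n = lext (\<lambda>m. if int (mdegree m) = n then single m 1 else 0)"

definition homog :: "int \<Rightarrow> 'k::comm_ring_1 mpoly set"
  where "homog n = {p. \<forall>m\<in>keys p. int (mdegree m) = n}"

definition deg_le :: "int \<Rightarrow> 'k::comm_ring_1 mpoly set"
  where "deg_le n = {p. \<forall>m\<in>keys p. int (mdegree m) \<le> n}"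

lemma lookup_hpart:
  "lookup (hpart n p) m = (if int (mdegree m) = n then lookup p m else 0)"
  by (induction p rule: poly_mapping_induct)
     (auto simp: hpart_def lext_add lext_single lookup_add cst_mult_single lookup_single when_def)

lemma hpart_add: "hpart n (p + q) = hpart n p + hpart n q"
  by (simp add: hpart_def lext_add)

lemma hpart_diff: "hpart n (p - q) = hpart n p - hpart n q"
  by (simp add: hpart_def lext_diff)

lemma hpart_cst_mult: "hpart n (cst c * p) = cst c * hpart n p"
  by (simp add: hpart_def lext_cst_mult)

lemma hpart_sum: "hpart n (sum f A) = (\<Sum>x\<in>A. hpart n (f x))"
  by (simp add: hpart_def lext_sum)

lemma hpart_0 [simp]: "hpart n 0 = 0"
  by (simp add: hpart_def)

lemma homog_iff: "p \<in> homog n \<longleftrightarrow> (\<forall>m. int (mdegree m) \<noteq> n \<longrightarrow> lookup p m = 0)"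
  by (auto simp: homog_def in_keys_iff)

lemma deg_le_iff: "p \<in> deg_le n \<longleftrightarrow> (\<forall>m. int (mdegree m) > n \<longrightarrow> lookup p m = 0)"
  by (auto simp: deg_le_def in_keys_iff not_less[symmetric])

lemma hpart_in_homog [simp]: "hpart n p \<in> homog n"
  by (simp add: homog_iff lookup_hpart)

lemma homog_hpart: "p \<in> homog n \<Longrightarrow> hpart n p = p"
  by (rule poly_mapping_eqI) (auto simp: homog_iff lookup_hpart)

lemma homog_hpart_other: "p \<in> homog n \<Longrightarrow> k \<noteq> n \<Longrightarrow> hpart k p = 0"
  by (rule poly_mapping_eqI) (auto simp: homog_iff lookup_hpart)

lemma homog_deg_le: "p \<in> homog n \<Longrightarrow> n \<le> k \<Longrightarrow> p \<in> deg_le k"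
  by (auto simp: homog_def deg_le_def)

lemma deg_le_mono: "p \<in> deg_le n \<Longrightarrow> n \<le> k \<Longrightarrow> p \<in> deg_le k"
  by (fastforce simp: deg_le_def)

lemma deg_le_hpart: "p \<in> deg_le n \<Longrightarrow> n < k \<Longrightarrow> hpart k p = 0"
  by (rule poly_mapping_eqI) (auto simp: deg_le_iff lookup_hpart)

lemma deg_le_diff_hpart: "p \<in> deg_le n \<Longrightarrow> p - hpart n p \<in> deg_le (n - 1)"
  by (auto simp: deg_le_iff lookup_hpart lookup_minus)

lemma deg_le_predI: "p \<in> deg_le n \<Longrightarrow> hpart n p = 0 \<Longrightarrow> p \<in> deg_le (n - 1)"
  using deg_le_diff_hpart by fastforce

lemma deg_le_negative: "p \<in> deg_le n \<Longrightarrow> n < 0 \<Longrightarrow> p = 0"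
  by (rule poly_mapping_eqI) (auto simp: deg_le_iff)

lemma homog_negative: "p \<in> homog n \<Longrightarrow> n < 0 \<Longrightarrow> p = 0"
  using homog_deg_le deg_le_negative by blast

lemma deg_le_0 [simp]: "0 \<in> deg_le n" and homog_0 [simp]: "0 \<in> homog n"
  by (simp_all add: deg_le_def homog_def)

lemma deg_le_add: "p \<in> deg_le n \<Longrightarrow> q \<in> deg_le n \<Longrightarrow> p + q \<in> deg_le n"
  and deg_le_diff: "p \<in> deg_le n \<Longrightarrow> q \<in> deg_le n \<Longrightarrow> p - q \<in> deg_le n"
  and homog_add: "p \<in> homog n \<Longrightarrow> q \<in> homog n \<Longrightarrow> p + q \<in> homog n"
  and homog_diff: "p \<in> homog n \<Longrightarrow> q \<in> homog n \<Longrightarrow> p - q \<in> homog n"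
  and deg_le_cst_mult: "p \<in> deg_le n \<Longrightarrow> cst c * p \<in> deg_le n"
  and homog_cst_mult: "p \<in> homog n \<Longrightarrow> cst c * p \<in> homog n"
  by (simp_all add: deg_le_iff homog_iff lookup_add lookup_minus lookup_cst_mult)

lemma deg_le_sum: "(\<And>x. x \<in> A \<Longrightarrow> f x \<in> deg_le n) \<Longrightarrow> sum f A \<in> deg_le n"
  by (induction A rule: infinite_finite_induct) (auto intro: deg_le_add)

lemma homog_sum: "(\<And>x. x \<in> A \<Longrightarrow> f x \<in> homog n) \<Longrightarrow> sum f A \<in> homog n"
  by (induction A rule: infinite_finite_induct) (auto intro: homog_add)

lemma homog_mult: "p \<in> homog i \<Longrightarrow> q \<in> homog j \<Longrightarrow> p * q \<in> homog (i + j)"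
  using keys_mult[of p q] by (fastforce simp: homog_def mdegree_add)

lemma deg_le_mult: "p \<in> deg_le i \<Longrightarrow> q \<in> deg_le j \<Longrightarrow> p * q \<in> deg_le (i + j)"
  using keys_mult[of p q] by (fastforce simp: deg_le_def mdegree_add)

lemma homog_1 [simp]: "1 \<in> homog 0"
  by (auto simp: homog_def)

lemma homog_cst [simp]: "cst c \<in> homog 0"
  by (auto simp: homog_def cst_def)

lemma homog_Var [simp]: "Var i \<in> homog 1"
  by (auto simp: homog_def Var_def)

lemma homog_single [simp]: "single m c \<in> homog (int (mdegree m))"
  by (auto simp: homog_def)

lemma hpart_mult:
  assumes "p \<in> deg_le i" "q \<in> deg_le j"
  shows "hpart (i + j) (p * q) = hpart i p * hpart j q"
proof -
  define p' q' where "p' = p - hpart i p" and "q' = q - hpart j q"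
  have lower: "p' \<in> deg_le (i - 1)" "q' \<in> deg_le (j - 1)"
    using assms deg_le_diff_hpart by (auto simp: p'_def q'_def)
  have eq: "p * q = hpart i p * hpart j q + p' * q + hpart i p * q'"
    by (simp add: p'_def q'_def algebra_simps)
  have "p' * q \<in> deg_le (i - 1 + j)" "hpart i p * q' \<in> deg_le (i + (j - 1))"
    using lower assms by (auto intro!: deg_le_mult intro: homog_deg_le[OF hpart_in_homog])
  then show ?thesis
    unfolding eq hpart_add by (simp add: deg_le_hpart homog_hpart homog_mult)
qed

lemma sum_hpart:
  assumes "finite N" "\<And>m. m \<in> keys p \<Longrightarrow> int (mdegree m) \<in> N"
  shows "(\<Sum>n\<in>N. hpart n p) = p"
proof (rule poly_mapping_eqI)
  fix m
  have "lookup (\<Sum>n\<in>N. hpart n p) m = (if int (mdegree m) \<in> N then lookup p m else 0)"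
    using assms(1) by (simp add: lookup_sum lookup_hpart)
  then show "lookup (\<Sum>n\<in>N. hpart n p) m = lookup p m"
    using assms(2)[of m] by (auto simp: in_keys_iff)
qed

text \<open>A polynomial is the sum of its homogeneous parts. The set \<open>D\<close> admits maps
  that are additive only on a part of the type, such as the polynomials in \<open>d\<close>
  variables or the invariants.\<close>

lemma additive_eqI_homog:
  assumes "\<And>p q. p \<in> D \<Longrightarrow> q \<in> D \<Longrightarrow> f (p + q) = f p + f q" "\<And>p q. p \<in> D \<Longrightarrow> q \<in> D \<Longrightarrow> g (p + q) = g p + (g q::'z::ab_group_add)"
    and "0 \<in> D" "\<And>p q. p \<in> D \<Longrightarrow> q \<in> D \<Longrightarrow> p + q \<in> D"
    and hpart_D: "\<And>n. hpart n p \<in> D"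
    and eq: "\<And>n. f (hpart n p) = g (hpart n p)"
  shows "f p = g p"
proof -
  define N where "N = (\<lambda>m. int (mdegree m)) ` keys p"
  have z: "f 0 = 0" "g 0 = 0" using assms(1)[of 0 0] assms(2)[of 0 0] assms(3) by simp_all
  have "(\<Sum>n\<in>M. hpart n p) \<in> D \<and> f (\<Sum>n\<in>M. hpart n p) = g (\<Sum>n\<in>M. hpart n p)" if "finite M" for M
    using that by (induction M rule: finite_induct) (simp_all add: assms z)
  moreover have "(\<Sum>n\<in>N. hpart n p) = p" by (rule sum_hpart) (auto simp: N_def)
  ultimately show ?thesis unfolding N_def by (metis finite_imageI finite_keys)
qed

lemma exists_deg_le: "\<exists>n::nat. p \<in> deg_le (int n)"
proof (intro exI)
  show "p \<in> deg_le (int (\<Sum>m\<in>keys p. mdegree m))"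
    by (auto simp: deg_le_def intro!: member_le_sum)
qed

section \<open>Auslander's theorem for a domain\<close>

locale finite_transformation_group =
  fixes G :: "('v \<Rightarrow> 'v) set"
  assumes finite_G: "finite G"
    and id_G: "id \<in> G"
    and comp_G: "g \<in> G \<Longrightarrow> h \<in> G \<Longrightarrow> g \<circ> h \<in> G"
    and inv_G: "g \<in> G \<Longrightarrow> \<exists>h\<in>G. h \<circ> g = id \<and> g \<circ> h = id"
begin

lemma sum_translate:
  assumes "g \<in> G"
  shows "(\<Sum>h\<in>G. f (g \<circ> h)) = (\<Sum>h\<in>G. (f h :: 'z::comm_monoid_add))"
proof -
  obtain k where k: "k \<in> G" "k \<circ> g = id" "g \<circ> k = id" using inv_G assms by blast
  show ?thesis
    by (rule sum.reindex_bij_witness[where i = "\<lambda>h. k \<circ> h" and j = "\<lambda>h. g \<circ> h"])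
       (use k assms comp_G in \<open>auto simp flip: comp_assoc\<close>)
qed

lemma prod_translate:
  assumes "g \<in> G"
  shows "(\<Prod>h\<in>G. f (g \<circ> h)) = (\<Prod>h\<in>G. (f h :: 'z::comm_monoid_mult))"
proof -
  obtain k where k: "k \<in> G" "k \<circ> g = id" "g \<circ> k = id" using inv_G assms by blast
  show ?thesis
    by (rule prod.reindex_bij_witness[where i = "\<lambda>h. k \<circ> h" and j = "\<lambda>h. g \<circ> h"])
       (use k assms comp_G in \<open>auto simp flip: comp_assoc\<close>)
qed

end

text \<open>The ring is a subset \<open>D\<close> of a type because the intended one consists of the
  polynomials in the first \<open>d\<close> of countably many variables; the identity of the group
  acts as the identity only there.\<close>

locale group_acting_on_domain = finite_transformation_group G
  for G :: "('v \<Rightarrow> 'v) set" +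
  fixes D :: "'a::idom set" and act :: "('v \<Rightarrow> 'v) \<Rightarrow> 'a \<Rightarrow> 'a"
  assumes one_D: "1 \<in> D"
    and add_D: "x \<in> D \<Longrightarrow> y \<in> D \<Longrightarrow> x + y \<in> D"
    and diff_D: "x \<in> D \<Longrightarrow> y \<in> D \<Longrightarrow> x - y \<in> D"
    and mult_D: "x \<in> D \<Longrightarrow> y \<in> D \<Longrightarrow> x * y \<in> D"
    and act_D: "g \<in> G \<Longrightarrow> x \<in> D \<Longrightarrow> act g x \<in> D"
    and act_add: "g \<in> G \<Longrightarrow> x \<in> D \<Longrightarrow> y \<in> D \<Longrightarrow> act g (x + y) = act g x + act g y"
    and act_mult: "g \<in> G \<Longrightarrow> x \<in> D \<Longrightarrow> y \<in> D \<Longrightarrow> act g (x * y) = act g x * act g y"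
    and act_one: "g \<in> G \<Longrightarrow> act g 1 = 1"
    and act_id: "x \<in> D \<Longrightarrow> act id x = x"
    and act_comp: "g \<in> G \<Longrightarrow> h \<in> G \<Longrightarrow> x \<in> D \<Longrightarrow> act (g \<circ> h) x = act g (act h x)"
begin

definition invariants :: "'a set"
  where "invariants = {t \<in> D. \<forall>g\<in>G. act g t = t}"

lemma zero_D: "0 \<in> D"
  using diff_D[OF one_D one_D] by simp

lemma uminus_D: "x \<in> D \<Longrightarrow> - x \<in> D"
  using diff_D[OF zero_D] by simp

lemma sum_D: "(\<And>x. x \<in> A \<Longrightarrow> f x \<in> D) \<Longrightarrow> sum f A \<in> D"
  by (induction A rule: infinite_finite_induct) (auto intro: zero_D add_D)

lemma prod_D: "(\<And>x. x \<in> A \<Longrightarrow> f x \<in> D) \<Longrightarrow> prod f A \<in> D"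
  by (induction A rule: infinite_finite_induct) (auto intro: one_D mult_D)

lemma sign_D: "(- 1) ^ n \<in> D"
  by (induction n) (auto intro: one_D uminus_D)

lemma act_zero: "g \<in> G \<Longrightarrow> act g 0 = 0"
  using act_add[of g 0 0] zero_D by (metis add_0 add_cancel_left_right)

lemma act_sum: "g \<in> G \<Longrightarrow> (\<And>x. x \<in> A \<Longrightarrow> f x \<in> D) \<Longrightarrow> act g (sum f A) = (\<Sum>x\<in>A. act g (f x))"
  by (induction A rule: infinite_finite_induct) (auto simp: act_zero act_add sum_D)

lemma act_prod: "g \<in> G \<Longrightarrow> (\<And>x. x \<in> A \<Longrightarrow> f x \<in> D) \<Longrightarrow> act g (prod f A) = (\<Prod>x\<in>A. act g (f x))"
  by (induction A rule: infinite_finite_induct) (auto simp: act_one act_mult prod_D)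

lemma trace_invariant:
  assumes "x \<in> D"
  shows "(\<Sum>h\<in>G. act h x) \<in> invariants"
proof -
  have "act g (\<Sum>h\<in>G. act h x) = (\<Sum>h\<in>G. act (g \<circ> h) x)" if "g \<in> G" for g
    using that assms by (simp add: act_sum act_D act_comp)
  then show ?thesis
    using assms by (auto simp: invariants_def sum_translate[where f = "\<lambda>h. act h x"] intro!: sum_D act_D)
qed

lemma norm_invariant:
  assumes "x \<in> D"
  shows "(\<Prod>h\<in>G. act h x) \<in> invariants"
proof -
  have "act g (\<Prod>h\<in>G. act h x) = (\<Prod>h\<in>G. act (g \<circ> h) x)" if "g \<in> G" for g
    using that assms by (simp add: act_prod act_D act_comp)
  then show ?thesis
    using assms by (auto simp: invariants_def prod_translate[where f = "\<lambda>h. act h x"] intro!: prod_D act_D)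
qed

lemma act_cancel:
  assumes "g \<in> G" "x \<in> D" "act g x = 0"
  shows "x = 0"
proof -
  obtain k where k: "k \<in> G" "k \<circ> g = id" using inv_G assms by blast
  then have "x = act k (act g x)" using assms by (metis act_comp act_id)
  then show ?thesis using assms k act_zero by simp
qed

text \<open>Dedekind's independence of characters, with the usual shortest relation replaced by an
  induction on the set of group elements that occur.\<close>

lemma act_independent:
  assumes distinct: "\<And>g h. g \<in> G \<Longrightarrow> h \<in> G \<Longrightarrow> g \<noteq> h \<Longrightarrow> \<exists>z\<in>D. act g z \<noteq> act h z"
    and "\<And>y. y \<in> D \<Longrightarrow> (\<Sum>h\<in>G. c h * act h y) = 0" "g \<in> G"
  shows "c g = 0"
proof -
  have "\<forall>g\<in>T. c g = 0"
    if "T \<subseteq> G" "\<And>y. y \<in> D \<Longrightarrow> (\<Sum>h\<in>T. c h * act h y) = 0" for T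
    using finite_subset[OF that(1) finite_G] that
  proof (induction T arbitrary: c rule: finite_induct)
    case (insert g T)
    have "c k = 0" if k: "k \<in> T" for k
    proof -
      obtain z where z: "z \<in> D" "act g z \<noteq> act k z"
        using distinct[of g k] insert k by blast
      have "\<forall>h\<in>T. c h * (act h z - act g z) = 0"
      proof (rule insert.IH)
        fix y assume y: "y \<in> D"
        \<comment> \<open>The relation at \<open>z * y\<close> minus \<open>act g z\<close> times
          the relation at \<open>y\<close>: the term of \<open>g\<close> drops out, and the
          coefficient of \<open>k\<close> gets multiplied by the nonzero factor
          \<open>act k z - act g z\<close>.\<close>
        have "(\<Sum>h\<in>insert g T. c h * act h (z * y)) - act g z * (\<Sum>h\<in>insert g T. c h * act h y) = 0"
          using insert.prems(2) y z mult_D by simp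
        moreover have "(\<Sum>h\<in>T. c h * act h (z * y)) = (\<Sum>h\<in>T. c h * act h z * act h y)"
          using insert.prems(1) y z by (intro sum.cong) (auto simp: act_mult mult.assoc)
        moreover have "act g (z * y) = act g z * act g y"
          using insert.prems(1) y z by (auto simp: act_mult)
        ultimately show "(\<Sum>h\<in>T. c h * (act h z - act g z) * act h y) = 0"
          using insert.hyps by (simp add: algebra_simps sum_distrib_left sum_subtractf)
      qed (use insert.prems in auto)
      then show ?thesis using k z by auto
    qed
    then have "\<forall>k\<in>T. c k = 0" by blast
    moreover from this have "c g = 0"
      using insert.prems(2)[OF one_D] insert.prems(1) insert.hyps act_one by simp
    ultimately show ?case by simp
  qed simp
  from this[of G] show ?thesis using assms(2,3) by auto
qed

definition represented :: "('a \<Rightarrow> 'a) \<Rightarrow> bool"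
  where "represented \<psi> \<longleftrightarrow> (\<exists>c. (\<forall>g\<in>G. c g \<in> D) \<and> (\<forall>y\<in>D. \<psi> y = (\<Sum>g\<in>G. c g * act g y)))"

definition invariant_linear :: "('a \<Rightarrow> 'a) \<Rightarrow> bool"
  where "invariant_linear \<psi> \<longleftrightarrow> (\<forall>x\<in>D. \<psi> x \<in> D) \<and> (\<forall>x\<in>D. \<forall>y\<in>D. \<psi> (x + y) = \<psi> x + \<psi> y) \<and>
    (\<forall>x\<in>D. \<forall>t\<in>invariants. \<psi> (x * t) = \<psi> x * t)"

lemma invariants_D: "t \<in> invariants \<Longrightarrow> t \<in> D"
  by (simp add: invariants_def)

lemma invariant_linear_mult:
  assumes "invariant_linear \<psi>" "f \<in> D"
  shows "invariant_linear (\<lambda>y. \<psi> (f * y))"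
  using assms by (auto simp: invariant_linear_def mult_D distrib_left invariants_D simp flip: mult.assoc)

text \<open>The product vanishes under every substitution \<open>a g \<mapsto> h (a g)\<close> of the second terms except
  \<open>h = id\<close>, so multiplication by it is a sum of maps \<open>y \<mapsto> p \<cdot> tr (q \<cdot> y)\<close>, whose traces \<open>\<psi>\<close> pulls
  out.\<close>

lemma represented_product:
  assumes \<psi>: "invariant_linear \<psi>" and a: "\<And>g. g \<in> G \<Longrightarrow> a g \<in> D"
  shows "represented (\<lambda>y. \<psi> ((\<Prod>g\<in>G - {id}. act g (a g) - a g) * y))"
proof -
  let ?T = "G - {id}"
  define f where "f = (\<Prod>g\<in>?T. act g (a g) - a g)"
  \<comment> \<open>\<open>Y\<close> is the set of factors from which the subtracted term is taken.
    \<open>p Y\<close> does not depend on \<open>h\<close>, and the rest is one application of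
    \<open>act h\<close> to \<open>q Y\<close>; this is what makes traces appear after summing over
    \<open>h\<close>.\<close>
  define p q where "p Y = (- 1) ^ card Y * (\<Prod>t\<in>?T - Y. act t (a t))" and "q Y = prod a Y" for Y
  have \<psi>_D: "x \<in> D \<Longrightarrow> \<psi> x \<in> D" and \<psi>_add: "x \<in> D \<Longrightarrow> y \<in> D \<Longrightarrow> \<psi> (x + y) = \<psi> x + \<psi> y"
    and \<psi>_inv: "x \<in> D \<Longrightarrow> t \<in> invariants \<Longrightarrow> \<psi> (x * t) = \<psi> x * t" for x y t
    using \<psi> by (auto simp: invariant_linear_def)
  have "\<psi> 0 = 0" using \<psi>_add[of 0 0] zero_D by (metis add_0 add_cancel_left_right)
  then have \<psi>_sum: "\<psi> (sum w A) = (\<Sum>x\<in>A. \<psi> (w x))" if "\<And>x. x \<in> A \<Longrightarrow> w x \<in> D" for w and A :: "('v \<Rightarrow> 'v) set set"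
    using that by (induction A rule: infinite_finite_induct) (auto simp: \<psi>_add sum_D)
  have p: "p Y \<in> D" for Y unfolding p_def using a by (intro mult_D sign_D prod_D act_D) auto
  have q: "q Y \<in> D" if "Y \<in> Pow ?T" for Y unfolding q_def using a that by (intro prod_D) auto
  have expand: "(\<Prod>t\<in>?T. act t (a t) - act h (a t)) = (\<Sum>Y\<in>Pow ?T. p Y * act h (q Y))" if "h \<in> G" for h
    unfolding p_def q_def using finite_G a that
    by (subst prod_diff_conv_sum) (auto intro!: sum.cong simp: act_prod subset_iff mult_ac)
  \<comment> \<open>For \<open>h \<noteq> id\<close> the factor \<open>t = h\<close> is zero. Hence
    \<open>f * y\<close> may be written as a sum over all of \<open>G\<close>.\<close>
  have vanish: "(\<Prod>t\<in>?T. act t (a t) - act h (a t)) = (if h = id then f else 0)" if "h \<in> G" for h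
    using that finite_G a by (auto simp: f_def act_id intro!: prod.cong)
  define c where "c h = (\<Sum>Y\<in>Pow ?T. \<psi> (p Y) * act h (q Y))" for h
  have "\<psi> (f * y) = (\<Sum>g\<in>G. c g * act g y)" if y: "y \<in> D" for y
  proof -
    have trace: "(\<Sum>h\<in>G. act h (q Y * y)) \<in> invariants" if "Y \<in> Pow ?T" for Y
      using q[OF that] y by (intro trace_invariant mult_D)
    have exchange: "(\<Sum>h\<in>G. (\<Sum>Y\<in>Pow ?T. r Y * act h (q Y)) * act h y) =
        (\<Sum>Y\<in>Pow ?T. r Y * (\<Sum>h\<in>G. act h (q Y * y)))" for r
    proof -
      have "(\<Sum>h\<in>G. (\<Sum>Y\<in>Pow ?T. r Y * act h (q Y)) * act h y) =
          (\<Sum>h\<in>G. \<Sum>Y\<in>Pow ?T. r Y * act h (q Y * y))"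
        using y q by (simp add: sum_distrib_right act_mult mult.assoc)
      also have "\<dots> = (\<Sum>Y\<in>Pow ?T. \<Sum>h\<in>G. r Y * act h (q Y * y))" by (rule sum.swap)
      finally show ?thesis by (simp add: sum_distrib_left)
    qed
    have "f * y = (\<Sum>h\<in>G. (\<Prod>t\<in>?T. act t (a t) - act h (a t)) * act h y)"
      using finite_G id_G y by (simp add: vanish act_id if_distrib[of "\<lambda>x. x * _"] cong: if_cong)
    also have "\<dots> = (\<Sum>Y\<in>Pow ?T. p Y * (\<Sum>h\<in>G. act h (q Y * y)))"
      by (simp add: expand exchange)
    also have "\<psi> \<dots> = (\<Sum>Y\<in>Pow ?T. \<psi> (p Y * (\<Sum>h\<in>G. act h (q Y * y))))"
      by (intro \<psi>_sum mult_D p invariants_D[OF trace])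
    also have "\<dots> = (\<Sum>Y\<in>Pow ?T. \<psi> (p Y) * (\<Sum>h\<in>G. act h (q Y * y)))"
      using trace p by (intro sum.cong refl \<psi>_inv)
    finally show ?thesis by (simp add: c_def exchange)
  qed
  moreover have "c g \<in> D" if "g \<in> G" for g
    unfolding c_def using p q that by (intro sum_D mult_D \<psi>_D act_D)
  ultimately show ?thesis
    unfolding represented_def f_def[symmetric] by blast
qed

text \<open>Comparing the coefficients of both representations on \<open>x \<cdot> x'\<close> shows that those of the first are
  divisible by the conjugates of \<open>x\<close>.\<close>

lemma represented_cancel:
  assumes \<psi>: "invariant_linear \<psi>"
    and distinct: "\<And>g h. g \<in> G \<Longrightarrow> h \<in> G \<Longrightarrow> g \<noteq> h \<Longrightarrow> \<exists>z\<in>D. act g z \<noteq> act h z"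
    and x: "x \<in> D" "x \<noteq> 0" and x': "x' \<in> D" "x' \<noteq> 0"
    and coprime: "\<And>u v. u \<in> D \<Longrightarrow> v \<in> D \<Longrightarrow> x * v = x' * u \<Longrightarrow> \<exists>c\<in>D. u = x * c"
    and rep: "represented (\<lambda>y. \<psi> (x * y))" and rep': "represented (\<lambda>y. \<psi> (x' * y))"
  shows "represented \<psi>"
proof -
  have \<psi>_D: "x \<in> D \<Longrightarrow> \<psi> x \<in> D" and \<psi>_add: "x \<in> D \<Longrightarrow> y \<in> D \<Longrightarrow> \<psi> (x + y) = \<psi> x + \<psi> y"
    and \<psi>_inv: "x \<in> D \<Longrightarrow> t \<in> invariants \<Longrightarrow> \<psi> (x * t) = \<psi> x * t" for x y t
    using \<psi> by (auto simp: invariant_linear_def)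
  obtain c where c: "\<And>g. g \<in> G \<Longrightarrow> c g \<in> D" "\<And>y. y \<in> D \<Longrightarrow> \<psi> (x * y) = (\<Sum>g\<in>G. c g * act g y)"
    using rep by (auto simp: represented_def)
  obtain c' where c': "\<And>g. g \<in> G \<Longrightarrow> c' g \<in> D" "\<And>y. y \<in> D \<Longrightarrow> \<psi> (x' * y) = (\<Sum>g\<in>G. c' g * act g y)"
    using rep' by (auto simp: represented_def)
  have eq: "c g * act g x' = c' g * act g x" if "g \<in> G" for g
  proof -
    have "c g * act g x' - c' g * act g x = 0"
    proof (rule act_independent[where c = "\<lambda>h. c h * act h x' - c' h * act h x"])
      fix y assume y: "y \<in> D"
      have "(\<Sum>h\<in>G. c h * act h (x' * y)) = (\<Sum>h\<in>G. c' h * act h (x * y))"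
        using x x' y c(2)[of "x' * y"] c'(2)[of "x * y"] by (simp add: mult_D mult.left_commute)
      then show "(\<Sum>h\<in>G. (c h * act h x' - c' h * act h x) * act h y) = 0"
        using x x' y by (simp add: act_mult left_diff_distrib sum_subtractf mult.assoc)
    next
      show "\<exists>z\<in>D. act g z \<noteq> act h z" if "g \<in> G" "h \<in> G" "g \<noteq> h" for g h
        using distinct that by blast
    qed (rule that)
    then show ?thesis by simp
  qed
  \<comment> \<open>Coprimality is assumed for \<open>x\<close> and \<open>x'\<close> themselves, so
    the relation between their conjugates is moved back by the inverse of \<open>g\<close>.\<close>
  have "\<exists>d\<in>D. c g = act g x * d" if g: "g \<in> G" for g
  proof -
    obtain k where k: "k \<in> G" "k \<circ> g = id" "g \<circ> k = id" using inv_G g by blast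
    have kg: "act k (act g z) = z" and gk: "act g (act k z) = z" if "z \<in> D" for z
      using that k g by (metis act_comp act_id)+
    have "x * act k (c' g) = x' * act k (c g)"
      using arg_cong[OF eq[OF g], of "act k"] g k c c' x x'
      by (simp add: act_mult act_D kg mult.commute)
    then obtain d where "d \<in> D" "act k (c g) = x * d"
      using coprime[of "act k (c g)" "act k (c' g)"] k(1) g c(1) c'(1) act_D by meson
    then have "act g d \<in> D" "c g = act g x * act g d"
      using g c x gk[of "c g"] by (auto simp: act_mult act_D)
    then show ?thesis by blast
  qed
  then obtain d where d: "\<And>g. g \<in> G \<Longrightarrow> d g \<in> D" "\<And>g. g \<in> G \<Longrightarrow> c g = act g x * d g" by metis
  have "\<psi> y = (\<Sum>g\<in>G. d g * act g y)" if y: "y \<in> D" for y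
  proof -
    \<comment> \<open>Only invariant factors pass through \<open>\<psi>\<close>. The factor
      \<open>x\<close> is therefore completed to its norm \<open>N\<close>, whose cofactor
      \<open>M\<close> is absorbed into the argument, and \<open>N\<close> is cancelled at the end
      in the domain.\<close>
    define N where "N = (\<Prod>h\<in>G. act h x)"
    have N: "N \<in> invariants" "N \<in> D" using x invariants_D by (auto simp: N_def intro: norm_invariant)
    have "N \<noteq> 0" using finite_G x act_cancel by (auto simp: N_def)
    define M where "M = (\<Prod>h\<in>G - {id}. act h x)"
    have M: "M \<in> D" "N = x * M"
      using finite_G id_G x by (auto simp: N_def M_def act_id prod.remove[of G id] intro!: prod_D act_D)
    have "\<psi> y * N = \<psi> (y * N)" using y N by (simp add: \<psi>_inv)
    also have "y * N = x * (M * y)" by (simp add: M mult_ac)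
    also have "\<psi> \<dots> = (\<Sum>g\<in>G. d g * (act g x * act g (M * y)))"
      using c(2)[of "M * y"] y M x d(2) by (simp add: mult_D mult_ac)
    also have "\<dots> = (\<Sum>g\<in>G. d g * act g (N * y))"
      using y M x by (intro sum.cong) (simp_all add: act_mult mult_D mult_ac)
    also have "\<dots> = (\<Sum>g\<in>G. d g * act g y) * N"
      using N y by (auto simp: sum_distrib_right act_mult invariants_def intro!: sum.cong)
    finally show ?thesis using \<open>N \<noteq> 0\<close> by simp
  qed
  then show ?thesis using d(1) by (auto simp: represented_def)
qed

text \<open>The induction over the remaining factors assumes a representation for every choice
  \<open>s\<close> between \<open>a\<close> and \<open>a'\<close>. To remove the factor of
  \<open>k\<close>, the choices at the other elements are frozen into a multiplier \<open>f\<close>;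
  the two choices at \<open>k\<close> then give the two representations that
  \<open>represented_cancel\<close> compares. Coprimality is stated as a consequence of a syzygy,
  the form in which it can be checked directly for linear forms.\<close>

theorem represented_if_invariant_linear:
  assumes \<psi>: "invariant_linear \<psi>"
    and distinct: "\<And>g h. g \<in> G \<Longrightarrow> h \<in> G \<Longrightarrow> g \<noteq> h \<Longrightarrow> \<exists>z\<in>D. act g z \<noteq> act h z"
    and a: "\<And>g. g \<in> G \<Longrightarrow> a g \<in> D" and a': "\<And>g. g \<in> G \<Longrightarrow> a' g \<in> D"
    and nonzero: "\<And>g. g \<in> G \<Longrightarrow> g \<noteq> id \<Longrightarrow> act g (a g) \<noteq> a g" "\<And>g. g \<in> G \<Longrightarrow> g \<noteq> id \<Longrightarrow> act g (a' g) \<noteq> a' g"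
    and coprime: "\<And>g u v. g \<in> G \<Longrightarrow> g \<noteq> id \<Longrightarrow> u \<in> D \<Longrightarrow> v \<in> D \<Longrightarrow>
      (act g (a g) - a g) * v = (act g (a' g) - a' g) * u \<Longrightarrow> \<exists>c\<in>D. u = (act g (a g) - a g) * c"
  shows "represented \<psi>"
proof -
  have peel: "represented \<psi>" if "T \<subseteq> G - {id}" "invariant_linear \<psi>"
    "\<And>s. (\<And>g. g \<in> G \<Longrightarrow> s g = a g \<or> s g = a' g) \<Longrightarrow> represented (\<lambda>y. \<psi> ((\<Prod>g\<in>T. act g (s g) - s g) * y))" for T \<psi>
    using finite_subset[OF that(1) finite_Diff[OF finite_G]] that
  proof (induction T rule: finite_induct)
    case empty
    from empty.prems(3)[of a] show ?case by simp
  next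
    case (insert k T)
    have k: "k \<in> G" "k \<noteq> id" using insert.prems by auto
    show ?case
    proof (rule insert.IH)
      fix s assume s: "\<And>g. g \<in> G \<Longrightarrow> s g = a g \<or> s g = a' g"
      define f where "f = (\<Prod>g\<in>T. act g (s g) - s g)"
      have "s g \<in> D" if "g \<in> G" for g using s[OF that] a a' that by auto
      then have f: "f \<in> D"
        using insert.prems by (auto simp: f_def intro!: prod_D diff_D act_D)
      have step: "represented (\<lambda>y. \<psi> (f * ((act k z - z) * y)))" if "z = a k \<or> z = a' k" for z
      proof -
        have "represented (\<lambda>y. \<psi> ((\<Prod>g\<in>insert k T. act g ((s(k := z)) g) - (s(k := z)) g) * y))"
          using that s by (intro insert.prems(3)) auto
        also have "(\<Prod>g\<in>insert k T. act g ((s(k := z)) g) - (s(k := z)) g) = f * (act k z - z)"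
          using insert.hyps by (auto simp: f_def mult.commute intro!: prod.cong)
        finally show ?thesis by (simp add: mult.assoc)
      qed
      show "represented (\<lambda>y. \<psi> (f * y))"
      proof (rule represented_cancel[OF invariant_linear_mult[OF insert.prems(2) f] distinct])
        show "represented (\<lambda>y. \<psi> (f * ((act k (a k) - a k) * y)))"
          and "represented (\<lambda>y. \<psi> (f * ((act k (a' k) - a' k) * y)))"
          by (simp_all add: step)
      qed (use k a a' nonzero coprime in \<open>auto intro!: diff_D act_D\<close>)
    qed (use insert.prems in auto)
  qed
  show ?thesis
    by (rule peel[OF order_refl \<psi>], rule represented_product[OF \<psi>]) (use a a' in metis)
qed

end

section \<open>The Poincare-Birkhoff-Witt theorem\<close>

text \<open>Second component of the measure for straightening: a swap at a descent keeps the length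
  and lowers this number, while a bracket term lowers the length.\<close>

fun inversions :: "nat list \<Rightarrow> nat" where
  "inversions [] = 0"
| "inversions (x # xs) = length (filter (\<lambda>y. y < x) xs) + inversions xs"

lemma inversions_swap: "c < a \<Longrightarrow> inversions (u @ c # a # v) < inversions (u @ a # c # v)"
  by (induction u) auto

definition descent :: "nat list \<Rightarrow> nat list \<times> nat \<times> nat \<times> nat list"
  where "descent w = (SOME (u, a, c, v). w = u @ a # c # v \<and> c < a)"

lemma exists_descent: "\<not> sorted w \<Longrightarrow> \<exists>u a c v. w = u @ a # c # v \<and> c < (a::nat)"
proof (induction w)
  case (Cons x w)
  show ?case
  proof (cases "sorted w")
    case True
    then obtain y v where "w = y # v" "y < x"
      using Cons.prems by (cases w) (fastforce simp: not_le)+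
    then show ?thesis by (metis append_Nil)
  next
    case False
    then show ?thesis using Cons.IH by (metis append_Cons)
  qed
qed simp

lemma descent:
  assumes "\<not> sorted w" "descent w = (u, a, c, v)"
  shows "w = u @ a # c # v \<and> c < a"
proof -
  have "\<exists>t. (\<lambda>(u, a, c, v). w = u @ a # c # v \<and> c < a) t"
    using exists_descent[OF assms(1)] by fastforce
  from someI_ex[OF this] show ?thesis
    using assms(2) by (simp add: descent_def)
qed

text \<open>Basis vectors, letters of words and polynomial variables share the same indices, the
  numbers below \<open>d\<close>.\<close>

locale lie_coordinates = lie_algebra scale bracket
  for scale :: "'k::field \<Rightarrow> 'g::ab_group_add \<Rightarrow> 'g" and bracket +
  fixes d :: nat and bv :: "nat \<Rightarrow> 'g" and coord :: "'g \<Rightarrow> nat \<Rightarrow> 'k"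
  assumes coord_add: "coord (x + y) k = coord x k + coord y k"
    and coord_scale: "coord (scale c x) k = c * coord x k"
    and bv_beyond: "d \<le> i \<Longrightarrow> bv i = 0"
    and coord_bv: "i < d \<Longrightarrow> k < d \<Longrightarrow> coord (bv i) k = (if i = k then 1 else 0)"
    and expand: "x = (\<Sum>k<d. scale (coord x k) (bv k))"
begin

lemma coord_0 [simp]: "coord 0 k = 0"
  using coord_add[of 0 0 k] by (metis add_0 add_cancel_left_left)

lemma coord_uminus: "coord (- x) k = - coord x k"
  using coord_add[of x "- x" k] by (simp add: eq_neg_iff_add_eq_0 add.commute)

lemma coord_sum: "coord (sum f A) k = (\<Sum>x\<in>A. coord (f x) k)"
  by (induction A rule: infinite_finite_induct) (simp_all add: coord_add)

lemma bracket_add_right: "bracket x (y + z) = bracket x y + bracket x z"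
  and bracket_scale_right: "bracket x (scale c y) = scale c (bracket x y)"
  and bracket_add_left: "bracket (x + y) z = bracket x z + bracket y z"
  and bracket_scale_left: "bracket (scale c x) z = scale c (bracket x z)"
  using bracket_linear_right[of x] bracket_linear_left[of z]
  by (simp_all add: Vector_Spaces.linear_iff)

lemma bracket_0_right [simp]: "bracket x 0 = 0"
  using bracket_add_right[of x 0 0] by (metis add_0 add_cancel_left_left)

lemma bracket_skew: "bracket x y = - bracket y x"
proof -
  have "bracket (x + y) (x + y) = bracket x y + bracket y x"
    unfolding bracket_add_right bracket_add_left by (simp add: bracket_alternating)
  then show ?thesis
    by (simp add: bracket_alternating eq_neg_iff_add_eq_0)
qed

lemma bracket_0_left [simp]: "bracket 0 x = 0"
  by (subst bracket_skew) simp

lemma bracket_sum_right: "bracket x (sum f A) = (\<Sum>y\<in>A. bracket x (f y))"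
  by (induction A rule: infinite_finite_induct) (simp_all add: bracket_add_right)

lemma bracket_expand_right:
  "coord (bracket x t) j = (\<Sum>k<d. coord t k * coord (bracket x (bv k)) j)"
  by (subst expand[of t]) (simp add: bracket_sum_right bracket_scale_right coord_sum coord_scale)

lemma bracket_uminus_right: "bracket x (- y) = - bracket x y"
  using bracket_add_right[of x y "- y"] by (simp add: eq_neg_iff_add_eq_0 add.commute)

text \<open>Normal form of a word in the basis vectors modulo \<open>bv a \<cdot> bv c = bv c \<cdot> bv a + [bv a, bv c]\<close>,
  with an arbitrarily chosen descent in each step.\<close>

function straighten :: "nat list \<Rightarrow> 'k mpoly" where
  "straighten w = (if sorted w then single (word_monom w) 1
     else case descent w of (u, a, c, v) \<Rightarrow> straighten (u @ c # a # v) +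
       (\<Sum>k<d. cst (coord (bracket (bv a) (bv c)) k) * straighten (u @ k # v)))"
  by auto
termination
  by (relation "measures [length, inversions]") (auto dest!: descent[OF _ sym] simp: inversions_swap)

declare straighten.simps [simp del]

text \<open>Normal form of a word with the vector \<open>t\<close> standing between the basis
  letters \<open>u\<close> and \<open>v\<close>. It expresses the bracket term of a rewriting
  step.\<close>

definition straighten_at :: "nat list \<Rightarrow> 'g \<Rightarrow> nat list \<Rightarrow> 'k mpoly"
  where "straighten_at u t v = (\<Sum>k<d. cst (coord t k) * straighten (u @ k # v))"

lemma straighten_sorted: "sorted w \<Longrightarrow> straighten w = single (word_monom w) 1"
  by (simp add: straighten.simps)

lemma straighten_descent:
  assumes "\<not> sorted w" "descent w = (u, a, c, v)"
  shows "straighten w = straighten (u @ c # a # v) + straighten_at u (bracket (bv a) (bv c)) v"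
  using assms by (subst straighten.simps) (simp add: straighten_at_def)

lemma straighten_at_add: "straighten_at u (s + t) v = straighten_at u s v + straighten_at u t v"
  by (simp add: straighten_at_def coord_add cst_add distrib_right sum.distrib)

lemma straighten_at_uminus: "straighten_at u (- t) v = - straighten_at u t v"
  by (simp add: straighten_at_def coord_uminus cst_uminus sum_negf)

lemma straighten_at_0 [simp]: "straighten_at u 0 v = 0"
  by (simp add: straighten_at_def)

text \<open>Compatibility of the normal form with one instance of the commutator relation. By
  construction it holds at the descent that \<open>straighten\<close> happens to choose; that it
  holds at every place is the confluence of the rewriting.\<close>

definition swap_ok :: "nat list \<Rightarrow> nat \<Rightarrow> nat \<Rightarrow> nat list \<Rightarrow> bool"
  where "swap_ok u a c v \<longleftrightarrow>
    straighten (u @ a # c # v) = straighten (u @ c # a # v) + straighten_at u (bracket (bv a) (bv c)) v"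

lemma swap_ok_sym: "swap_ok u c a v \<Longrightarrow> swap_ok u a c v"
  by (subst (asm) swap_ok_def, subst (asm) bracket_skew)
     (simp add: swap_ok_def straighten_at_uminus)

lemma swap_ok_refl: "swap_ok u a a v"
  by (simp add: swap_ok_def bracket_alternating)

text \<open>The relation between two basis letters extends linearly to a basis letter and a vector:
  moving \<open>x\<close> past \<open>t\<close> costs their bracket.\<close>

lemma straighten_at_letter:
  assumes "\<And>a c. swap_ok u a c v"
  shows "straighten_at (u @ [x]) t v = straighten_at u t (x # v) + straighten_at u (bracket (bv x) t) v"
proof -
  have "straighten_at u (bracket (bv x) t) v =
    (\<Sum>j<d. \<Sum>k<d. cst (coord t k) * (cst (coord (bracket (bv x) (bv k)) j) * straighten (u @ j # v)))"
    unfolding straighten_at_def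
    by (simp add: bracket_expand_right[of _ t] cst_sum cst_mult sum_distrib_right mult.assoc)
  also have "\<dots> = (\<Sum>k<d. cst (coord t k) * straighten_at u (bracket (bv x) (bv k)) v)"
    unfolding straighten_at_def sum_distrib_left by (rule sum.swap)
  also have "\<dots> = (\<Sum>k<d. cst (coord t k) * (straighten (u @ x # k # v) - straighten (u @ k # x # v)))"
  proof -
    have "straighten_at u (bracket (bv x) (bv k)) v = straighten (u @ x # k # v) - straighten (u @ k # x # v)" for k
      using assms[of x k] by (simp add: swap_ok_def)
    then show ?thesis by simp
  qed
  finally show ?thesis
    by (simp add: straighten_at_def right_diff_distrib sum_subtractf)
qed

text \<open>The overlap ambiguity of the diamond lemma. Both one-step results are rewritten further
  until their leading word is \<open>z y x\<close>, through words with fewer inversions. The bracket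
  terms left over are shorter words, and their difference is a sum of nested brackets that vanishes
  by the Jacobi identity.\<close>

lemma descents_agree_overlap:
  assumes shorter: "\<And>u' a c v'. length (u' @ a # c # v') < length (u @ x # y # z # v) \<Longrightarrow> swap_ok u' a c v'"
    and fewer: "\<And>u' a c v'. length (u' @ a # c # v') = length (u @ x # y # z # v) \<Longrightarrow>
      inversions (u' @ a # c # v') < inversions (u @ x # y # z # v) \<Longrightarrow> c < a \<Longrightarrow> swap_ok u' a c v'"
    and "z < y" "y < x"
  shows "straighten (u @ y # x # z # v) + straighten_at u (bracket (bv x) (bv y)) (z # v) =
    straighten (u @ x # z # y # v) + straighten_at (u @ [x]) (bracket (bv y) (bv z)) v"
proof -
  have inv: "inversions (u @ y # x # z # v) < inversions (u @ x # y # z # v)"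
    "inversions (u @ y # z # x # v) < inversions (u @ y # x # z # v)"
    "inversions (u @ x # z # y # v) < inversions (u @ x # y # z # v)"
    "inversions (u @ z # x # y # v) < inversions (u @ x # z # y # v)"
    using assms(3,4) inversions_swap[of y x u "z # v"] inversions_swap[of z x "u @ [y]" v]
      inversions_swap[of z y "u @ [x]" v] inversions_swap[of z x u "y # v"] by auto
  \<comment> \<open>The first two swaps lead from \<open>y x z\<close> to \<open>z y x\<close>, the
    other two from \<open>x z y\<close> to \<open>z y x\<close>.\<close>
  have "swap_ok (u @ [y]) x z v" "swap_ok u y z (x # v)" "swap_ok u x z (y # v)" "swap_ok (u @ [z]) x y v"
    using inv assms(3,4) by (auto intro!: fewer)
  moreover have letter: "straighten_at (u @ [i]) t v = straighten_at u t (i # v) + straighten_at u (bracket (bv i) t) v" for i t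
    by (rule straighten_at_letter) (simp add: shorter)
  moreover have "bracket (bv y) (bracket (bv x) (bv z)) =
      bracket (bv z) (bracket (bv x) (bv y)) + bracket (bv x) (bracket (bv y) (bv z))"
    using jacobi[of "bv x" "bv y" "bv z"] bracket_skew[of "bv z" "bv x"]
    by (simp add: bracket_uminus_right eq_neg_iff_add_eq_0 algebra_simps)
  ultimately show ?thesis
    by (simp add: swap_ok_def straighten_at_add)
qed

text \<open>Descents without a common letter can be rewritten in either order; the terms in which
  both brackets occur are the same double sum.\<close>

lemma descents_agree_disjoint:
  assumes shorter: "\<And>u' a' c' v'. length (u' @ a' # c' # v') < length (u @ x # y # m @ a # c # v) \<Longrightarrow> swap_ok u' a' c' v'"
    and fewer: "\<And>u' a' c' v'. length (u' @ a' # c' # v') = length (u @ x # y # m @ a # c # v) \<Longrightarrow>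
      inversions (u' @ a' # c' # v') < inversions (u @ x # y # m @ a # c # v) \<Longrightarrow> c' < a' \<Longrightarrow> swap_ok u' a' c' v'"
    and "y < x" "c < a"
  shows "straighten (u @ y # x # m @ a # c # v) + straighten_at u (bracket (bv x) (bv y)) (m @ a # c # v) =
    straighten (u @ x # y # m @ c # a # v) + straighten_at (u @ x # y # m) (bracket (bv a) (bv c)) v"
proof -
  let ?s = "bracket (bv x) (bv y)" and ?t = "bracket (bv a) (bv c)"
  have inv: "inversions (u @ y # x # m @ a # c # v) < inversions (u @ x # y # m @ a # c # v)"
    "inversions (u @ x # y # m @ c # a # v) < inversions (u @ x # y # m @ a # c # v)"
    using assms(3,4) inversions_swap[of y x u "m @ a # c # v"] inversions_swap[of c a "u @ x # y # m" v] by auto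
  have "swap_ok (u @ y # x # m) a c v" "swap_ok u x y (m @ c # a # v)"
    using inv assms(3,4) by (auto intro!: fewer)
  moreover
  have "swap_ok (u @ k # m) a c v" for k by (rule shorter) simp
  then have "straighten_at u ?s (m @ a # c # v) = straighten_at u ?s (m @ c # a # v) +
      (\<Sum>k<d. cst (coord ?s k) * straighten_at (u @ k # m) ?t v)"
    by (simp add: straighten_at_def[of u] swap_ok_def distrib_left sum.distrib)
  moreover
  have "swap_ok u x y (m @ k # v)" for k by (rule shorter) simp
  then have "straighten_at (u @ x # y # m) ?t v = straighten_at (u @ y # x # m) ?t v +
      (\<Sum>k<d. cst (coord ?t k) * straighten_at u ?s (m @ k # v))"
    by (simp add: straighten_at_def[of "_ @ _"] swap_ok_def distrib_left sum.distrib)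
  moreover
  have "(\<Sum>k<d. cst (coord ?t k) * straighten_at u ?s (m @ k # v)) =
      (\<Sum>k<d. cst (coord ?s k) * straighten_at (u @ k # m) ?t v)"
    unfolding straighten_at_def sum_distrib_left by (subst sum.swap) (simp add: mult.left_commute)
  ultimately show ?thesis by (simp add: swap_ok_def)
qed

text \<open>Induction on the length and, inside it, on the number of inversions. A given descent is
  compared with the one that \<open>descent\<close> selects. Letters in increasing order are covered
  by the antisymmetry of the bracket, equal letters by its being alternating.\<close>

lemma straighten_swap: "swap_ok u a c v"
proof -
  have desc: "swap_ok u a c v" if "length (u @ a # c # v) = n" "inversions (u @ a # c # v) = i" "c < a"
    and shorter: "\<And>u a c v. length (u @ a # c # v) < n \<Longrightarrow> swap_ok u a c v" for n i u a c v
    using that(1-3)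
  proof (induction i arbitrary: u a c v rule: less_induct)
    case (less i)
    define w where "w = u @ a # c # v"
    have unsorted: "\<not> sorted w" using less.prems by (auto simp: w_def sorted_append)
    obtain u' a' c' v' where desc: "descent w = (u', a', c', v')" by (metis prod_cases4)
    have w': "w = u' @ a' # c' # v'" "c' < a'" using descent[OF unsorted desc] by auto
    have fewer: "swap_ok u1 a1 c1 v1"
      if "length (u1 @ a1 # c1 # v1) = length w" "inversions (u1 @ a1 # c1 # v1) < inversions w" "c1 < a1" for u1 a1 c1 v1
      using that less by (auto simp: w_def)
    have shorter: "swap_ok u1 a1 c1 v1" if "length (u1 @ a1 # c1 # v1) < length w" for u1 a1 c1 v1
      using that less.prems by (intro shorter) (simp add: w_def)
    have agree: "straighten (u1 @ c1 # a1 # v1) + straighten_at u1 (bracket (bv a1) (bv c1)) v1 =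
        straighten (u2 @ c2 # a2 # v2) + straighten_at u2 (bracket (bv a2) (bv c2)) v2"
      if "w = u1 @ a1 # c1 # v1" "w = u2 @ a2 # c2 # v2" "c1 < a1" "c2 < a2" "length u1 \<le> length u2"
      for u1 u2 a1 a2 c1 c2 v1 v2
    proof -
      from that have "u1 @ a1 # c1 # v1 = u2 @ a2 # c2 # v2" by simp
      then obtain us where us: "u2 = u1 @ us" "a1 # c1 # v1 = us @ a2 # c2 # v2"
        using \<open>length u1 \<le> length u2\<close> by (auto simp: append_eq_append_conv2)
      \<comment> \<open>The second descent is at the same place, overlaps the first in one letter,
        or lies entirely to its right.\<close>
      consider "us = []" | "us = [a1]" "a2 = c1" "v1 = c2 # v2"
        | m where "us = a1 # c1 # m" "v1 = m @ a2 # c2 # v2"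
        using us(2) by (cases us; cases "tl us") auto
      then show ?thesis
      proof cases
        case 1
        then show ?thesis using us by simp
      next
        case 2
        have "w = u1 @ a1 # c1 # c2 # v2" using that 2 by simp
        then show ?thesis
          using descents_agree_overlap[of u1 a1 c1 c2 v2] shorter fewer that us 2 by simp
      next
        case 3
        have "w = u1 @ a1 # c1 # m @ a2 # c2 # v2" using that 3 by simp
        then show ?thesis
          using descents_agree_disjoint[of u1 a1 c1 m a2 c2 v2] shorter fewer that us 3 by simp
      qed
    qed
    have "straighten (u @ c # a # v) + straighten_at u (bracket (bv a) (bv c)) v =
        straighten (u' @ c' # a' # v') + straighten_at u' (bracket (bv a') (bv c')) v'"
      using agree[of u a c v u' a' c' v'] agree[of u' a' c' v' u a c v] less.prems w'
      by (cases "length u \<le> length u'") (auto simp: w_def)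
    then show ?case
      using straighten_descent[OF unsorted desc] by (simp add: swap_ok_def flip: w_def)
  qed
  have "swap_ok u a c v" if "length (u @ a # c # v) = n" for n u a c v
    using that
  proof (induction n arbitrary: u a c v rule: less_induct)
    case (less n)
    have step: "swap_ok u a c v" if "length (u @ a # c # v) = n" "c < a" for u a c v
      using desc[OF that(1) refl that(2)] less.IH by blast
    show ?case
    proof (cases a c rule: linorder_cases)
      case less': less
      show ?thesis by (rule swap_ok_sym, rule step) (use less' less.prems in auto)
    next
      case equal
      then show ?thesis by (simp add: swap_ok_refl)
    next
      case greater
      then show ?thesis using step less.prems by blast
    qed
  qed
  then show ?thesis by blast
qed

end

section \<open>Polynomials in the first \<open>d\<close> variables, the model of the symmetric
  algebra\<close>

definition vars_lt :: "nat \<Rightarrow> 'k::comm_ring_1 mpoly set"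
  where "vars_lt d = {p. \<forall>m\<in>keys p. keys m \<subseteq> {..<d}}"

lemma vars_lt_iff:
  "p \<in> vars_lt d \<longleftrightarrow> (\<forall>m. \<not> keys m \<subseteq> {..<d} \<longrightarrow> lookup p m = 0)"
  by (auto simp: vars_lt_def in_keys_iff)

lemma vars_lt_0 [simp]: "0 \<in> vars_lt d"
  and vars_lt_1 [simp]: "1 \<in> vars_lt d"
  and vars_lt_cst [simp]: "cst c \<in> vars_lt d"
  by (auto simp: vars_lt_def cst_def)

lemma vars_lt_Var: "i < d \<Longrightarrow> Var i \<in> vars_lt d"
  by (auto simp: vars_lt_def Var_def)

lemma vars_lt_add: "p \<in> vars_lt d \<Longrightarrow> q \<in> vars_lt d \<Longrightarrow> p + q \<in> vars_lt d"
  and vars_lt_diff: "p \<in> vars_lt d \<Longrightarrow> q \<in> vars_lt d \<Longrightarrow> p - q \<in> vars_lt d"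
  and vars_lt_hpart: "p \<in> vars_lt d \<Longrightarrow> hpart n p \<in> vars_lt d"
  by (auto simp: vars_lt_iff lookup_add lookup_minus lookup_hpart)

lemma vars_lt_mult:
  assumes "p \<in> vars_lt d" "q \<in> vars_lt d"
  shows "p * q \<in> vars_lt d"
  unfolding vars_lt_def
proof (intro CollectI ballI)
  fix m assume "m \<in> keys (p * q)"
  then obtain a b where ab: "a \<in> keys p" "b \<in> keys q" "m = a + b"
    using keys_mult[of p q] by blast
  then have "keys a \<subseteq> {..<d}" "keys b \<subseteq> {..<d}"
    using assms by (auto simp: vars_lt_def)
  then show "keys m \<subseteq> {..<d}"
    using keys_add[of a b] ab(3) by blast
qed

lemma vars_lt_sum: "(\<And>x. x \<in> A \<Longrightarrow> f x \<in> vars_lt d) \<Longrightarrow> sum f A \<in> vars_lt d"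
  by (induction A rule: infinite_finite_induct) (auto intro: vars_lt_add)

lemma vars_lt_prod_list: "(\<And>x. x \<in> set xs \<Longrightarrow> f x \<in> vars_lt d) \<Longrightarrow> (\<Prod>x\<leftarrow>xs. f x) \<in> vars_lt d"
  by (induction xs) (auto intro: vars_lt_mult)

lemma vars_lt_single: "set w \<subseteq> {..<d} \<Longrightarrow> single (word_monom w) c \<in> vars_lt d"
  by (auto simp: vars_lt_def keys_word_monom)

lemma set_sorted_word: "set (sorted_word m) = keys m"
  by (metis keys_word_monom monom_of_sorted_word)

lemma vars_lt_lext:
  assumes "\<And>m. h m \<in> vars_lt d"
  shows "lext h p \<in> vars_lt d"
  unfolding lext_def using assms by (intro vars_lt_sum vars_lt_mult) auto

lemma subst_in_vars_lt:
  assumes "\<And>i. f i \<in> vars_lt d"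
  shows "subst f p \<in> vars_lt d"
  unfolding subst_def monom_subst_def
proof (intro vars_lt_lext)
  fix m :: "nat \<Rightarrow>\<^sub>0 nat"
  have pow: "f i ^ n \<in> vars_lt d" for i n
    by (induction n) (auto intro: vars_lt_mult assms)
  have "(\<Prod>i\<in>A. f i ^ lookup m i) \<in> vars_lt d" for A
    by (induction A rule: infinite_finite_induct) (auto intro: vars_lt_mult pow)
  then show "(\<Prod>i\<in>keys m. f i ^ lookup m i) \<in> vars_lt d" .
qed

lemma subst_in_homog:
  assumes "\<And>i. f i \<in> homog 1" "p \<in> homog n"
  shows "subst f p \<in> homog n"
  unfolding subst_def lext_def
proof (rule homog_sum)
  fix m assume m: "m \<in> keys p"
  have pow: "f i ^ k \<in> homog (int k)" for i k
    by (induction k) (simp_all add: homog_mult assms(1))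
  have "(\<Prod>i\<in>A. f i ^ lookup m i) \<in> homog (int (\<Sum>i\<in>A. lookup m i))" for A
    by (induction A rule: infinite_finite_induct) (auto intro: homog_mult pow)
  then have "monom_subst f m \<in> homog (int (mdegree m))"
    by (simp add: monom_subst_def mdegree_def)
  moreover have "int (mdegree m) = n" using m assms(2) by (auto simp: homog_def)
  ultimately show "cst (lookup p m) * monom_subst f m \<in> homog n"
    by (simp add: homog_cst_mult)
qed

lemma hpart_subst:
  assumes "\<And>i. f i \<in> homog 1"
  shows "hpart n (subst f p) = subst f (hpart n p)"
proof (rule additive_eqI_homog[where D = UNIV and f = "\<lambda>p. hpart n (subst f p)" and g = "\<lambda>p. subst f (hpart n p)"])
  fix k
  have "subst f (hpart k p) \<in> homog k"
    using assms by (intro subst_in_homog) auto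
  then show "hpart n (subst f (hpart k p)) = subst f (hpart n (hpart k p))"
    by (cases "n = k") (simp_all add: homog_hpart homog_hpart_other[OF _ not_sym] homog_hpart_other[of _ k])
qed (simp_all add: subst_add hpart_add)

section \<open>Words in the free associative algebra\<close>

definition word :: "'g list \<Rightarrow> ('k::field, 'g) free_alg"
  where "word xs = single (Word xs) 1"

lemma word_append: "word (xs @ ys) = word xs * word ys"
  by (simp add: word_def mult_single plus_free_monoid_def)

lemma word_Nil [simp]: "word [] = 1"
  by (simp add: word_def flip: zero_free_monoid_def)

lemma generator_word: "generator x = word [x]"
  by (simp add: generator_def word_def)

lemma single_word: "single m c = cst c * word (letters m)"
  by (simp add: word_def cst_mult_single)

lemma lext_word: "lext h (word xs) = h (Word xs)"
  by (simp add: word_def lext_single)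

lemma free_alg_induct [case_names zero word add]:
  assumes "P 0" "\<And>c xs. P (cst c * word xs)" "\<And>p q. P p \<Longrightarrow> P q \<Longrightarrow> P (p + q)"
  shows "P p"
  by (induction p rule: poly_mapping_induct) (simp_all add: assms single_word)

lemma smult_free_algebra: "c \<odot>\<^bsub>free_algebra\<^esub> p = cst c * p"
  by (simp add: free_algebra_def cst_def mult_map_scale_conv_mult)

lemma free_algebra_simps [simp]:
  "carrier free_algebra = UNIV" "p \<otimes>\<^bsub>free_algebra\<^esub> q = p * q" "p \<oplus>\<^bsub>free_algebra\<^esub> q = p + q"
  "\<one>\<^bsub>free_algebra\<^esub> = 1" "\<zero>\<^bsub>free_algebra\<^esub> = 0"
  by (simp_all add: free_algebra_def)

lemma ring_free_algebra: "ring (free_algebra :: ('k::field, ('k, 'g) free_alg) module)"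
proof (rule ringI)
  show "abelian_group (free_algebra :: ('k, ('k, 'g) free_alg) module)"
  proof (rule abelian_groupI)
    fix x :: "('k, 'g) free_alg"
    show "\<exists>y\<in>carrier free_algebra. y \<oplus>\<^bsub>free_algebra\<^esub> x = \<zero>\<^bsub>free_algebra\<^esub>"
      by (intro bexI[of _ "- x"]) simp_all
  qed (simp_all add: ac_simps)
  show "Group.monoid (free_algebra :: ('k, ('k, 'g) free_alg) module)"
    by (rule monoidI) (simp_all add: mult.assoc)
qed (simp_all add: distrib_left distrib_right)

lemma ideal_free_algebraI:
  fixes J :: "('k::field, 'g) free_alg set"
  assumes "0 \<in> J" "\<And>p q. p \<in> J \<Longrightarrow> q \<in> J \<Longrightarrow> p + q \<in> J"
    "\<And>p q. p \<in> J \<Longrightarrow> q * p \<in> J" "\<And>p q. p \<in> J \<Longrightarrow> p * q \<in> J"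
  shows "ideal J free_algebra"
proof -
  interpret ring "free_algebra :: ('k, ('k, 'g) free_alg) module" by (rule ring_free_algebra)
  show ?thesis
  proof (rule idealI[OF ring_free_algebra])
    show "subgroup J (add_monoid free_algebra)"
    proof (rule add.subgroupI)
      fix a assume a: "a \<in> J"
      have "\<ominus>\<^bsub>free_algebra\<^esub> a = - 1 * a"
        by (rule minus_equality) simp_all
      then show "\<ominus>\<^bsub>free_algebra\<^esub> a \<in> J" using assms(3) a by metis
    qed (use assms in auto)
  qed (use assms in auto)
qed

lemma free_algebra_map_lext:
  "free_algebra_map f = (lext (\<lambda>w. word (map f (letters w))) :: ('k::field, 'g) free_alg \<Rightarrow> _)"
proof
  fix p :: "('k, 'g) free_alg"
  have "map_free_monoid f w = Word (map f (letters w))" for w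
    by (cases w) simp
  then show "free_algebra_map f p = lext (\<lambda>w. word (map f (letters w))) p"
    by (simp add: free_algebra_map_def lext_def word_def cst_mult_single)
qed

lemma free_algebra_map_word [simp]: "free_algebra_map f (word xs) = word (map f xs)"
  by (simp add: free_algebra_map_lext lext_word)

lemma free_algebra_map_add: "free_algebra_map f (p + q) = free_algebra_map f p + free_algebra_map f q"
  and free_algebra_map_diff: "free_algebra_map f (p - q) = free_algebra_map f p - free_algebra_map f q"
  and free_algebra_map_cst_mult: "free_algebra_map f (cst c * p) = cst c * free_algebra_map f p"
  and free_algebra_map_0 [simp]: "free_algebra_map f 0 = 0"
  by (simp_all add: free_algebra_map_lext lext_add lext_diff lext_cst_mult)

lemma free_algebra_map_mult: "free_algebra_map f (p * q) = free_algebra_map f p * free_algebra_map f q"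
  unfolding free_algebra_map_lext
  by (rule lext_mult) (simp add: plus_free_monoid_def word_append)

lemma free_algebra_map_1 [simp]: "free_algebra_map f 1 = 1"
  using free_algebra_map_word[of f "[]"] by simp

lemma free_algebra_map_cst [simp]: "free_algebra_map f (cst c) = cst c"
  using free_algebra_map_cst_mult[of f c 1] by simp

lemma free_algebra_map_comp: "free_algebra_map (f \<circ> h) p = free_algebra_map f (free_algebra_map h p)"
  by (induction p rule: free_alg_induct) (simp_all add: free_algebra_map_add free_algebra_map_cst_mult comp_def)

lemma free_algebra_map_id: "free_algebra_map id p = p"
  by (induction p rule: free_alg_induct) (simp_all add: free_algebra_map_add free_algebra_map_cst_mult)

text \<open>The filtration is put on the free algebra by word length; the degree of a class in the
  enveloping algebra is read off from its normal form.\<close>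

definition words_le :: "int \<Rightarrow> ('k::field, 'g) free_alg set"
  where "words_le n = {p. \<forall>w\<in>keys p. int (length (letters w)) \<le> n}"

section \<open>Normal forms modulo the enveloping ideal\<close>

context lie_coordinates
begin

abbreviation I :: "('k, 'g) free_alg set"
  where "I \<equiv> enveloping_ideal scale bracket"

lemma ideal_I: "ideal I free_algebra"
  unfolding enveloping_ideal_def by (rule ring.genideal_ideal[OF ring_free_algebra]) simp

lemma I_0: "0 \<in> I" and I_add: "p \<in> I \<Longrightarrow> q \<in> I \<Longrightarrow> p + q \<in> I"
  and I_mult_left: "p \<in> I \<Longrightarrow> q * p \<in> I" and I_mult_right: "p \<in> I \<Longrightarrow> p * q \<in> I"
  using ideal.I_l_closed[OF ideal_I] ideal.I_r_closed[OF ideal_I]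
    additive_subgroup.a_closed[OF ideal.axioms(1)[OF ideal_I]]
    additive_subgroup.zero_closed[OF ideal.axioms(1)[OF ideal_I]] by auto

lemma I_uminus: "p \<in> I \<Longrightarrow> - p \<in> I"
  using I_mult_left[of p "- 1"] by simp

lemma I_diff: "p \<in> I \<Longrightarrow> q \<in> I \<Longrightarrow> p - q \<in> I"
  using I_add[of p "- q"] by (simp add: I_uminus)

lemma I_sum: "(\<And>x. x \<in> A \<Longrightarrow> f x \<in> I) \<Longrightarrow> sum f A \<in> I"
  by (induction A rule: infinite_finite_induct) (auto intro: I_0 I_add)

lemma relation_in_I:
  "word [x + y] - word [x] - word [y] \<in> I"
  "word [scale c x] - cst c * word [x] \<in> I"
  "word [x] * word [y] - word [y] * word [x] - word [bracket x y] \<in> I"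
proof -
  have "enveloping_relations scale bracket \<subseteq> I"
    unfolding enveloping_ideal_def by (rule ring.genideal_self[OF ring_free_algebra]) simp
  then show "word [x + y] - word [x] - word [y] \<in> I"
    "word [scale c x] - cst c * word [x] \<in> I"
    "word [x] * word [y] - word [y] * word [x] - word [bracket x y] \<in> I"
    unfolding enveloping_relations_def generator_word smult_free_algebra by blast+
qed

lemma I_subset:
  assumes "ideal J free_algebra"
    and "\<And>x y. word [x + y] - word [x] - word [y] \<in> J"
    and "\<And>c x. word [scale c x] - cst c * word [x] \<in> J"
    and "\<And>x y. word [x] * word [y] - word [y] * word [x] - word [bracket x y] \<in> J"
  shows "I \<subseteq> J"
  unfolding enveloping_ideal_def using assms(2-)
  by (intro ring.genideal_minimal[OF ring_free_algebra assms(1)])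
     (auto simp: enveloping_relations_def generator_word smult_free_algebra)

text \<open>The letters of the first argument are arbitrary vectors still to be expanded in the basis; the
  second argument is the expanded prefix.\<close>

primrec expand_word :: "'g list \<Rightarrow> nat list \<Rightarrow> 'k mpoly" where
  "expand_word [] u = straighten u"
| "expand_word (x # xs) u = (\<Sum>k<d. cst (coord x k) * expand_word xs (u @ [k]))"

text \<open>Coordinates of the class of an element with respect to the sorted basis words. The map
  is linear but not multiplicative.\<close>

definition pbw :: "('k, 'g) free_alg \<Rightarrow> 'k mpoly"
  where "pbw = lext (\<lambda>w. expand_word (letters w) [])"

lemma pbw_word: "pbw (word xs) = expand_word xs []"
  by (simp add: pbw_def lext_word)

lemma pbw_add: "pbw (p + q) = pbw p + pbw q"
  and pbw_diff: "pbw (p - q) = pbw p - pbw q"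
  and pbw_cst_mult: "pbw (cst c * p) = cst c * pbw p"
  and pbw_0 [simp]: "pbw 0 = 0"
  by (simp_all add: pbw_def lext_add lext_diff lext_cst_mult)

text \<open>The letters still to be expanded only lengthen, by linearity, the context of the swap,
  so everything reduces to \<open>straighten_swap\<close>.\<close>

lemma expand_word_letters_swap:
  "expand_word ys (u @ i # j # v) = expand_word ys (u @ j # i # v) +
    (\<Sum>k<d. cst (coord (bracket (bv i) (bv j)) k) * expand_word ys (u @ k # v))"
proof (induction ys arbitrary: v)
  case Nil
  show ?case
    using straighten_swap[of u i j v] by (simp add: swap_ok_def straighten_at_def)
next
  case (Cons y ys)
  have "expand_word (y # ys) (u @ i # j # v) =
    (\<Sum>l<d. cst (coord y l) * expand_word ys (u @ i # j # v @ [l]))"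
    by simp
  also have "\<dots> = expand_word (y # ys) (u @ j # i # v) +
    (\<Sum>l<d. cst (coord y l) * (\<Sum>k<d. cst (coord (bracket (bv i) (bv j)) k) * expand_word ys (u @ k # v @ [l])))"
    by (subst Cons.IH) (simp add: distrib_left sum.distrib)
  also have "(\<Sum>l<d. cst (coord y l) * (\<Sum>k<d. cst (coord (bracket (bv i) (bv j)) k) * expand_word ys (u @ k # v @ [l]))) =
    (\<Sum>k<d. cst (coord (bracket (bv i) (bv j)) k) * expand_word (y # ys) (u @ k # v))"
    unfolding sum_distrib_left by (subst sum.swap) (simp add: sum_distrib_left mult.left_commute)
  finally show ?case .
qed

lemma bracket_expand:
  "coord (bracket x y) k = (\<Sum>i<d. \<Sum>j<d. coord x i * coord y j * coord (bracket (bv i) (bv j)) k)"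
proof -
  have sum_left: "bracket (sum f A) y = (\<Sum>x\<in>A. bracket (f x) y)" for f :: "nat \<Rightarrow> 'g" and A
    by (induction A rule: infinite_finite_induct) (simp_all add: bracket_add_left)
  have "coord (bracket x y) k = (\<Sum>i<d. coord x i * coord (bracket (bv i) y) k)"
    by (subst expand[of x]) (simp add: sum_left bracket_scale_left coord_sum coord_scale)
  then show ?thesis
    by (simp add: bracket_expand_right[of _ y] sum_distrib_left mult.assoc)
qed

text \<open>Bilinearity in \<open>x\<close> and \<open>y\<close> reduces the commutator relation for
  arbitrary vectors to pairs of basis vectors.\<close>

lemma expand_word_swap:
  "expand_word (xs @ x # y # ys) u =
    expand_word (xs @ y # x # ys) u + expand_word (xs @ bracket x y # ys) u"
proof (induction xs arbitrary: u)
  case Nil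
  let ?s = "\<lambda>i j. expand_word ys (u @ [i, j])"
  have "expand_word (x # y # ys) u = (\<Sum>i<d. \<Sum>j<d. cst (coord x i * coord y j) * ?s i j)"
    by (simp add: sum_distrib_left cst_mult mult.assoc)
  also have "\<dots> = (\<Sum>i<d. \<Sum>j<d. cst (coord x i * coord y j) * ?s j i) +
      (\<Sum>i<d. \<Sum>j<d. \<Sum>k<d. cst (coord x i * coord y j * coord (bracket (bv i) (bv j)) k) * expand_word ys (u @ [k]))"
  proof -
    have "cst (coord x i * coord y j) * ?s i j = cst (coord x i * coord y j) * ?s j i +
        (\<Sum>k<d. cst (coord x i * coord y j * coord (bracket (bv i) (bv j)) k) * expand_word ys (u @ [k]))" for i j
      using expand_word_letters_swap[of ys u i j "[]"]
      by (simp add: distrib_left sum_distrib_left cst_mult mult.assoc)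
    then have "(\<Sum>i<d. \<Sum>j<d. cst (coord x i * coord y j) * ?s i j) =
      (\<Sum>i<d. \<Sum>j<d. cst (coord x i * coord y j) * ?s j i +
        (\<Sum>k<d. cst (coord x i * coord y j * coord (bracket (bv i) (bv j)) k) * expand_word ys (u @ [k])))"
      by (intro sum.cong refl)
    then show ?thesis by (simp only: sum.distrib)
  qed
  also have "(\<Sum>i<d. \<Sum>j<d. cst (coord x i * coord y j) * ?s j i) = expand_word (y # x # ys) u"
    by (subst sum.swap) (simp add: sum_distrib_left cst_mult mult_ac)
  also have "(\<Sum>i<d. \<Sum>j<d. \<Sum>k<d. cst (coord x i * coord y j * coord (bracket (bv i) (bv j)) k) * expand_word ys (u @ [k]))
      = expand_word (bracket x y # ys) u"
  proof -
    have "expand_word (bracket x y # ys) u = (\<Sum>k<d. \<Sum>i<d. \<Sum>j<d.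
        cst (coord x i * coord y j * coord (bracket (bv i) (bv j)) k) * expand_word ys (u @ [k]))"
      by (simp add: bracket_expand[of x y] cst_sum sum_distrib_right)
    also have "\<dots> = (\<Sum>i<d. \<Sum>k<d. \<Sum>j<d.
        cst (coord x i * coord y j * coord (bracket (bv i) (bv j)) k) * expand_word ys (u @ [k]))"
      by (rule sum.swap)
    also have "\<dots> = (\<Sum>i<d. \<Sum>j<d. \<Sum>k<d.
        cst (coord x i * coord y j * coord (bracket (bv i) (bv j)) k) * expand_word ys (u @ [k]))"
      by (intro sum.cong refl sum.swap)
    finally show ?thesis by simp
  qed
  finally show ?case by simp
next
  case (Cons z xs)
  then show ?case by (simp add: distrib_left sum.distrib)
qed

lemma expand_word_add:
  "expand_word (xs @ (x + y) # ys) u = expand_word (xs @ x # ys) u + expand_word (xs @ y # ys) u"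
  by (induction xs arbitrary: u)
     (simp_all add: coord_add cst_add distrib_right distrib_left sum.distrib)

lemma expand_word_scale:
  "expand_word (xs @ scale c x # ys) u = cst c * expand_word (xs @ x # ys) u"
  by (induction xs arbitrary: u)
     (simp_all add: coord_scale cst_mult sum_distrib_left mult_ac)

lemma pbw_I:
  assumes "p \<in> I"
  shows "pbw p = 0"
proof -
  \<comment> \<open>The kernel of the merely linear map \<open>pbw\<close> is not visibly an ideal.
    \<open>J\<close> is the largest two-sided ideal inside it, so it suffices to place the defining
    relations in \<open>J\<close>, that is, to check them between arbitrary words.\<close>
  define J where "J = {z. \<forall>xs ys. pbw (word xs * z * word ys) = 0}"
  have left: "q * z \<in> J" if z: "z \<in> J" for z q
    unfolding J_def
  proof (intro CollectI allI)
    fix xs ys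
    show "pbw (word xs * (q * z) * word ys) = 0"
    proof (induction q rule: free_alg_induct)
      case (word c zs)
      have "word xs * (cst c * word zs * z) * word ys = cst c * (word (xs @ zs) * z * word ys)"
        by (simp add: word_append mult.assoc cst_left_commute)
      then show ?case using z by (simp add: J_def pbw_cst_mult)
    qed (simp_all add: distrib_left distrib_right pbw_add)
  qed
  have right: "z * q \<in> J" if z: "z \<in> J" for z q
    unfolding J_def
  proof (intro CollectI allI)
    fix xs ys
    show "pbw (word xs * (z * q) * word ys) = 0"
    proof (induction q rule: free_alg_induct)
      case (word c zs)
      have "word xs * (z * (cst c * word zs)) * word ys = cst c * (word xs * z * word (zs @ ys))"
        by (simp add: word_append mult.assoc cst_left_commute)
      then show ?case using z by (simp add: J_def pbw_cst_mult)
    qed (simp_all add: distrib_left distrib_right pbw_add)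
  qed
  have "I \<subseteq> J"
  proof (rule I_subset)
    show "ideal J free_algebra"
      using left right by (intro ideal_free_algebraI) (auto simp: J_def pbw_add distrib_left distrib_right)
    show "word [x + y] - word [x] - word [y] \<in> J" for x y
      by (simp add: J_def left_diff_distrib right_diff_distrib pbw_diff pbw_word expand_word_add flip: word_append)
    show "word [scale c x] - cst c * word [x] \<in> J" for c x
    proof -
      have "word xs * (cst c * word [x]) * word ys = cst c * word (xs @ x # ys)" for xs ys
      proof -
        have "word xs * (cst c * word [x]) * word ys = cst c * (word xs * word [x] * word ys)"
          by (simp add: mult.assoc cst_left_commute)
        also have "word xs * word [x] * word ys = (word (xs @ x # ys) :: ('k, 'g) free_alg)"
          by (simp flip: word_append)
        finally show ?thesis .
      qed
      then show ?thesis
        by (simp add: J_def left_diff_distrib right_diff_distrib pbw_diff pbw_cst_mult pbw_word expand_word_scale flip: word_append)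
    qed
    show "word [x] * word [y] - word [y] * word [x] - word [bracket x y] \<in> J" for x y
      using expand_word_swap[of _ x y _ "[]"]
      by (simp add: J_def left_diff_distrib right_diff_distrib pbw_diff pbw_word flip: word_append)
  qed
  then have "pbw (word [] * p * word []) = 0"
    using assms unfolding J_def by blast
  then show ?thesis by simp
qed

text \<open>The representative of a normal form by sorted basis words: a linear section of
  \<open>pbw\<close> on the polynomials in \<open>d\<close> variables.\<close>

definition lift :: "'k mpoly \<Rightarrow> ('k, 'g) free_alg"
  where "lift = lext (\<lambda>m. word (map bv (sorted_word m)))"

lemma lift_add: "lift (p + q) = lift p + lift q"
  and lift_cst_mult: "lift (cst c * p) = cst c * lift p"
  and lift_0 [simp]: "lift 0 = 0"
  and lift_sum: "lift (sum f A) = (\<Sum>x\<in>A. lift (f x))"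
  by (simp_all add: lift_def lext_add lext_cst_mult lext_sum)

lemma word_expand: "word [x] - (\<Sum>k<d. cst (coord x k) * word [bv k]) \<in> I"
proof -
  \<comment> \<open>In the free algebra the zero vector is a letter like any other; the additivity
    relation at \<open>0\<close> and \<open>0\<close> puts it into the ideal.\<close>
  have "word [0::'g] - word [0] - word [0] \<in> I" using relation_in_I(1)[of 0 0] by simp
  then have zero: "word [0::'g] \<in> I" using I_uminus by fastforce
  have "word [\<Sum>k\<in>A. scale (f k) (bv k)] - (\<Sum>k\<in>A. cst (f k) * word [bv k]) \<in> I" for A :: "nat set" and f
  proof (induction A rule: infinite_finite_induct)
    case (insert j A)
    have "(word [scale (f j) (bv j) + (\<Sum>k\<in>A. scale (f k) (bv k))] - word [scale (f j) (bv j)] -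
        word [\<Sum>k\<in>A. scale (f k) (bv k)]) + (word [scale (f j) (bv j)] - cst (f j) * word [bv j]) +
        (word [\<Sum>k\<in>A. scale (f k) (bv k)] - (\<Sum>k\<in>A. cst (f k) * word [bv k])) \<in> I"
      by (intro I_add relation_in_I insert.IH)
    then show ?case using insert.hyps by (simp add: algebra_simps)
  qed (simp_all add: zero)
  from this[of "coord x" "{..<d}"] show ?thesis by (simp flip: expand)
qed

lemma word_insert_expand:
  "word (xs @ x # ys) - (\<Sum>k<d. cst (coord x k) * word (xs @ bv k # ys)) \<in> I"
proof -
  have eq: "word (xs @ z # ys) = word xs * word [z] * word ys" for z
    using word_append[of "xs @ [z]" ys] by (simp add: word_append)
  have "word xs * (word [x] - (\<Sum>k<d. cst (coord x k) * word [bv k])) * word ys \<in> I"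
    by (intro I_mult_left I_mult_right word_expand)
  also have "word xs * (word [x] - (\<Sum>k<d. cst (coord x k) * word [bv k])) * word ys =
      word (xs @ x # ys) - (\<Sum>k<d. cst (coord x k) * word (xs @ bv k # ys))"
    by (simp add: eq right_diff_distrib left_diff_distrib sum_distrib_left sum_distrib_right
        cst_left_commute mult.assoc)
  finally show ?thesis .
qed

text \<open>Each rewriting step stays in the same class modulo \<open>I\<close>, by the commutator
  relation for the two letters and the expansion of their bracket in the basis. This is the spanning
  half of the Poincare-Birkhoff-Witt theorem.\<close>

lemma word_minus_lift_straighten: "word (map bv w) - lift (straighten w) \<in> I"
proof (induction w rule: straighten.induct)
  case (1 w)
  show ?case
  proof (cases "sorted w")
    case True
    then show ?thesis
      by (simp add: straighten_sorted lift_def lext_single sorted_word_word_monom I_0)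
  next
    case False
    obtain u a c v where desc: "descent w = (u, a, c, v)" by (metis prod_cases4)
    note w = descent[OF False desc]
    let ?t = "bracket (bv a) (bv c)"
    let ?W = "\<lambda>w. word (map bv w)"
    have "?W (u @ c # a # v) - lift (straighten (u @ c # a # v)) \<in> I"
      and IH2: "\<And>k. k < d \<Longrightarrow> ?W (u @ k # v) - lift (straighten (u @ k # v)) \<in> I"
      using 1[OF False] desc by auto
    moreover have "(\<Sum>k<d. cst (coord ?t k) * (?W (u @ k # v) - lift (straighten (u @ k # v)))) \<in> I"
      by (intro I_sum I_mult_left IH2) simp
    moreover have "?W (u @ a # c # v) - ?W (u @ c # a # v) - word (map bv u @ ?t # map bv v) \<in> I"
    proof -
      have "?W u * (word [bv a] * word [bv c] - word [bv c] * word [bv a] - word [?t]) * ?W v \<in> I"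
        by (intro I_mult_left I_mult_right relation_in_I)
      then show ?thesis
        by (simp add: right_diff_distrib left_diff_distrib mult.assoc flip: word_append)
    qed
    moreover have "word (map bv u @ ?t # map bv v) - (\<Sum>k<d. cst (coord ?t k) * ?W (u @ k # v)) \<in> I"
      using word_insert_expand[of "map bv u" ?t "map bv v"] by simp
    ultimately have "(?W (u @ a # c # v) - ?W (u @ c # a # v) - word (map bv u @ ?t # map bv v)) +
       (word (map bv u @ ?t # map bv v) - (\<Sum>k<d. cst (coord ?t k) * ?W (u @ k # v))) +
       (?W (u @ c # a # v) - lift (straighten (u @ c # a # v))) +
       (\<Sum>k<d. cst (coord ?t k) * (?W (u @ k # v) - lift (straighten (u @ k # v)))) \<in> I"
      by (intro I_add) simp_all
    then show ?thesis
      using straighten_descent[OF False desc] w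
      by (simp add: straighten_at_def lift_add lift_sum lift_cst_mult right_diff_distrib sum_subtractf diff_diff_eq)
  qed
qed

lemma minus_lift_pbw: "p - lift (pbw p) \<in> I"
proof (induction p rule: free_alg_induct)
  case zero
  show ?case by (simp add: I_0)
next
  case (word c xs)
  have "word (map bv u @ xs) - lift (expand_word xs u) \<in> I" for u
  proof (induction xs arbitrary: u)
    case Nil
    show ?case by (simp add: word_minus_lift_straighten)
  next
    case (Cons x xs)
    have "(word (map bv u @ x # xs) - (\<Sum>k<d. cst (coord x k) * word (map bv u @ bv k # xs))) +
        (\<Sum>k<d. cst (coord x k) * (word (map bv (u @ [k]) @ xs) - lift (expand_word xs (u @ [k])))) \<in> I"
      by (intro I_add I_sum I_mult_left Cons.IH word_insert_expand)
    then show ?case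
      by (simp add: lift_sum lift_cst_mult right_diff_distrib sum_subtractf)
  qed
  from this[of "[]"] have "cst c * (word xs - lift (pbw (word xs))) \<in> I"
    by (intro I_mult_left) (simp add: pbw_word)
  then show ?case by (simp add: pbw_cst_mult lift_cst_mult right_diff_distrib)
next
  case (add p q)
  then show ?case using I_add by (fastforce simp: pbw_add lift_add algebra_simps)
qed

text \<open>Normal forms vanish on the ideal, and every element is congruent to the lift of its
  normal form. Equality in the enveloping algebra thereby becomes equality of polynomials.\<close>

theorem pbw_eq_0_iff: "pbw p = 0 \<longleftrightarrow> p \<in> I"
  using minus_lift_pbw[of p] pbw_I[of p] by fastforce

lemma pbw_eq_iff: "pbw p = pbw q \<longleftrightarrow> p - q \<in> I"
  using pbw_eq_0_iff[of "p - q"] by (simp add: pbw_diff)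

lemma straighten_vars_lt: "set w \<subseteq> {..<d} \<Longrightarrow> straighten w \<in> vars_lt d"
proof (induction w rule: straighten.induct)
  case (1 w)
  show ?case
  proof (cases "sorted w")
    case True
    then show ?thesis using 1(3) by (simp add: straighten_sorted vars_lt_single)
  next
    case False
    obtain u a c v where desc: "descent w = (u, a, c, v)" by (metis prod_cases4)
    note w = descent[OF False desc]
    then show ?thesis
      unfolding straighten_descent[OF False desc] straighten_at_def
      using 1 False desc by (intro vars_lt_add vars_lt_sum vars_lt_mult) auto
  qed
qed

lemma expand_word_vars_lt: "set u \<subseteq> {..<d} \<Longrightarrow> expand_word xs u \<in> vars_lt d"
  by (induction xs arbitrary: u)
     (auto simp: straighten_vars_lt intro!: vars_lt_sum vars_lt_mult)

lemma pbw_vars_lt: "pbw p \<in> vars_lt d"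
  unfolding pbw_def by (intro vars_lt_lext expand_word_vars_lt) simp

lemma expand_word_basis:
  "set w \<subseteq> {..<d} \<Longrightarrow> expand_word (map bv w) u = straighten (u @ w)"
proof (induction w arbitrary: u)
  case (Cons i w)
  have "expand_word (map bv (i # w)) u = (\<Sum>k<d. if i = k then straighten (u @ i # w) else 0)"
    unfolding expand_word.simps list.map by (rule sum.cong) (use Cons in \<open>auto simp: coord_bv\<close>)
  then show ?case using Cons.prems by simp
qed simp

lemma pbw_lift:
  assumes "s \<in> vars_lt d"
  shows "pbw (lift s) = s"
proof -
  have "pbw (lift s) = lext (\<lambda>m. pbw (word (map bv (sorted_word m)))) s"
    by (simp add: pbw_def lift_def lext_lext)
  also have "\<dots> = lext (\<lambda>m. single m 1) s"
  proof (rule lext_eqI)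
    fix m assume "m \<in> keys s"
    then have "set (sorted_word m) \<subseteq> {..<d}"
      using assms by (auto simp: vars_lt_def set_sorted_word)
    then show "pbw (word (map bv (sorted_word m))) = single m 1"
      by (simp add: pbw_word expand_word_basis straighten_sorted sorted_sorted_word)
  qed
  finally show ?thesis by (simp add: lext_id)
qed

section \<open>Leading symbols in the symmetric algebra\<close>

definition lin :: "'g \<Rightarrow> 'k mpoly"
  where "lin x = (\<Sum>k<d. cst (coord x k) * Var k)"

lemma lin_vars_lt: "lin x \<in> vars_lt d"
  by (auto simp: lin_def intro!: vars_lt_sum vars_lt_mult vars_lt_Var)

lemma lin_homog: "lin x \<in> homog 1"
  by (auto simp: lin_def intro!: homog_sum homog_cst_mult)

lemma lin_add: "lin (x + y) = lin x + lin y"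
  by (simp add: lin_def coord_add cst_add distrib_right sum.distrib)

lemma lin_scale: "lin (scale c x) = cst c * lin x"
  by (simp add: lin_def coord_scale cst_mult sum_distrib_left mult.assoc)

lemma lin_0 [simp]: "lin 0 = 0"
  by (simp add: lin_def)

lemma lin_sum: "lin (sum f A) = (\<Sum>x\<in>A. lin (f x))"
  by (induction A rule: infinite_finite_induct) (simp_all add: lin_add)

lemma lin_bv: "k < d \<Longrightarrow> lin (bv k) = Var k"
proof -
  assume k: "k < d"
  have "lin (bv k) = (\<Sum>i<d. if k = i then Var k else 0)"
    unfolding lin_def using k by (intro sum.cong) (auto simp: coord_bv)
  then show ?thesis using k by simp
qed

text \<open>A swap does not change the underlying monomial, and the bracket term has one letter
  less.\<close>

lemma straighten_symbol:
  "straighten w - single (word_monom w) 1 \<in> deg_le (int (length w) - 1)"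
proof (induction w rule: straighten.induct)
  case (1 w)
  show ?case
  proof (cases "sorted w")
    case True
    then show ?thesis by (simp add: straighten_sorted)
  next
    case False
    obtain u a c v where desc: "descent w = (u, a, c, v)" by (metis prod_cases4)
    note w = descent[OF False desc]
    have "straighten (u @ c # a # v) - single (word_monom (u @ c # a # v)) 1
        \<in> deg_le (int (length (u @ c # a # v)) - 1)"
      and *: "\<And>k. k < d \<Longrightarrow> straighten (u @ k # v) - single (word_monom (u @ k # v)) 1
        \<in> deg_le (int (length (u @ k # v)) - 1)"
      using 1[OF False] desc by auto
    moreover have "word_monom (u @ c # a # v) = word_monom w"
      using w by (simp add: ac_simps)
    moreover have "straighten_at u (bracket (bv a) (bv c)) v \<in> deg_le (int (length w) - 1)"
      unfolding straighten_at_def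
    proof (intro deg_le_sum deg_le_cst_mult)
      fix k assume "k \<in> {..<d}"
      then have "straighten (u @ k # v) - single (word_monom (u @ k # v)) 1 \<in> deg_le (int (length w) - 1)"
        using w by (intro deg_le_mono[OF *]) auto
      moreover have "(single (word_monom (u @ k # v)) 1 :: 'k mpoly) \<in> deg_le (int (length w) - 1)"
        using w by (intro homog_deg_le[OF homog_single]) (simp add: mdegree_add)
      ultimately show "straighten (u @ k # v) \<in> deg_le (int (length w) - 1)"
        using deg_le_add by fastforce
    qed
    ultimately have "(straighten (u @ c # a # v) - single (word_monom w) 1) +
        straighten_at u (bracket (bv a) (bv c)) v \<in> deg_le (int (length w) - 1)"
      using w by (intro deg_le_add) auto
    then show ?thesis
      using straighten_descent[OF False desc] by (simp add: algebra_simps)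
  qed
qed

lemma expand_word_symbol:
  "expand_word xs u - single (word_monom u) 1 * (\<Prod>x\<leftarrow>xs. lin x)
    \<in> deg_le (int (length u + length xs) - 1)"
proof (induction xs arbitrary: u)
  case Nil
  show ?case using straighten_symbol by simp
next
  case (Cons x xs)
  have "(\<Sum>k<d. cst (coord x k) * (expand_word xs (u @ [k]) -
      single (word_monom (u @ [k])) 1 * (\<Prod>x\<leftarrow>xs. lin x)))
    \<in> deg_le (int (length u + length (x # xs)) - 1)"
    using Cons.IH[of "u @ [_]"] by (intro deg_le_sum deg_le_cst_mult) simp
  also have "(\<Sum>k<d. cst (coord x k) * (expand_word xs (u @ [k]) -
      single (word_monom (u @ [k])) 1 * (\<Prod>x\<leftarrow>xs. lin x))) =
      expand_word (x # xs) u - single (word_monom u) 1 * (\<Prod>x\<leftarrow>x # xs. lin x)"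
  proof -
    have eq: "cst (coord x k) * (single (word_monom (u @ [k])) 1 * p) =
        single (word_monom u) 1 * ((cst (coord x k) * Var k) * p)" for k p
    proof -
      have "cst (coord x k) * single (word_monom (u @ [k])) 1 =
          single (word_monom u) 1 * (cst (coord x k) * Var k)"
        by (simp add: Var_def cst_def mult_single)
      then show ?thesis by (simp only: mult.assoc[symmetric])
    qed
    show ?thesis
      unfolding right_diff_distrib sum_subtractf eq
      by (simp add: lin_def[of x] sum_distrib_left sum_distrib_right)
  qed
  finally show ?case .
qed

text \<open>The canonical homomorphism from the free algebra to the symmetric algebra. Unlike
  \<open>pbw\<close> it is multiplicative, and it intertwines linear maps with their substitutions;
  comparing \<open>pbw\<close> with it in top degree yields the symbols of products and of
  automorphisms.\<close>

definition abel :: "('k, 'g) free_alg \<Rightarrow> 'k mpoly"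
  where "abel = lext (\<lambda>w. \<Prod>x\<leftarrow>letters w. lin x)"

lemma abel_add: "abel (p + q) = abel p + abel q"
  and abel_cst_mult: "abel (cst c * p) = cst c * abel p"
  and abel_0 [simp]: "abel 0 = 0"
  and abel_word: "abel (word xs) = (\<Prod>x\<leftarrow>xs. lin x)"
  by (simp_all add: abel_def lext_add lext_cst_mult lext_word)

lemma abel_mult: "abel (p * q) = abel p * abel q"
  unfolding abel_def by (rule lext_mult) (simp add: plus_free_monoid_def)

lemma prod_list_lin_homog: "(\<Prod>x\<leftarrow>xs. lin x) \<in> homog (int (length xs))"
  by (induction xs) (use homog_mult[OF lin_homog] in auto)

lemma pbw_symbol:
  assumes "p \<in> words_le n"
  shows "pbw p \<in> deg_le n" "abel p \<in> deg_le n" "hpart n (pbw p) = hpart n (abel p)"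
proof -
  have *: "expand_word xs [] - (\<Prod>x\<leftarrow>xs. lin x) \<in> deg_le (n - 1) \<and> (\<Prod>x\<leftarrow>xs. lin x) \<in> deg_le n"
    if "int (length xs) \<le> n" for xs
    using expand_word_symbol[of xs "[]"] that prod_list_lin_homog[of xs]
    by (auto intro: deg_le_mono homog_deg_le)
  have "pbw p - abel p = (\<Sum>w\<in>keys p. cst (lookup p w) *
      (expand_word (letters w) [] - (\<Prod>x\<leftarrow>letters w. lin x)))"
    by (simp add: pbw_def abel_def lext_def right_diff_distrib sum_subtractf)
  also have "\<dots> \<in> deg_le (n - 1)"
    using assms * by (intro deg_le_sum deg_le_cst_mult) (auto simp: words_le_def)
  finally have diff: "pbw p - abel p \<in> deg_le (n - 1)" .
  show abel: "abel p \<in> deg_le n"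
    unfolding abel_def lext_def using assms * by (intro deg_le_sum deg_le_cst_mult) (auto simp: words_le_def)
  show "pbw p \<in> deg_le n"
    using deg_le_add[OF abel deg_le_mono[OF diff]] by simp
  show "hpart n (pbw p) = hpart n (abel p)"
    using deg_le_hpart[OF diff, of n] by (simp add: hpart_diff)
qed

lemma words_le_lift:
  assumes "s \<in> deg_le n"
  shows "lift s \<in> words_le n"
proof -
  have "keys (lift s) \<subseteq> (\<Union>m\<in>keys s. {Word (map bv (sorted_word m))})"
    unfolding lift_def lext_def word_def cst_mult_single
    by (rule order.trans[OF keys_sum]) auto
  then show ?thesis
    using assms by (auto simp: words_le_def deg_le_def)
qed

lemma words_le_mult: "p \<in> words_le i \<Longrightarrow> q \<in> words_le j \<Longrightarrow> p * q \<in> words_le (i + j)"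
  using keys_mult[of p q] by (fastforce simp: words_le_def plus_free_monoid_def)

lemma words_le_free_algebra_map: "p \<in> words_le i \<Longrightarrow> free_algebra_map f p \<in> words_le i"
proof -
  assume p: "p \<in> words_le i"
  have "keys (free_algebra_map f p) \<subseteq> (\<Union>w\<in>keys p. {Word (map f (letters w))})"
    unfolding free_algebra_map_lext lext_def word_def cst_mult_single
    by (rule order.trans[OF keys_sum]) auto
  then show ?thesis using p by (auto simp: words_le_def)
qed

definition sym_map :: "('g \<Rightarrow> 'g) \<Rightarrow> 'k mpoly \<Rightarrow> 'k mpoly"
  where "sym_map f = subst (\<lambda>k. lin (f (bv k)))"

lemma sym_map_lin:
  assumes "Vector_Spaces.linear scale scale f"
  shows "sym_map f (lin x) = lin (f x)"
proof -
  interpret f: Vector_Spaces.linear scale scale f by fact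
  have "lin (f x) = lin (\<Sum>k<d. scale (coord x k) (f (bv k)))"
    by (subst expand[of x]) (simp add: f.sum f.scale)
  then show ?thesis
    by (simp add: lin_sum lin_scale sym_map_def lin_def[of x] subst_sum subst_mult)
qed

lemma abel_free_algebra_map:
  assumes "Vector_Spaces.linear scale scale f"
  shows "abel (free_algebra_map f p) = sym_map f (abel p)"
proof (induction p rule: free_alg_induct)
  case (word c xs)
  have "sym_map f (\<Prod>x\<leftarrow>xs. lin x) = (\<Prod>x\<leftarrow>map f xs. lin x)"
  proof (induction xs)
    case Nil
    show ?case by (simp add: sym_map_def)
  next
    case (Cons x xs)
    then show ?case using sym_map_lin[OF assms, of x] by (simp add: sym_map_def subst_mult)
  qed
  then show ?case
    by (simp add: free_algebra_map_cst_mult abel_cst_mult abel_word sym_map_def subst_mult)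
qed (simp_all add: free_algebra_map_add abel_add sym_map_def subst_add)

lemma free_algebra_map_I:
  assumes f: "Vector_Spaces.linear scale scale f" "\<And>x y. f (bracket x y) = bracket (f x) (f y)"
    and "p \<in> I"
  shows "free_algebra_map f p \<in> I"
proof -
  interpret f: Vector_Spaces.linear scale scale f by fact
  have "I \<subseteq> {p. free_algebra_map f p \<in> I}"
  proof (rule I_subset)
    show "ideal {p. free_algebra_map f p \<in> I} free_algebra"
      by (rule ideal_free_algebraI)
         (auto simp: free_algebra_map_add free_algebra_map_mult I_0 intro: I_add I_mult_left I_mult_right)
  qed (auto simp: free_algebra_map_diff free_algebra_map_mult free_algebra_map_cst_mult relation_in_I
      f.add f.scale f(2))
  then show ?thesis using assms(3) by blast
qed

end

section \<open>Filtered deformations of a polynomial ring with a group action\<close>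

lemma hpart_mult_homog:
  assumes "y \<in> homog n"
  shows "hpart (k + n) (c * y) = hpart k c * y"
proof (rule additive_eqI_homog[where D = UNIV and f = "\<lambda>c. hpart (k + n) (c * y)" and g = "\<lambda>c. hpart k c * y"])
  fix i
  have "hpart i c * y \<in> homog (i + n)" using assms by (simp add: homog_mult)
  then show "hpart (k + n) (hpart i c * y) = hpart k (hpart i c) * y"
    by (cases "i = k") (auto simp: homog_hpart homog_hpart_other[of _ i k] homog_hpart_other[of _ "i + n" "k + n"])
qed (simp_all add: distrib_right hpart_add)

text \<open>What the main argument retains of the enveloping algebra: a filtered product and a
  filtered action on the polynomials in \<open>d\<close> variables, whose leading terms are the
  commutative product and the graded action \<open>act\<close>. The elements \<open>a g\<close> and
  \<open>a' g\<close> are those whose displacements under \<open>g\<close> are coprime.\<close>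

locale filtered_deformation =
  group_acting_on_domain G "vars_lt d" act
  for G :: "('v \<Rightarrow> 'v) set" and d :: nat and act :: "('v \<Rightarrow> 'v) \<Rightarrow> 'k::field_char_0 mpoly \<Rightarrow> 'k mpoly" +
  fixes star :: "'k mpoly \<Rightarrow> 'k mpoly \<Rightarrow> 'k mpoly" (infixl \<open>\<star>\<close> 70)
    and \<beta> :: "('v \<Rightarrow> 'v) \<Rightarrow> 'k mpoly \<Rightarrow> 'k mpoly"
    and a a' :: "('v \<Rightarrow> 'v) \<Rightarrow> 'k mpoly"
  assumes act_hpart: "g \<in> G \<Longrightarrow> hpart n (act g s) = act g (hpart n s)"
    and star_D: "s \<star> t \<in> vars_lt d"
    and star_add_left: "(s + s') \<star> t = s \<star> t + s' \<star> t"
    and star_add_right: "s \<star> (t + t') = s \<star> t + s \<star> t'"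
    and star_assoc: "s \<in> vars_lt d \<Longrightarrow> t \<in> vars_lt d \<Longrightarrow> r \<in> vars_lt d \<Longrightarrow>
      s \<star> t \<star> r = s \<star> (t \<star> r)"
    and star_cst: "s \<in> vars_lt d \<Longrightarrow> s \<star> cst c = cst c * s"
    and star_deg_le: "s \<in> vars_lt d \<Longrightarrow> t \<in> vars_lt d \<Longrightarrow> s \<in> deg_le i \<Longrightarrow> t \<in> deg_le j \<Longrightarrow>
      s \<star> t \<in> deg_le (i + j)"
    and star_hpart: "s \<in> vars_lt d \<Longrightarrow> t \<in> vars_lt d \<Longrightarrow> s \<in> deg_le i \<Longrightarrow> t \<in> deg_le j \<Longrightarrow>
      hpart (i + j) (s \<star> t) = hpart i s * hpart j t"
    and \<beta>_D: "\<beta> g s \<in> vars_lt d"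
    and \<beta>_add: "\<beta> g (s + t) = \<beta> g s + \<beta> g t"
    and \<beta>_cst: "g \<in> G \<Longrightarrow> \<beta> g (cst c) = cst c"
    and \<beta>_star: "g \<in> G \<Longrightarrow> \<beta> g (s \<star> t) = \<beta> g s \<star> \<beta> g t"
    and \<beta>_comp: "g \<in> G \<Longrightarrow> \<beta> (g \<circ> h) s = \<beta> g (\<beta> h s)"
    and \<beta>_deg_le: "g \<in> G \<Longrightarrow> s \<in> vars_lt d \<Longrightarrow> s \<in> deg_le n \<Longrightarrow> \<beta> g s \<in> deg_le n"
    and \<beta>_hpart: "g \<in> G \<Longrightarrow> s \<in> vars_lt d \<Longrightarrow> s \<in> deg_le n \<Longrightarrow> hpart n (\<beta> g s) = act g (hpart n s)"
    and a_D: "g \<in> G \<Longrightarrow> a g \<in> vars_lt d" and a'_D: "g \<in> G \<Longrightarrow> a' g \<in> vars_lt d"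
    and moved: "g \<in> G \<Longrightarrow> g \<noteq> id \<Longrightarrow> act g (a g) \<noteq> a g" "g \<in> G \<Longrightarrow> g \<noteq> id \<Longrightarrow> act g (a' g) \<noteq> a' g"
    and coprime: "g \<in> G \<Longrightarrow> g \<noteq> id \<Longrightarrow> u \<in> vars_lt d \<Longrightarrow> v \<in> vars_lt d \<Longrightarrow>
      (act g (a g) - a g) * v = (act g (a' g) - a' g) * u \<Longrightarrow> \<exists>c\<in>vars_lt d. u = (act g (a g) - a g) * c"
begin

abbreviation D :: "'k mpoly set"
  where "D \<equiv> vars_lt d"

lemma cst_mult_D: "s \<in> D \<Longrightarrow> cst c * s \<in> D"
  by (rule mult_D[OF vars_lt_cst])

lemma single_D: "p \<in> D \<Longrightarrow> m \<in> keys p \<Longrightarrow> single m c \<in> D"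
  by (auto simp: vars_lt_def)

lemma star_zero_left: "0 \<star> t = 0"
  using star_add_left[of 0 0 t] by simp

lemma star_sum_left: "sum f A \<star> t = (\<Sum>x\<in>A. f x \<star> t)"
  by (induction A rule: infinite_finite_induct) (auto simp: star_zero_left star_add_left)

lemma \<beta>_sum: "g \<in> G \<Longrightarrow> \<beta> g (sum f A) = (\<Sum>x\<in>A. \<beta> g (f x))"
  using \<beta>_cst[of g 0] by (induction A rule: infinite_finite_induct) (auto simp: \<beta>_add)

lemma \<beta>_cst_mult: "g \<in> G \<Longrightarrow> s \<in> D \<Longrightarrow> \<beta> g (cst c * s) = cst c * \<beta> g s"
  using \<beta>_star[of g s "cst c"] by (simp add: star_cst \<beta>_cst \<beta>_D)

lemma act_homog: "g \<in> G \<Longrightarrow> s \<in> homog n \<Longrightarrow> act g s \<in> homog n"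
  using act_hpart[of g n s] hpart_in_homog by (metis homog_hpart)

text \<open>The inverse of \<open>g\<close> composed with \<open>h\<close> is not the identity, and
  \<open>moved\<close> applies to it.\<close>

lemma act_distinct:
  assumes "g \<in> G" "h \<in> G" "g \<noteq> h"
  shows "\<exists>z\<in>D. act g z \<noteq> act h z"
proof -
  obtain k where k: "k \<in> G" "k \<circ> g = id" "g \<circ> k = id" using inv_G assms by blast
  then have "k \<circ> h \<noteq> id" using assms(3) by (metis comp_assoc comp_id id_comp)
  then have "act (k \<circ> h) (a (k \<circ> h)) \<noteq> a (k \<circ> h)" and z: "a (k \<circ> h) \<in> D"
    using moved k assms comp_G a_D by blast+
  moreover have "act (k \<circ> g) (a (k \<circ> h)) = a (k \<circ> h)" using z k act_id by simp
  ultimately show ?thesis using k assms act_comp by metis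
qed

definition fixed :: "'k mpoly set"
  where "fixed = {t \<in> D. \<forall>g\<in>G. \<beta> g t = t}"

text \<open>Averaging over the group. Every \<open>\<beta> g t\<close> has leading term
  \<open>t\<close>, so the average has it too; thus the leading terms of fixed elements exhaust the
  homogeneous invariants.\<close>

lemma invariant_lift:
  assumes "t \<in> invariants" "t \<in> homog j"
  shows "\<exists>t'\<in>fixed. t' \<in> deg_le j \<and> hpart j t' = t"
proof
  define t' where "t' = cst (1 / of_nat (card G)) * (\<Sum>g\<in>G. \<beta> g t)"
  have t: "t \<in> D" "t \<in> deg_le j" using assms invariants_D homog_deg_le by auto
  have n: "of_nat (card G) \<noteq> (0::'k)" using finite_G id_G by auto
  have sum_in: "(\<Sum>g\<in>G. \<beta> g t) \<in> D" using t by (intro sum_D \<beta>_D)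
  have "\<beta> g (\<Sum>h\<in>G. \<beta> h t) = (\<Sum>h\<in>G. \<beta> h t)" if "g \<in> G" for g
    using that t sum_translate[of g "\<lambda>h. \<beta> h t"] by (simp add: \<beta>_sum \<beta>_D \<beta>_comp)
  then show "t' \<in> fixed"
    using sum_in by (auto simp: fixed_def t'_def cst_mult_D \<beta>_cst_mult)
  have "hpart j (\<beta> g t) = t" if "g \<in> G" for g
    using that t assms by (simp add: \<beta>_hpart homog_hpart invariants_def)
  then have "hpart j t' = cst (1 / of_nat (card G)) * (of_nat (card G) * t)"
    by (simp add: t'_def hpart_cst_mult hpart_sum)
  also have "of_nat (card G) = (cst (of_nat (card G)) :: 'k mpoly)"
    by (simp add: cst_def)
  also have "cst (1 / of_nat (card G)) * (cst (of_nat (card G)) * t) = t"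
    using n by (simp flip: mult.assoc cst_mult)
  finally show "t' \<in> deg_le j \<and> hpart j t' = t"
    using t by (auto simp: t'_def intro!: deg_le_cst_mult deg_le_sum \<beta>_deg_le)
qed

theorem natural_injective:
  assumes u: "\<And>g. g \<in> G \<Longrightarrow> u g \<in> D"
    and zero: "\<And>x. x \<in> D \<Longrightarrow> (\<Sum>g\<in>G. u g \<star> \<beta> g x) = 0"
    and "g \<in> G"
  shows "u g = 0"
proof -
  \<comment> \<open>The bound is shifted by one so that \<open>n = 0\<close> stands for negative
    degree, where all coefficients are zero.\<close>
  have *: "\<forall>g\<in>G. u g = 0" if "\<forall>g\<in>G. u g \<in> deg_le (int n - 1)" for n
    using that
  proof (induction n)
    case 0
    then show ?case using deg_le_negative by fastforce
  next
    case (Suc n)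
    then have deg: "u g \<in> deg_le (int n)" if "g \<in> G" for g using that by simp
    have "hpart (int n) (u g) = 0" if "g \<in> G" for g
    proof (rule act_independent[where c = "\<lambda>g. hpart (int n) (u g)"])
      fix y assume y: "y \<in> D"
      show "(\<Sum>h\<in>G. hpart (int n) (u h) * act h y) = 0"
      proof (rule additive_eqI_homog[where D = "D" and g = "\<lambda>_. 0" and
            f = "\<lambda>y. \<Sum>h\<in>G. hpart (int n) (u h) * act h y"])
        fix k
        let ?y = "hpart k y"
        have y': "?y \<in> D" "?y \<in> deg_le k"
          using y vars_lt_hpart homog_deg_le[OF hpart_in_homog order_refl] by auto
        \<comment> \<open>On a homogeneous argument of degree \<open>k\<close>, the part of degree
          \<open>n + k\<close> of the relation only involves leading terms.\<close>
        have "0 = hpart (int n + k) (\<Sum>h\<in>G. u h \<star> \<beta> h ?y)" using zero[OF y'(1)] by simp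
        also have "\<dots> = (\<Sum>h\<in>G. hpart (int n) (u h) * act h ?y)"
          using y' u deg by (simp add: hpart_sum star_hpart \<beta>_D \<beta>_deg_le \<beta>_hpart homog_hpart)
        finally show "(\<Sum>h\<in>G. hpart (int n) (u h) * act h ?y) = 0" by simp
      qed (use y in \<open>auto simp: act_add distrib_left sum.distrib add_D vars_lt_hpart\<close>)
    next
      show "\<exists>z\<in>D. act g z \<noteq> act h z" if "g \<in> G" "h \<in> G" "g \<noteq> h" for g h
        using that by (rule act_distinct)
    qed (rule that)
    then show ?case using Suc.IH deg deg_le_predI by blast
  qed
  obtain n where n: "\<And>p :: 'k mpoly. p \<in> deg_le (int (n p))" using exists_deg_le by metis
  have "u g \<in> deg_le (int (Suc (\<Sum>g\<in>G. n (u g))) - 1)" if "g \<in> G" for g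
  proof (rule deg_le_mono[OF n])
    have "n (u g) \<le> (\<Sum>g\<in>G. n (u g))"
      using that finite_G by (intro member_le_sum[where f = "\<lambda>g. n (u g)"]) auto
    then show "int (n (u g)) \<le> int (Suc (\<Sum>g\<in>G. n (u g))) - 1" by linarith
  qed
  then show ?thesis using * assms(3) by blast
qed

definition right_linear :: "('k mpoly \<Rightarrow> 'k mpoly) \<Rightarrow> bool"
  where "right_linear \<phi> \<longleftrightarrow> (\<forall>x\<in>D. \<phi> x \<in> D) \<and>
    (\<forall>x\<in>D. \<forall>y\<in>D. \<phi> (x + y) = \<phi> x + \<phi> y) \<and>
    (\<forall>x\<in>D. \<forall>t\<in>fixed. \<phi> (x \<star> t) = \<phi> x \<star> t)"

text \<open>The bound is an integer because removing leading terms lowers it past zero.\<close>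

definition degree_bound :: "int \<Rightarrow> ('k mpoly \<Rightarrow> 'k mpoly) \<Rightarrow> bool"
  where "degree_bound M \<phi> \<longleftrightarrow> (\<forall>n. \<forall>x\<in>D \<inter> deg_le n. \<phi> x \<in> deg_le (n + M))"

context
  fixes \<phi> assumes \<phi>: "right_linear \<phi>"
begin

lemma \<phi>_D: "x \<in> D \<Longrightarrow> \<phi> x \<in> D"
  and \<phi>_add: "x \<in> D \<Longrightarrow> y \<in> D \<Longrightarrow> \<phi> (x + y) = \<phi> x + \<phi> y"
  and \<phi>_star: "x \<in> D \<Longrightarrow> t \<in> fixed \<Longrightarrow> \<phi> (x \<star> t) = \<phi> x \<star> t"
  using \<phi> by (auto simp: right_linear_def)

lemma \<phi>_zero: "\<phi> 0 = 0"
  using \<phi>_add[of 0 0] by simp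

text \<open>Right linear maps are only required to be additive; constants are fixed elements that
  act from the right as scalars.\<close>

lemma \<phi>_cst_mult: "x \<in> D \<Longrightarrow> \<phi> (cst c * x) = cst c * \<phi> x"
  using \<phi>_star[of x "cst c"] by (simp add: star_cst \<phi>_D fixed_def \<beta>_cst)

lemma \<phi>_diff: "x \<in> D \<Longrightarrow> y \<in> D \<Longrightarrow> \<phi> (x - y) = \<phi> x - \<phi> y"
  using \<phi>_add[of "x - y" y] by (simp add: diff_D)

lemma \<phi>_sum: "(\<And>x. x \<in> A \<Longrightarrow> f x \<in> D) \<Longrightarrow> \<phi> (sum f A) = (\<Sum>x\<in>A. \<phi> (f x))"
  by (induction A rule: infinite_finite_induct) (auto simp: \<phi>_zero \<phi>_add sum_D)

lemma \<phi>_lext: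
  assumes "s \<in> D"
  shows "\<phi> s = lext (\<lambda>m. \<phi> (single m 1)) s"
proof -
  have s: "s = (\<Sum>m\<in>keys s. cst (lookup s m) * single m 1)"
    using lext_id[of s] by (simp add: lext_def)
  have "\<phi> (\<Sum>m\<in>keys s. cst (lookup s m) * single m 1) =
      (\<Sum>m\<in>keys s. cst (lookup s m) * \<phi> (single m 1))"
    using assms by (subst \<phi>_sum) (auto intro!: sum.cong \<phi>_cst_mult cst_mult_D single_D)
  then show ?thesis by (simp add: lext_def flip: s)
qed

text \<open>Each monomial goes to the part of its image that lies exactly \<open>M\<close> degrees
  higher. Under \<open>degree_bound M\<close> this is the associated graded map.\<close>

definition symbol :: "int \<Rightarrow> 'k mpoly \<Rightarrow> 'k mpoly"
  where "symbol M = lext (\<lambda>m. hpart (int (mdegree m) + M) (\<phi> (single m 1)))"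

lemma symbol_hpart:
  assumes M: "degree_bound M \<phi>" and x: "x \<in> D" "x \<in> deg_le n"
  shows "symbol M (hpart n x) = hpart (n + M) (\<phi> x)"
proof -
  let ?y = "hpart n x"
  have y: "?y \<in> D" using x by (simp add: vars_lt_hpart)
  have "symbol M ?y = lext (\<lambda>m. hpart (n + M) (\<phi> (single m 1))) ?y"
    unfolding symbol_def
  proof (rule lext_eqI)
    fix m assume "m \<in> keys ?y"
    then show "hpart (int (mdegree m) + M) (\<phi> (single m 1)) = hpart (n + M) (\<phi> (single m 1))"
      using hpart_in_homog[of n x] by (simp add: homog_def)
  qed
  also have "\<dots> = hpart (n + M) (\<phi> ?y)"
    by (subst \<phi>_lext[OF y]) (simp add: lext_def hpart_sum hpart_cst_mult)
  also have "\<dots> = hpart (n + M) (\<phi> x)"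
  proof -
    have "\<phi> (x - ?y) \<in> deg_le (n - 1 + M)"
    proof -
      have "x - ?y \<in> D \<inter> deg_le (n - 1)" using x y deg_le_diff_hpart diff_D by blast
      then show ?thesis using M unfolding degree_bound_def by blast
    qed
    then have "hpart (n + M) (\<phi> (x - ?y)) = 0" by (rule deg_le_hpart) simp
    then show ?thesis using x y by (simp add: \<phi>_diff hpart_diff)
  qed
  finally show ?thesis .
qed

text \<open>A homogeneous invariant \<open>t\<close> lifts to a fixed element \<open>t'\<close>, and
  the top-degree part of \<open>\<phi> (s \<star> t') = \<phi> s \<star> t'\<close> is the claim for
  homogeneous \<open>s\<close>. The general case splits both arguments into homogeneous parts; those
  of an invariant are invariant because the action preserves degrees.\<close>

lemma symbol_invariant_linear:
  assumes M: "degree_bound M \<phi>"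
  shows "invariant_linear (symbol M)"
  unfolding invariant_linear_def
proof (intro conjI ballI)
  fix x assume x: "x \<in> D"
  show "symbol M x \<in> D"
    unfolding symbol_def lext_def
    using x by (intro sum_D cst_mult_D vars_lt_hpart \<phi>_D single_D)
  show "symbol M (x + y) = symbol M x + symbol M y" for y
    by (simp add: symbol_def lext_add)
  fix t assume t: "t \<in> invariants"
  have homog: "symbol M (s * t) = symbol M s * t"
    if s: "s \<in> D" "s \<in> homog i" and t: "t \<in> invariants" "t \<in> homog j" for s t i j
  proof -
    obtain t' where t': "t' \<in> fixed" "t' \<in> deg_le j" "hpart j t' = t" using invariant_lift t by blast
    then have t'_D: "t' \<in> D" by (simp add: fixed_def)
    have si: "s \<in> deg_le i" "hpart i s = s" using s homog_deg_le homog_hpart by auto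
    have \<phi>s: "\<phi> s \<in> D" "\<phi> s \<in> deg_le (i + M)" using M s si \<phi>_D by (auto simp: degree_bound_def)
    have "s * t = hpart (i + j) (s \<star> t')" using s t' t'_D si by (simp add: star_hpart)
    then have "symbol M (s * t) = hpart (i + j + M) (\<phi> (s \<star> t'))"
      using s t' t'_D si symbol_hpart[OF M star_D] star_deg_le by simp
    also have "\<dots> = hpart (i + M + j) (\<phi> s \<star> t')" using s t' by (simp add: \<phi>_star ac_simps)
    also have "\<dots> = hpart (i + M) (\<phi> s) * t" using \<phi>s t' t'_D by (simp add: star_hpart)
    also have "hpart (i + M) (\<phi> s) = symbol M s" using symbol_hpart[OF M s(1) si(1)] si by simp
    finally show ?thesis .
  qed
  have hpart_inv: "hpart j t \<in> invariants" if "t \<in> invariants" for t j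
    using that by (auto simp: invariants_def vars_lt_hpart) (metis act_hpart)
  show "symbol M (x * t) = symbol M x * t"
  proof (rule additive_eqI_homog[where D = "D" and f = "\<lambda>x. symbol M (x * t)" and g = "\<lambda>x. symbol M x * t"])
    fix i
    show "symbol M (hpart i x * t) = symbol M (hpart i x) * t"
    proof (rule additive_eqI_homog[where D = invariants and f = "\<lambda>t. symbol M (hpart i x * t)" and g = "\<lambda>t. symbol M (hpart i x) * t"])
      show "symbol M (hpart i x * hpart j t) = symbol M (hpart i x) * hpart j t" for j
        by (rule homog[where i = i and j = j]) (auto simp: x t hpart_inv vars_lt_hpart)
      show "s + r \<in> invariants" if "s \<in> invariants" "r \<in> invariants" for s r
        using that by (auto simp: invariants_def act_add add_D)
      show "0 \<in> invariants" by (auto simp: invariants_def act_zero)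
    qed (use t in \<open>auto simp: symbol_def distrib_left lext_add hpart_inv\<close>)
  qed (use x in \<open>auto simp: symbol_def distrib_right lext_add add_D vars_lt_hpart\<close>)
qed

lemma leading_term:
  assumes M: "degree_bound M \<phi>"
  shows "\<exists>u. (\<forall>g\<in>G. u g \<in> D \<and> u g \<in> homog M) \<and>
    degree_bound (M - 1) (\<lambda>x. \<phi> x - (\<Sum>g\<in>G. u g \<star> \<beta> g x))"
proof -
  have "represented (symbol M)"
    by (rule represented_if_invariant_linear[OF symbol_invariant_linear[OF M], where a = a and a' = a'])
       (use act_distinct a_D a'_D moved coprime in auto)
  then obtain c where c: "\<And>g. g \<in> G \<Longrightarrow> c g \<in> D"
    "\<And>y. y \<in> D \<Longrightarrow> symbol M y = (\<Sum>g\<in>G. c g * act g y)"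
    by (auto simp: represented_def)
  \<comment> \<open>The representation of the symbol may have coefficients of mixed degrees. Since
    the symbol raises degrees by exactly \<open>M\<close>, their parts of degree \<open>M\<close>
    already represent it.\<close>
  define u where "u g = hpart M (c g)" for g
  have u: "u g \<in> D" "u g \<in> homog M" if "g \<in> G" for g
    using that c by (auto simp: u_def vars_lt_hpart)
  have "\<phi> x - (\<Sum>g\<in>G. u g \<star> \<beta> g x) \<in> deg_le (n + (M - 1))"
    if x: "x \<in> D" "x \<in> deg_le n" for x n
  proof -
    have "u g \<star> \<beta> g x \<in> deg_le (n + M)" if "g \<in> G" for g
      using that x u star_deg_le[of "u g" "\<beta> g x" M n]
homog_deg_le[OF u(2)[OF that] order_refl]
      by (simp add: \<beta>_D \<beta>_deg_le add.commute)
    moreover have "\<phi> x \<in> deg_le (n + M)" using M x by (simp add: degree_bound_def)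
    ultimately have "\<phi> x - (\<Sum>g\<in>G. u g \<star> \<beta> g x) \<in> deg_le (n + M)"
      by (intro deg_le_diff deg_le_sum)
    moreover have "hpart (n + M) (\<phi> x) = (\<Sum>g\<in>G. hpart (n + M) (u g \<star> \<beta> g x))"
    proof -
      have y: "act g (hpart n x) \<in> homog n" if "g \<in> G" for g using that by (simp add: act_homog)
      have "hpart (n + M) (\<phi> x) = hpart (n + M) (symbol M (hpart n x))"
        using symbol_hpart[OF M x] by (simp add: homog_hpart)
      also have "\<dots> = (\<Sum>g\<in>G. hpart (M + n) (c g * act g (hpart n x)))"
        using x by (simp add: c vars_lt_hpart hpart_sum add.commute)
      also have "\<dots> = (\<Sum>g\<in>G. u g * act g (hpart n x))"
        unfolding u_def by (intro sum.cong refl hpart_mult_homog y)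
      also have "\<dots> = (\<Sum>g\<in>G. hpart (M + n) (u g \<star> \<beta> g x))"
      proof (rule sum.cong[OF refl])
        fix g assume g: "g \<in> G"
        show "u g * act g (hpart n x) = hpart (M + n) (u g \<star> \<beta> g x)"
          using g x u[OF g] star_hpart[of "u g" "\<beta> g x" M n] homog_deg_le[OF u(2)[OF g] order_refl]
          by (simp add: \<beta>_D \<beta>_deg_le \<beta>_hpart homog_hpart)
      qed
      finally show ?thesis by (simp add: add.commute)
    qed
    then have "hpart (n + M) (\<phi> x - (\<Sum>g\<in>G. u g \<star> \<beta> g x)) = 0"
      by (simp add: hpart_diff hpart_sum)
    ultimately show ?thesis
      using deg_le_predI by (simp add: add_diff_eq)
  qed
  then show ?thesis using u by (intro exI[of _ u]) (auto simp: degree_bound_def)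
qed

end

lemma right_linear_natural:
  assumes u: "\<And>g. g \<in> G \<Longrightarrow> u g \<in> D"
  shows "right_linear (\<lambda>x. \<Sum>g\<in>G. u g \<star> \<beta> g x)"
  unfolding right_linear_def
proof (intro conjI ballI)
  fix x t assume x: "x \<in> D" and t: "t \<in> fixed"
  then show "(\<Sum>g\<in>G. u g \<star> \<beta> g (x \<star> t)) = (\<Sum>g\<in>G. u g \<star> \<beta> g x) \<star> t"
    using u by (simp add: fixed_def star_sum_left star_D \<beta>_D \<beta>_star star_assoc)
qed (auto simp: u \<beta>_D star_D \<beta>_add star_add_right sum.distrib intro!: sum_D)

lemma right_linear_diff:
  assumes "right_linear \<phi>" "right_linear \<psi>"
  shows "right_linear (\<lambda>x. \<phi> x - \<psi> x)"
  unfolding right_linear_def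
proof (intro conjI ballI)
  fix x t assume x: "x \<in> D" and t: "t \<in> fixed"
  then have "(\<phi> x - \<psi> x) \<star> t + \<psi> x \<star> t = \<phi> x \<star> t"
    using assms star_add_left[of "\<phi> x - \<psi> x" "\<psi> x" t]
    by (simp add: right_linear_def diff_D fixed_def)
  then have "(\<phi> x - \<psi> x) \<star> t = \<phi> x \<star> t - \<psi> x \<star> t" by (simp add: eq_diff_eq)
  then show "\<phi> (x \<star> t) - \<psi> (x \<star> t) = (\<phi> x - \<psi> x) \<star> t"
    using assms x t by (simp add: right_linear_def)
qed (use assms in \<open>auto simp: right_linear_def diff_D\<close>)

text \<open>For a negative bound the leading coefficients are homogeneous of negative degree, hence
  zero. The symbol therefore vanishes and the bound can be lowered by one indefinitely.\<close>

lemma negative_degree_bound: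
  assumes \<phi>: "right_linear \<phi>" and "degree_bound (-1) \<phi>" and x: "x \<in> D"
  shows "\<phi> x = 0"
proof -
  have bound: "degree_bound (- 1 - int k) \<phi>" for k
  proof (induction k)
    case (Suc k)
    obtain u where u: "\<And>g. g \<in> G \<Longrightarrow> u g \<in> homog (- 1 - int k)"
      "degree_bound (- 1 - int k - 1) (\<lambda>x. \<phi> x - (\<Sum>g\<in>G. u g \<star> \<beta> g x))"
      using leading_term[OF \<phi> Suc.IH] by blast
    have "u g = 0" if "g \<in> G" for g by (rule homog_negative[OF u(1)[OF that]]) simp
    then have eq: "(\<Sum>g\<in>G. u g \<star> \<beta> g x) = 0" if "x \<in> D" for x
      using that by (simp add: star_zero_left \<beta>_D)
    show ?case
      unfolding degree_bound_def
    proof (intro allI ballI)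
      fix n x assume x: "x \<in> D \<inter> deg_le n"
      then have "\<phi> x - (\<Sum>g\<in>G. u g \<star> \<beta> g x) \<in> deg_le (n + (- 1 - int k - 1))"
        using u(2) unfolding degree_bound_def by blast
      then show "\<phi> x \<in> deg_le (n + (- 1 - int (Suc k)))"
        using x by (simp add: eq algebra_simps)
    qed
  qed (use assms(2) in simp)
  \<comment> \<open>With \<open>k = n\<close> the bound places \<open>\<phi> x\<close> in degree at
    most \<open>-1\<close>.\<close>
  obtain n where "x \<in> deg_le (int n)" using exists_deg_le by blast
  then have "\<phi> x \<in> deg_le (int n + (- 1 - int n))" using bound[of n] x unfolding degree_bound_def by blast
  then show ?thesis using deg_le_negative by force
qed

text \<open>Induction on the bound, shifted so that the base case is the bound \<open>-1\<close>;
  each step subtracts a natural map with the same leading symbol.\<close>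

lemma natural_surjective_bounded:
  assumes "right_linear \<phi>" "degree_bound (int N - 1) \<phi>"
  shows "\<exists>u. (\<forall>g\<in>G. u g \<in> D) \<and> (\<forall>x\<in>D. \<phi> x = (\<Sum>g\<in>G. u g \<star> \<beta> g x))"
  using assms
proof (induction N arbitrary: \<phi>)
  case 0
  then have "\<phi> x = 0" if "x \<in> D" for x
    using that negative_degree_bound by simp
  then show ?case by (intro exI[of _ "\<lambda>_. 0"]) (simp add: star_zero_left \<beta>_D)
next
  case (Suc N)
  then have "degree_bound (int N) \<phi>" by simp
  from leading_term[OF Suc.prems(1) this] obtain u where u: "\<And>g. g \<in> G \<Longrightarrow> u g \<in> D"
    "degree_bound (int N - 1) (\<lambda>x. \<phi> x - (\<Sum>g\<in>G. u g \<star> \<beta> g x))"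
    by blast
  have "right_linear (\<lambda>x. \<phi> x - (\<Sum>g\<in>G. u g \<star> \<beta> g x))"
    using Suc.prems u by (intro right_linear_diff right_linear_natural)
  from Suc.IH[OF this u(2)] obtain v where v: "\<And>g. g \<in> G \<Longrightarrow> v g \<in> D"
    "\<And>x. x \<in> D \<Longrightarrow> \<phi> x - (\<Sum>g\<in>G. u g \<star> \<beta> g x) = (\<Sum>g\<in>G. v g \<star> \<beta> g x)"
    by blast
  then have "\<phi> x = (\<Sum>g\<in>G. (v g + u g) \<star> \<beta> g x)" if "x \<in> D" for x
    using that u by (simp add: star_add_left \<beta>_D sum.distrib flip: v(2))
  then show ?case using u v by (intro exI[of _ "\<lambda>g. v g + u g"]) (auto simp: add_D)
qed

text \<open>The part of degree \<open>n\<close> of the ideal generated by the homogeneous invariants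
  of positive degree. The cofactors are homogeneous of lower degree, so that an induction on the
  degree applies to them.\<close>

inductive_set decomposable :: "int \<Rightarrow> 'k mpoly set" for n where
  decomposable_0: "0 \<in> decomposable n"
| decomposable_add: "y \<in> decomposable n \<Longrightarrow> z \<in> decomposable n \<Longrightarrow> y + z \<in> decomposable n"
| decomposable_term: "s \<in> D \<Longrightarrow> s \<in> homog (n - j) \<Longrightarrow> t \<in> invariants \<Longrightarrow> t \<in> homog j \<Longrightarrow> 1 \<le> j \<Longrightarrow>
    s * t \<in> decomposable n"

lemma decomposable_sum: "(\<And>x. x \<in> A \<Longrightarrow> f x \<in> decomposable n) \<Longrightarrow> sum f A \<in> decomposable n"
  by (induction A rule: infinite_finite_induct) (auto intro: decomposable_0 decomposable_add)

lemma decomposable_mult: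
  assumes "y \<in> decomposable n" "r \<in> D" "r \<in> homog k"
  shows "r * y \<in> decomposable (k + n)"
  using assms(1)
proof induction
  case (decomposable_term s j t)
  have "r * s \<in> homog (k + n - j)"
    using homog_mult[OF assms(3) decomposable_term(2)] by (simp add: add_diff_eq)
  then have "r * s * t \<in> decomposable (k + n)"
    using decomposable_term assms(2) by (intro decomposable.decomposable_term mult_D)
  then show ?case by (simp add: mult.assoc)
qed (simp_all add: decomposable_0 decomposable_add distrib_left)

text \<open>Expand \<open>\<Prod>t\<in>G. c t - h (t\<inverse> (c t))\<close>, which is zero for every \<open>h\<close> because of the factor
  \<open>t = h\<close>, and sum over \<open>h\<close>.\<close>

lemma prod_decomposable:
  assumes c: "\<And>g. g \<in> G \<Longrightarrow> c g \<in> D" "\<And>g. g \<in> G \<Longrightarrow> c g \<in> homog 1"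
  shows "(\<Prod>g\<in>G. c g) \<in> decomposable (int (card G))"
proof -
  obtain k where k: "\<And>g. g \<in> G \<Longrightarrow> k g \<in> G \<and> k g \<circ> g = id \<and> g \<circ> k g = id" using inv_G by metis
  define e where "e g = act (k g) (c g)" for g
  have e: "e g \<in> D" "e g \<in> homog 1" "act g (e g) = c g" if "g \<in> G" for g
    using that k c by (auto simp: e_def act_D act_homog act_id simp flip: act_comp)
  define p q where "p Y = (- 1) ^ card Y * prod c (G - Y)" and "q Y = prod e Y" for Y
  have prod_homog: "prod w Y \<in> homog (int (card Y))" if "Y \<subseteq> G" "\<And>g. g \<in> Y \<Longrightarrow> w g \<in> homog 1" for w Y
    using finite_subset[OF that(1) finite_G] that
    by (induction Y rule: finite_induct) (auto intro!: homog_mult)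
  have "(- 1) ^ n \<in> (homog 0 :: 'k mpoly set)" for n
    using homog_cst[of "(- 1) ^ n"] by (induction n) (auto intro: homog_diff[OF homog_0, simplified])
  then have p: "p Y \<in> D" "p Y \<in> homog (int (card G) - int (card Y))" if "Y \<subseteq> G" for Y
    using homog_mult[of _ 0 _ "int (card G) - int (card Y)"] prod_homog[of "G - Y" c] c that finite_G
    by (auto simp: p_def card_Diff_subset finite_subset of_nat_diff card_mono intro!: mult_D sign_D prod_D)
  have q: "q Y \<in> D" "q Y \<in> homog (int (card Y))" if "Y \<subseteq> G" for Y
    using that e prod_homog[of Y e] by (auto simp: q_def intro!: prod_D)
  have zero: "(\<Sum>Y\<in>Pow G. p Y * act h (q Y)) = 0" if h: "h \<in> G" for h
  proof -
    have "(\<Prod>t\<in>G. c t - act h (e t)) = (\<Sum>Y\<in>Pow G. p Y * act h (q Y))"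
      unfolding p_def q_def using finite_G e h
      by (subst prod_diff_conv_sum) (auto intro!: sum.cong simp: act_prod subset_iff mult_ac)
    moreover have "(\<Prod>t\<in>G. c t - act h (e t)) = 0"
      using finite_G e h by (intro prod_zero bexI[of _ h]) auto
    ultimately show ?thesis by simp
  qed
  \<comment> \<open>The term \<open>Y = {}\<close> contributes \<open>card G\<close> times the
    product in question, and every other term is a multiple of a trace of positive degree. This is
    the averaging argument behind Noether's degree bound.\<close>
  define r where "r = (\<Sum>Y\<in>Pow G - {{}}. p Y * (\<Sum>h\<in>G. act h (q Y)))"
  have "(\<Sum>Y\<in>Pow G. p Y * (\<Sum>h\<in>G. act h (q Y))) = (\<Sum>h\<in>G. \<Sum>Y\<in>Pow G. p Y * act h (q Y))"
    unfolding sum_distrib_left by (rule sum.swap)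
  then have "p {} * (\<Sum>h\<in>G. act h (q {})) + r = 0"
    using finite_G zero by (simp add: r_def sum.remove[of "Pow G" "{}"])
  then have "of_nat (card G) * prod c G = - r"
    by (simp add: p_def q_def act_one mult.commute eq_neg_iff_add_eq_0)
  moreover have "of_nat (card G) \<noteq> (0::'k)" using finite_G id_G by auto
  then have "prod c G = cst (1 / of_nat (card G)) * (cst (of_nat (card G)) * prod c G)"
    by (simp flip: mult.assoc cst_mult)
  ultimately have "prod c G = cst (- 1 / of_nat (card G)) * r"
    by (simp add: cst_def single_uminus)
  moreover have "r \<in> decomposable (int (card G))"
    unfolding r_def
  proof (rule decomposable_sum)
    fix Y assume "Y \<in> Pow G - {{}}"
    then have "Y \<subseteq> G" "card Y \<noteq> 0"
      using finite_subset[OF _ finite_G, of Y] by auto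
    then have Y: "Y \<subseteq> G" "1 \<le> int (card Y)" by simp_all
    then show "p Y * (\<Sum>h\<in>G. act h (q Y)) \<in> decomposable (int (card G))"
      using p q by (intro decomposable_term[where j = "int (card Y)"] trace_invariant homog_sum act_homog) auto
  qed
  ultimately show ?thesis
    using decomposable_mult[of r _ "cst (- 1 / of_nat (card G))" 0] by simp
qed

text \<open>Labelling the \<open>card G\<close> positions of the word by the group elements makes it
  a product as in \<open>prod_decomposable\<close>.\<close>

lemma word_decomposable:
  assumes "length w = card G" "set w \<subseteq> {..<d}"
  shows "(\<Prod>i\<leftarrow>w. Var i) \<in> decomposable (int (card G))"
proof -
  obtain f where f: "bij_betw f G {0..<card G}" using ex_bij_betw_finite_nat finite_G by blast
  have "(\<Prod>i\<leftarrow>w. Var i) = (\<Prod>i\<in>{0..<length w}. Var (w ! i) :: 'k mpoly)"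
    by (simp only: prod.list_conv_set_nth length_map) (auto intro: prod.cong)
  also have "\<dots> = (\<Prod>g\<in>G. Var (w ! f g))"
    using prod.reindex_bij_betw[OF f, of "\<lambda>i. Var (w ! i) :: 'k mpoly"] assms(1) by simp
  also have "\<dots> \<in> decomposable (int (card G))"
  proof (rule prod_decomposable)
    fix g assume "g \<in> G"
    then have "f g < length w" using f assms(1) by (auto simp: bij_betw_def)
    then show "Var (w ! f g) \<in> D" using assms(2) by (intro vars_lt_Var) (meson lessThan_iff nth_mem subsetD)
  qed simp
  finally show ?thesis .
qed

lemma homog_decomposable:
  assumes y: "y \<in> D" "y \<in> homog n" and n: "int (card G) \<le> n"
  shows "y \<in> decomposable n"
proof -
  have mono: "single m 1 \<in> decomposable n" if m: "m \<in> keys y" for m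
  proof -
    define w where "w = sorted_word m"
    have w: "set w \<subseteq> {..<d}" "int (length w) = n"
      using m y by (auto simp: w_def set_sorted_word vars_lt_def homog_def)
    let ?u = "take (card G) w" and ?v = "drop (card G) w"
    have "single m 1 = (\<Prod>i\<leftarrow>w. Var i :: 'k mpoly)"
      using single_word_monom[of w] by (simp add: w_def)
    also have "\<dots> = (\<Prod>i\<leftarrow>?v. Var i) * (\<Prod>i\<leftarrow>?u. Var i)"
      by (subst append_take_drop_id[of "card G" w, symmetric], subst map_append) (simp add: mult.commute)
    also have "\<dots> \<in> decomposable (int (length ?v) + int (card G))"
    proof (rule decomposable_mult)
      show "(\<Prod>i\<leftarrow>?u. Var i) \<in> decomposable (int (card G))"
        using w n set_take_subset[of "card G" w] by (intro word_decomposable) auto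
      show "(\<Prod>i\<leftarrow>?v. Var i) \<in> D"
        using w set_drop_subset[of "card G" w] by (intro vars_lt_prod_list vars_lt_Var) auto
      show "(\<Prod>i\<leftarrow>?v. Var i) \<in> homog (int (length ?v))"
        using homog_single[of "word_monom ?v" 1] by (simp only: single_word_monom mdegree_word_monom)
    qed
    also have "int (length ?v) + int (card G) = n" using w n by simp
    finally show ?thesis .
  qed
  have "cst c * single m 1 \<in> decomposable n" if "m \<in> keys y" for c m
    using decomposable_mult[OF mono[OF that], of "cst c" 0] by simp
  then have "(\<Sum>m\<in>keys y. cst (lookup y m) * single m 1) \<in> decomposable n"
    by (rule decomposable_sum)
  then show ?thesis using lext_id[of y] by (simp add: lext_def)
qed

text \<open>The bound exists because the polynomial ring is generated over its invariants in degrees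
  below \<open>card G\<close>.\<close>

lemma exists_degree_bound:
  assumes \<phi>: "right_linear \<phi>"
  shows "\<exists>M::nat. degree_bound (int M) \<phi>"
proof -
  \<comment> \<open>Finitely many words give all monomials of degree at most \<open>card G\<close>;
    the sum of degree bounds for their images is the constant \<open>M\<close>.\<close>
  define W where "W = {w. set w \<subseteq> {..<d} \<and> length w \<le> card G}"
  have "finite W" unfolding W_def by (rule finite_lists_length_le) simp
  obtain deg where deg: "\<And>p :: 'k mpoly. p \<in> deg_le (int (deg p))" using exists_deg_le by metis
  define M where "M = (\<Sum>w\<in>W. deg (\<phi> (single (word_monom w) 1)))"
  have small: "\<phi> x \<in> deg_le (int M)" if x: "x \<in> D" "x \<in> deg_le (int (card G))" for x
    unfolding \<phi>_lext[OF \<phi> x(1)] lext_def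
  proof (intro deg_le_sum deg_le_cst_mult)
    fix m assume m: "m \<in> keys x"
    have "sorted_word m \<in> W"
      using m x by (auto simp: W_def set_sorted_word vars_lt_def deg_le_def)
    then have "deg (\<phi> (single (word_monom (sorted_word m)) 1)) \<le> M"
      unfolding M_def using \<open>finite W\<close>
      by (intro member_le_sum[where f = "\<lambda>w. deg (\<phi> (single (word_monom w) 1))"]) auto
    then show "\<phi> (single m 1) \<in> deg_le (int M)"
      using deg_le_mono[OF deg[of "\<phi> (single m 1)"]] by simp
  qed
  have nat: "\<phi> x \<in> deg_le (int n + int M)" if "x \<in> D" "x \<in> deg_le (int n)" for x n
    using that
  proof (induction n arbitrary: x rule: less_induct)
    case (less n)
    show ?case
    proof (cases "n < card G")
      case True
      then have "\<phi> x \<in> deg_le (int M)"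
        by (intro small less.prems deg_le_mono[OF less.prems(2)]) simp
      then show ?thesis by (rule deg_le_mono) simp
    next
      case False
      \<comment> \<open>The leading part of \<open>x\<close> is decomposable. Replacing each
        \<open>s * t\<close> in it by \<open>s \<star> t'\<close>, with \<open>t'\<close> a fixed
        lift of \<open>t\<close>, yields \<open>z\<close> with the same leading part, and the
        induction hypothesis for the cofactors \<open>s\<close> controls \<open>\<phi> z\<close>. It
        then remains to treat \<open>x - z\<close>, which has lower degree.\<close>
      have "\<exists>z. z \<in> D \<and> z \<in> deg_le (int n) \<and> hpart (int n) z = y \<and> \<phi> z \<in> deg_le (int n + int M)"
        if "y \<in> decomposable (int n)" for y
        using that
      proof induction
        case decomposable_0
        show ?case by (intro exI[of _ 0]) (simp add: \<phi>_zero[OF \<phi>])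
      next
        case (decomposable_add y y')
        then obtain z z' where "z \<in> D" "z \<in> deg_le (int n)" "hpart (int n) z = y" "\<phi> z \<in> deg_le (int n + int M)"
          "z' \<in> D" "z' \<in> deg_le (int n)" "hpart (int n) z' = y'" "\<phi> z' \<in> deg_le (int n + int M)" by blast
        then show ?case
          by (intro exI[of _ "z + z'"]) (simp add: add_D deg_le_add hpart_add \<phi>_add[OF \<phi>])
      next
        case (decomposable_term s j t)
        note j = decomposable_term
        obtain t' where t': "t' \<in> fixed" "t' \<in> deg_le j" "hpart j t' = t" using invariant_lift j by blast
        then have t'_D: "t' \<in> D" by (simp add: fixed_def)
        have s: "s \<in> deg_le (int n - j)" using j homog_deg_le by blast
        have \<phi>s: "\<phi> s \<in> deg_le (int n - j + int M)"
        proof (cases "j \<le> int n")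
          case True
          define i where "i = nat (int n - j)"
          have i: "i < n" "int i = int n - j" using True j by (auto simp: i_def)
          then show ?thesis using less.IH[OF i(1) j(1)] s by simp
        next
          case False
          then have "s = 0" using deg_le_negative[OF s] by simp
          then show ?thesis by (simp add: \<phi>_zero[OF \<phi>])
        qed
        have "s \<star> t' \<in> deg_le (int n)" "hpart (int n) (s \<star> t') = s * t"
          using star_deg_le[OF j(1) t'_D s t'(2)] star_hpart[OF j(1) t'_D s t'(2)] t' j by (simp_all add: homog_hpart)
        moreover have "\<phi> (s \<star> t') \<in> deg_le (int n + int M)"
          using star_deg_le[OF \<phi>_D[OF \<phi> j(1)] t'_D \<phi>s t'(2)] \<phi>_star[OF \<phi> j(1) t'(1)]
          by (simp add: algebra_simps)
        ultimately show ?case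
          using j t'_D by (intro exI[of _ "s \<star> t'"]) (auto simp: star_D)
      qed
      moreover have "hpart (int n) x \<in> decomposable (int n)"
        using less.prems False by (intro homog_decomposable) (auto simp: vars_lt_hpart)
      ultimately obtain z where z: "z \<in> D" "z \<in> deg_le (int n)" "hpart (int n) z = hpart (int n) x"
        "\<phi> z \<in> deg_le (int n + int M)" by blast
      have "x - z \<in> deg_le (int n - 1)"
        using less.prems z by (intro deg_le_predI deg_le_diff) (auto simp: hpart_diff)
      moreover have "0 < n" using False finite_G id_G card_gt_0_iff[of G] by fastforce
      ultimately have "\<phi> (x - z) \<in> deg_le (int (n - 1) + int M)"
        using less.prems z by (intro less.IH) (auto simp: diff_D of_nat_diff)
      then have "\<phi> (x - z) + \<phi> z \<in> deg_le (int n + int M)"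
        using z by (intro deg_le_add) (auto elim: deg_le_mono)
      then show ?thesis using less.prems z by (simp add: \<phi>_diff[OF \<phi>])
    qed
  qed
  have "\<phi> x \<in> deg_le (n + int M)" if x: "x \<in> D" "x \<in> deg_le n" for x n
  proof (cases "0 \<le> n")
    case True
    then show ?thesis using nat[of x "nat n"] x by simp
  next
    case False
    then have "x = 0" using deg_le_negative[OF x(2)] by simp
    then show ?thesis by (simp add: \<phi>_zero[OF \<phi>])
  qed
  then show ?thesis by (auto simp: degree_bound_def)
qed

theorem natural_surjective:
  assumes "right_linear \<phi>"
  shows "\<exists>u. (\<forall>g\<in>G. u g \<in> D) \<and> (\<forall>x\<in>D. \<phi> x = (\<Sum>g\<in>G. u g \<star> \<beta> g x))"
proof -
  obtain M :: nat where "degree_bound (int M) \<phi>" using exists_degree_bound[OF assms] by blast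
  then show ?thesis using natural_surjective_bounded[OF assms, of "Suc M"] by simp
qed

end

section \<open>The natural map of a realized deformation\<close>

text \<open>Spares a direct verification of the axioms for the skew group algebra: they are pulled
  back along the natural map from the endomorphisms, where multiplication is composition.\<close>

lemma k_algebra_transport:
  fixes A :: "('k::field, 'a) module" and B :: "('k, 'b) module"
  assumes B: "k_algebra B" and bij: "bij_betw \<phi> (carrier A) (carrier B)"
    and closed: "\<one>\<^bsub>A\<^esub> \<in> carrier A" "\<zero>\<^bsub>A\<^esub> \<in> carrier A"
      "\<And>x y. x \<in> carrier A \<Longrightarrow> y \<in> carrier A \<Longrightarrow> x \<otimes>\<^bsub>A\<^esub> y \<in> carrier A"
      "\<And>x y. x \<in> carrier A \<Longrightarrow> y \<in> carrier A \<Longrightarrow> x \<oplus>\<^bsub>A\<^esub> y \<in> carrier A"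
      "\<And>c x. x \<in> carrier A \<Longrightarrow> c \<odot>\<^bsub>A\<^esub> x \<in> carrier A"
    and hom: "\<phi> \<one>\<^bsub>A\<^esub> = \<one>\<^bsub>B\<^esub>" "\<phi> \<zero>\<^bsub>A\<^esub> = \<zero>\<^bsub>B\<^esub>"
      "\<And>x y. x \<in> carrier A \<Longrightarrow> y \<in> carrier A \<Longrightarrow> \<phi> (x \<otimes>\<^bsub>A\<^esub> y) = \<phi> x \<otimes>\<^bsub>B\<^esub> \<phi> y"
      "\<And>x y. x \<in> carrier A \<Longrightarrow> y \<in> carrier A \<Longrightarrow> \<phi> (x \<oplus>\<^bsub>A\<^esub> y) = \<phi> x \<oplus>\<^bsub>B\<^esub> \<phi> y"
      "\<And>c x. x \<in> carrier A \<Longrightarrow> \<phi> (c \<odot>\<^bsub>A\<^esub> x) = c \<odot>\<^bsub>B\<^esub> \<phi> x"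
  shows "k_algebra A"
proof -
  interpret B: k_algebra B by (rule B)
  have \<phi>: "x \<in> carrier A \<Longrightarrow> \<phi> x \<in> carrier B" for x using bij by (auto simp: bij_betw_def)
  have inj: "x \<in> carrier A \<Longrightarrow> y \<in> carrier A \<Longrightarrow> \<phi> x = \<phi> y \<Longrightarrow> x = y" for x y
    using bij by (auto simp: bij_betw_def inj_on_def)
  show ?thesis
  proof (intro k_algebra.intro k_algebra_axioms.intro)
    show "ring A"
    proof (rule ringI)
      show "abelian_group A"
      proof (rule abelian_groupI)
        fix x assume x: "x \<in> carrier A"
        obtain y where y: "y \<in> carrier A" "\<phi> y = \<ominus>\<^bsub>B\<^esub> \<phi> x"
          using bij \<phi>[OF x] B.a_inv_closed by (metis bij_betw_def imageE)
        have "y \<oplus>\<^bsub>A\<^esub> x = \<zero>\<^bsub>A\<^esub>"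
          by (rule inj) (simp_all add: closed hom x y \<phi> B.l_neg)
        then show "\<exists>y\<in>carrier A. y \<oplus>\<^bsub>A\<^esub> x = \<zero>\<^bsub>A\<^esub>" using y by blast
      qed (auto intro!: inj simp: closed hom \<phi> B.a_ac)
      show "Group.monoid A"
        by (rule monoidI) (auto intro!: inj simp: closed hom \<phi> B.m_assoc)
    qed (auto intro!: inj simp: closed hom \<phi> B.l_distr B.r_distr)
  qed (auto intro!: inj simp: closed hom \<phi> B.smult_closed B.smult_add_left B.smult_add_right B.smult_smult
      B.smult_one B.smult_mult_left B.smult_mult_right)
qed

lemma (in k_algebra) smult_eq_mult_right: "x \<in> carrier A \<Longrightarrow> c \<odot> x = x \<otimes> (c \<odot> \<one>)"
  by (simp add: smult_mult_right)

context k_algebra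
begin

context
  fixes S assumes S: "S \<subseteq> carrier A" "\<And>c. c \<odot> \<one> \<in> S"
begin

abbreviation E where "E \<equiv> right_endomorphism_algebra A S"

lemma E_iff: "\<phi> \<in> carrier E \<longleftrightarrow> \<phi> \<in> carrier A \<rightarrow>\<^sub>E carrier A \<and>
    (\<forall>x\<in>carrier A. \<forall>y\<in>carrier A. \<phi> (x \<oplus> y) = \<phi> x \<oplus> \<phi> y) \<and>
    (\<forall>x\<in>carrier A. \<forall>s\<in>S. \<phi> (x \<otimes> s) = \<phi> x \<otimes> s)"
  by (simp add: right_endomorphism_algebra_def)

lemma E_simps [simp]:
  "\<phi> \<otimes>\<^bsub>E\<^esub> \<psi> = compose (carrier A) \<phi> \<psi>" "\<phi> \<oplus>\<^bsub>E\<^esub> \<psi> = (\<lambda>x\<in>carrier A. \<phi> x \<oplus> \<psi> x)"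
  "\<one>\<^bsub>E\<^esub> = (\<lambda>x\<in>carrier A. x)" "\<zero>\<^bsub>E\<^esub> = (\<lambda>x\<in>carrier A. \<zero>)" "c \<odot>\<^bsub>E\<^esub> \<phi> = (\<lambda>x\<in>carrier A. c \<odot> \<phi> x)"
  by (simp_all add: right_endomorphism_algebra_def)

text \<open>Compatibility with scalars comes from linearity over \<open>S\<close>, since scaling by
  \<open>c\<close> is right multiplication by \<open>c \<odot> \<one>\<close>.\<close>

lemma E_D:
  assumes "\<phi> \<in> carrier E"
  shows "x \<in> carrier A \<Longrightarrow> \<phi> x \<in> carrier A"
    "x \<in> carrier A \<Longrightarrow> y \<in> carrier A \<Longrightarrow> \<phi> (x \<oplus> y) = \<phi> x \<oplus> \<phi> y"
    "x \<in> carrier A \<Longrightarrow> s \<in> S \<Longrightarrow> \<phi> (x \<otimes> s) = \<phi> x \<otimes> s"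
    "x \<in> carrier A \<Longrightarrow> \<phi> (c \<odot> x) = c \<odot> \<phi> x"
proof -
  show 1: "x \<in> carrier A \<Longrightarrow> \<phi> x \<in> carrier A" for x
    using assms by (auto simp: E_iff)
  show "x \<in> carrier A \<Longrightarrow> y \<in> carrier A \<Longrightarrow> \<phi> (x \<oplus> y) = \<phi> x \<oplus> \<phi> y"
    and 2: "x \<in> carrier A \<Longrightarrow> s \<in> S \<Longrightarrow> \<phi> (x \<otimes> s) = \<phi> x \<otimes> s" for s
    using assms by (auto simp: E_iff)
  show "\<phi> (c \<odot> x) = c \<odot> \<phi> x" if x: "x \<in> carrier A"
    using smult_eq_mult_right[OF x, of c] smult_eq_mult_right[OF 1[OF x], of c] 2[OF x S(2)[of c]] by simp
qed

lemma E_eqI: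
  assumes "\<phi> \<in> carrier E" "\<psi> \<in> carrier E" "\<And>x. x \<in> carrier A \<Longrightarrow> \<phi> x = \<psi> x"
  shows "\<phi> = \<psi>"
  using assms by (intro PiE_ext[where k = "carrier A"]) (auto simp: E_iff)

lemma E_closed:
  "\<one>\<^bsub>E\<^esub> \<in> carrier E" "\<zero>\<^bsub>E\<^esub> \<in> carrier E"
  "\<phi> \<in> carrier E \<Longrightarrow> \<psi> \<in> carrier E \<Longrightarrow> \<phi> \<otimes>\<^bsub>E\<^esub> \<psi> \<in> carrier E"
  "\<phi> \<in> carrier E \<Longrightarrow> \<psi> \<in> carrier E \<Longrightarrow> \<phi> \<oplus>\<^bsub>E\<^esub> \<psi> \<in> carrier E"
  "\<phi> \<in> carrier E \<Longrightarrow> c \<odot>\<^bsub>E\<^esub> \<phi> \<in> carrier E"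
proof -
  have S': "s \<in> S \<Longrightarrow> s \<in> carrier A" for s using S by blast
  show "\<one>\<^bsub>E\<^esub> \<in> carrier E" "\<zero>\<^bsub>E\<^esub> \<in> carrier E"
    by (auto simp: E_iff S')
  show "\<phi> \<otimes>\<^bsub>E\<^esub> \<psi> \<in> carrier E" if "\<phi> \<in> carrier E" "\<psi> \<in> carrier E"
    using E_D[OF that(1)] E_D[OF that(2)] by (auto simp: E_iff S' compose_def)
  show "\<phi> \<oplus>\<^bsub>E\<^esub> \<psi> \<in> carrier E" if "\<phi> \<in> carrier E" "\<psi> \<in> carrier E"
    using E_D[OF that(1)] E_D[OF that(2)] by (auto simp: E_iff S' l_distr a_ac)
  show "c \<odot>\<^bsub>E\<^esub> \<phi> \<in> carrier E" if "\<phi> \<in> carrier E"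
    using E_D[OF that(1)] by (auto simp: E_iff S' smult_closed smult_add_right smult_mult_left)
qed

lemma k_algebra_E: "k_algebra E"
proof (intro k_algebra.intro k_algebra_axioms.intro)
  show "ring E"
  proof (rule ringI)
    show "abelian_group E"
    proof (rule abelian_groupI)
      fix \<phi> assume \<phi>: "\<phi> \<in> carrier E"
      have "(- 1) \<odot> y \<oplus> y = \<zero>" if "y \<in> carrier A" for y
      proof -
        have "0 \<odot> y \<oplus> 0 \<odot> y = 0 \<odot> y" using smult_add_left[OF that, of 0 0] by simp
        then have "0 \<odot> y = \<zero>" using smult_closed[OF that] add.l_cancel_one by blast
        then show ?thesis using smult_add_left[OF that, of "- 1" 1] by (simp add: smult_one that)
      qed
      then have "(- 1) \<odot>\<^bsub>E\<^esub> \<phi> \<oplus>\<^bsub>E\<^esub> \<phi> = \<zero>\<^bsub>E\<^esub>"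
        using E_D(1)[OF \<phi>] by (auto simp: fun_eq_iff)
      then show "\<exists>\<psi>\<in>carrier E. \<psi> \<oplus>\<^bsub>E\<^esub> \<phi> = \<zero>\<^bsub>E\<^esub>" using E_closed(5)[OF \<phi>] by blast
    qed (auto intro!: E_eqI E_closed simp del: E_simps, auto simp: E_D a_ac)
    show "Group.monoid E"
      by (rule monoidI) (auto intro!: E_eqI E_closed simp del: E_simps, auto simp: E_D compose_def)
  qed (auto intro!: E_eqI E_closed simp del: E_simps, auto simp: E_D compose_def)
qed (auto intro!: E_eqI E_closed simp del: E_simps,
    auto simp: E_D compose_def smult_add_left smult_add_right smult_smult smult_one smult_closed)

end

end

text \<open>\<open>K\<close> identifies the deformation on polynomials with an actual algebra
  \<open>R\<close> and its given group action; through it the results on \<open>star\<close> become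
  statements about \<open>natural_map\<close>.\<close>

locale realized_deformation =
  filtered_deformation G d act star \<beta> a a' + k_algebra R + Gp: Group.group Gp
  for G :: "('v \<Rightarrow> 'v) set" and d :: nat and act :: "('v \<Rightarrow> 'v) \<Rightarrow> 'k::field_char_0 mpoly \<Rightarrow> 'k mpoly"
    and star :: "'k mpoly \<Rightarrow> 'k mpoly \<Rightarrow> 'k mpoly" (infixl \<open>\<star>\<close> 70)
    and \<beta> :: "('v \<Rightarrow> 'v) \<Rightarrow> 'k mpoly \<Rightarrow> 'k mpoly"
    and a a' :: "('v \<Rightarrow> 'v) \<Rightarrow> 'k mpoly"
    and R :: "('k, 'r) module" (structure) and Gp :: "('v \<Rightarrow> 'v) monoid" +
  fixes K :: "'k mpoly \<Rightarrow> 'r" and ract :: "('v \<Rightarrow> 'v) \<Rightarrow> 'r \<Rightarrow> 'r"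
  assumes Gp: "carrier Gp = G" "\<And>g h. g \<otimes>\<^bsub>Gp\<^esub> h = g \<circ> h" "\<one>\<^bsub>Gp\<^esub> = id"
    and \<beta>_id: "s \<in> vars_lt d \<Longrightarrow> \<beta> id s = s"
    and K_bij: "bij_betw K (vars_lt d) (carrier R)"
    and K_add: "K (s + t) = K s \<oplus> K t"
    and K_star: "K (s \<star> t) = K s \<otimes> K t"
    and K_one: "K 1 = \<one>"
    and K_cst_mult: "K (cst c * s) = c \<odot> K s"
    and K_\<beta>: "g \<in> G \<Longrightarrow> K (\<beta> g s) = ract g (K s)"
begin

definition L :: "'r \<Rightarrow> 'k mpoly"
  where "L = inv_into (vars_lt d) K"

lemma K_closed: "s \<in> D \<Longrightarrow> K s \<in> carrier R"
  using K_bij by (auto simp: bij_betw_def)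

lemma L_D: "x \<in> carrier R \<Longrightarrow> L x \<in> D"
  using K_bij unfolding L_def by (metis bij_betw_def inv_into_into)

lemma K_L: "x \<in> carrier R \<Longrightarrow> K (L x) = x"
  using K_bij unfolding L_def by (metis bij_betw_inv_into_right)

lemma L_K: "s \<in> D \<Longrightarrow> L (K s) = s"
  using K_bij unfolding L_def by (metis bij_betw_inv_into_left)

lemma K_eq_iff: "s \<in> D \<Longrightarrow> t \<in> D \<Longrightarrow> K s = K t \<longleftrightarrow> s = t"
  using L_K by metis

lemma K_zero: "K 0 = \<zero>"
proof -
  have "K 0 \<oplus> K 0 = K 0" using K_add[of 0 0] by simp
  then show ?thesis using K_closed[of 0] add.l_cancel_one by (metis vars_lt_0)
qed

lemma K_sum: "(\<And>x. x \<in> T \<Longrightarrow> f x \<in> D) \<Longrightarrow> finite T \<Longrightarrow> K (sum f T) = (\<Oplus>x\<in>T. K (f x))"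
proof (induction T rule: infinite_finite_induct)
  case (insert x T)
  then show ?case by (subst finsum_insert) (auto simp: K_add K_closed sum_D)
qed (simp_all add: K_zero)

abbreviation "SGA \<equiv> skew_group_algebra R Gp ract"

abbreviation "FS \<equiv> fixed_subring R G ract"

abbreviation "N \<equiv> natural_map R Gp ract"

lemma FS_iff: "s \<in> D \<Longrightarrow> K s \<in> FS \<longleftrightarrow> s \<in> fixed"
  by (auto simp: fixed_subring_def fixed_def K_closed K_eq_iff \<beta>_D simp flip: K_\<beta>)

lemma FS_subset: "FS \<subseteq> carrier R"
  by (auto simp: fixed_subring_def)

lemma smult_one_FS: "c \<odot> \<one> \<in> FS"
  using FS_iff[of "cst c"] K_cst_mult[of c 1] by (simp add: K_one fixed_def \<beta>_cst)

abbreviation "ER \<equiv> right_endomorphism_algebra R FS"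

lemma k_algebra_ER: "k_algebra ER"
  by (rule k_algebra_E[OF FS_subset smult_one_FS])

lemma SGA_carrier: "carrier SGA = G \<rightarrow>\<^sub>E carrier R"
  by (simp add: skew_group_algebra_def Gp)

lemma star_sum_right: "t \<in> D \<Longrightarrow> t \<star> sum f T = (\<Sum>x\<in>T. t \<star> f x)"
  using star_cst[of t 0]
  by (induction T rule: infinite_finite_induct) (auto simp: star_add_right)

lemma ract_closed: "g \<in> G \<Longrightarrow> x \<in> carrier R \<Longrightarrow> ract g x \<in> carrier R"
  using K_\<beta>[of g "L x"] by (metis K_L K_closed L_D \<beta>_D)

lemma natural_map_K:
  assumes "u \<in> carrier SGA" "s \<in> D"
  shows "N u (K s) = K (\<Sum>g\<in>G. L (u g) \<star> \<beta> g s)"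
proof -
  have u: "u g \<in> carrier R" if "g \<in> G" for g using assms(1) that by (auto simp: SGA_carrier)
  have "N u (K s) = (\<Oplus>g\<in>G. u g \<otimes> ract g (K s))"
    using assms by (simp add: natural_map_def Gp K_closed)
  also have "\<dots> = (\<Oplus>g\<in>G. K (L (u g) \<star> \<beta> g s))"
    using u assms(2) by (intro finsum_cong') (auto simp: K_star K_\<beta> K_L L_D \<beta>_D K_closed ract_closed)
  also have "\<dots> = K (\<Sum>g\<in>G. L (u g) \<star> \<beta> g s)"
    using u assms(2) finite_G by (intro K_sum[symmetric]) (auto simp: star_D L_D \<beta>_D)
  finally show ?thesis .
qed

lemma SGA_closed_at: "u \<in> carrier SGA \<Longrightarrow> g \<in> G \<Longrightarrow> u g \<in> carrier R"
  by (auto simp: SGA_carrier)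

lemma SGA_L_D: "u \<in> carrier SGA \<Longrightarrow> g \<in> G \<Longrightarrow> L (u g) \<in> D"
  by (simp add: L_D SGA_closed_at)

lemma natural_map_sum_D: "(\<Sum>g\<in>G. L (u g) \<star> \<beta> g s) \<in> D"
  by (intro sum_D star_D)

lemma natural_map_closed:
  assumes "u \<in> carrier SGA"
  shows "N u \<in> carrier ER"
proof -
  have L: "g \<in> G \<Longrightarrow> L (u g) \<in> D" for g using assms by (simp add: SGA_L_D)
  have rl: "right_linear (\<lambda>s. \<Sum>g\<in>G. L (u g) \<star> \<beta> g s)" by (rule right_linear_natural[OF L])
  have "N u x \<in> carrier R" if "x \<in> carrier R" for x
    using natural_map_K[OF assms L_D[OF that]] natural_map_sum_D that
    by (simp add: K_L K_closed)
  moreover have "N u (x \<oplus> y) = N u x \<oplus> N u y" if "x \<in> carrier R" "y \<in> carrier R" for x y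
  proof -
    have "N u (K (L x + L y)) = N u (K (L x)) \<oplus> N u (K (L y))"
      using rl that by (simp add: natural_map_K assms L_D add_D natural_map_sum_D right_linear_def flip: K_add)
    then show ?thesis using that by (simp add: K_add L_D K_L)
  qed
  moreover have "N u (x \<otimes> t) = N u x \<otimes> t" if "x \<in> carrier R" "t \<in> FS" for x t
  proof -
    have t: "t \<in> carrier R" "L t \<in> fixed" using that FS_subset FS_iff[of "L t"] L_D K_L by auto
    have "N u (K (L x \<star> L t)) = N u (K (L x)) \<otimes> K (L t)"
      using rl that t by (simp add: natural_map_K assms L_D star_D natural_map_sum_D right_linear_def flip: K_star)
    then show ?thesis using that t by (simp add: K_star L_D K_L)
  qed
  moreover have "N u \<in> extensional (carrier R)" by (simp add: natural_map_def)
  ultimately show ?thesis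
    by (auto simp: E_iff[OF FS_subset smult_one_FS] PiE_def)
qed

lemma natural_map_eqI:
  assumes "u \<in> carrier SGA" "\<phi> \<in> carrier ER"
    and "\<And>s. s \<in> D \<Longrightarrow> K (\<Sum>g\<in>G. L (u g) \<star> \<beta> g s) = \<phi> (K s)"
  shows "N u = \<phi>"
proof (rule E_eqI[OF FS_subset smult_one_FS natural_map_closed[OF assms(1)] assms(2)])
  fix x assume x: "x \<in> carrier R"
  then show "N u x = \<phi> x"
    using assms(3)[OF L_D[OF x]] natural_map_K[OF assms(1) L_D[OF x]] by (simp add: K_L)
qed

lemma natural_map_bij: "bij_betw N (carrier SGA) (carrier ER)"
proof (rule bij_betw_imageI)
  show "inj_on N (carrier SGA)"
  proof (rule inj_onI)
    fix u v assume u: "u \<in> carrier SGA" and v: "v \<in> carrier SGA" and eq: "N u = N v"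
    have D: "L (u g) \<in> D" "L (v g) \<in> D" if "g \<in> G" for g using u v that by (simp_all add: SGA_L_D)
    have "L (u g) - L (v g) = 0" if "g \<in> G" for g
    proof (rule natural_injective[where u = "\<lambda>g. L (u g) - L (v g)"])
      fix x assume x: "x \<in> D"
      have "(\<Sum>g\<in>G. L (u g) \<star> \<beta> g x) = (\<Sum>g\<in>G. L (v g) \<star> \<beta> g x)"
        using natural_map_K[OF u x] natural_map_K[OF v x] eq
        by (simp add: K_eq_iff natural_map_sum_D u v x)
      moreover have "(L (u g) - L (v g)) \<star> \<beta> g x + L (v g) \<star> \<beta> g x = L (u g) \<star> \<beta> g x" if "g \<in> G" for g
        using star_add_left[of "L (u g) - L (v g)" "L (v g)" "\<beta> g x"] that D x by (simp add: diff_D \<beta>_D)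
      then have "(\<Sum>g\<in>G. (L (u g) - L (v g)) \<star> \<beta> g x) + (\<Sum>g\<in>G. L (v g) \<star> \<beta> g x) = (\<Sum>g\<in>G. L (u g) \<star> \<beta> g x)"
        by (simp flip: sum.distrib)
      ultimately show "(\<Sum>g\<in>G. (L (u g) - L (v g)) \<star> \<beta> g x) = 0" by simp
    qed (use D that diff_D in auto)
    then have "u g = v g" if "g \<in> G" for g
      using u v that K_L SGA_closed_at by (metis eq_iff_diff_eq_0)
    then show "u = v" using u v by (intro PiE_ext[of u G]) (auto simp: SGA_carrier)
  qed
  show "N ` carrier SGA = carrier ER"
  proof (intro equalityI subsetI)
    fix \<phi> assume \<phi>: "\<phi> \<in> carrier ER"
    note \<phi>' = E_D[OF FS_subset smult_one_FS \<phi>]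
    define \<phi>0 where "\<phi>0 s = L (\<phi> (K s))" for s
    have "right_linear \<phi>0"
      unfolding right_linear_def
    proof (intro conjI ballI)
      fix s t assume s: "s \<in> D"
      show "\<phi>0 s \<in> D" using s by (simp add: \<phi>0_def L_D \<phi>' K_closed)
      show "\<phi>0 (s + t) = \<phi>0 s + \<phi>0 t" if t: "t \<in> D"
      proof -
        have "\<phi> (K (s + t)) = K (\<phi>0 s + \<phi>0 t)"
          using s t by (simp add: \<phi>0_def K_add K_L L_D \<phi>' K_closed)
        then show ?thesis using s t by (simp add: \<phi>0_def[of "s + t"] L_K add_D) (simp add: \<phi>0_def L_K L_D add_D \<phi>' K_closed)
      qed
      show "\<phi>0 (s \<star> t) = \<phi>0 s \<star> t" if t: "t \<in> fixed"
      proof -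
        have tD: "t \<in> D" and tF: "K t \<in> FS" using t FS_iff by (auto simp: fixed_def)
        have "\<phi> (K (s \<star> t)) = K (\<phi>0 s \<star> t)"
          using s tD tF by (simp add: \<phi>0_def K_star K_L L_D \<phi>' K_closed)
        moreover have "\<phi>0 s \<star> t \<in> D" using s tD by (simp add: \<phi>0_def L_D \<phi>' K_closed star_D)
        ultimately show ?thesis by (simp add: \<phi>0_def[of "s \<star> t"] L_K)
      qed
    qed
    from natural_surjective[OF this] obtain u where u: "\<And>g. g \<in> G \<Longrightarrow> u g \<in> D"
      "\<And>x. x \<in> D \<Longrightarrow> \<phi>0 x = (\<Sum>g\<in>G. u g \<star> \<beta> g x)" by blast
    define v where "v = (\<lambda>g\<in>G. K (u g))"
    have v: "v \<in> carrier SGA" using u by (auto simp: v_def SGA_carrier K_closed)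
    have "N v = \<phi>"
    proof (rule natural_map_eqI[OF v \<phi>])
      fix s assume "s \<in> D"
      then show "K (\<Sum>g\<in>G. L (v g) \<star> \<beta> g s) = \<phi> (K s)"
        using u by (simp add: v_def L_K \<phi>0_def K_L K_closed \<phi>' flip: u(2) cong: sum.cong)
    qed
    then show "\<phi> \<in> N ` carrier SGA" using v by blast
  qed (use natural_map_closed in blast)
qed

lemma finsum_in: "(\<And>x. x \<in> T \<Longrightarrow> f x \<in> carrier R) \<Longrightarrow> finsum R f T \<in> carrier R"
  by (intro finsum_closed) auto

lemma inv_mult_G: "g \<in> G \<Longrightarrow> h \<in> G \<Longrightarrow> inv\<^bsub>Gp\<^esub> h \<otimes>\<^bsub>Gp\<^esub> g \<in> G"
  using Gp.m_closed[of "inv\<^bsub>Gp\<^esub> h" g] Gp.inv_closed[of h] by (simp add: Gp)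

lemma SGA_closed:
  "\<one>\<^bsub>SGA\<^esub> \<in> carrier SGA" "\<zero>\<^bsub>SGA\<^esub> \<in> carrier SGA"
  "u \<in> carrier SGA \<Longrightarrow> v \<in> carrier SGA \<Longrightarrow> u \<otimes>\<^bsub>SGA\<^esub> v \<in> carrier SGA"
  "u \<in> carrier SGA \<Longrightarrow> v \<in> carrier SGA \<Longrightarrow> u \<oplus>\<^bsub>SGA\<^esub> v \<in> carrier SGA"
  "u \<in> carrier SGA \<Longrightarrow> c \<odot>\<^bsub>SGA\<^esub> u \<in> carrier SGA"
proof -
  show "\<one>\<^bsub>SGA\<^esub> \<in> carrier SGA" "\<zero>\<^bsub>SGA\<^esub> \<in> carrier SGA"
    unfolding SGA_carrier by (simp_all add: skew_group_algebra_def Gp restrict_PiE_iff)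
  show "u \<otimes>\<^bsub>SGA\<^esub> v \<in> carrier SGA" if u: "u \<in> carrier SGA" and v: "v \<in> carrier SGA"
  proof -
    have "(\<Oplus>h\<in>G. u h \<otimes> ract h (v (inv\<^bsub>Gp\<^esub> h \<otimes>\<^bsub>Gp\<^esub> g))) \<in> carrier R" if "g \<in> G" for g
      using that by (intro finsum_in m_closed ract_closed SGA_closed_at[OF u] SGA_closed_at[OF v] inv_mult_G)
    then show ?thesis
      unfolding SGA_carrier by (simp add: skew_group_algebra_def Gp(1) restrict_PiE_iff)
  qed
  show "u \<oplus>\<^bsub>SGA\<^esub> v \<in> carrier SGA" if "u \<in> carrier SGA" "v \<in> carrier SGA"
    using SGA_closed_at[OF that(1)] SGA_closed_at[OF that(2)]
    unfolding SGA_carrier by (simp add: skew_group_algebra_def Gp(1) restrict_PiE_iff)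
  show "c \<odot>\<^bsub>SGA\<^esub> u \<in> carrier SGA" if "u \<in> carrier SGA"
    using SGA_closed_at[OF that]
    unfolding SGA_carrier by (simp add: skew_group_algebra_def Gp(1) restrict_PiE_iff smult_closed)
qed

lemma natural_map_mult:
  assumes u: "u \<in> carrier SGA" and v: "v \<in> carrier SGA"
  shows "N (u \<otimes>\<^bsub>SGA\<^esub> v) = N u \<otimes>\<^bsub>ER\<^esub> N v"
proof (rule natural_map_eqI)
  show "u \<otimes>\<^bsub>SGA\<^esub> v \<in> carrier SGA" by (intro SGA_closed u v)
  show "N u \<otimes>\<^bsub>ER\<^esub> N v \<in> carrier ER"
    by (intro E_closed[OF FS_subset smult_one_FS] natural_map_closed u v)
  fix s assume s: "s \<in> D"
  define u' v' where "u' g = L (u g)" and "v' g = L (v g)" for g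
  have D: "u' g \<in> D" "v' g \<in> D" if "g \<in> G" for g using u v that by (simp_all add: u'_def v'_def SGA_L_D)
  have K: "K (u' g) = u g" "K (v' g) = v g" if "g \<in> G" for g
    using u v that by (simp_all add: u'_def v'_def K_L SGA_closed_at)
  let ?i = "\<lambda>h g. inv\<^bsub>Gp\<^esub> h \<otimes>\<^bsub>Gp\<^esub> g"
  have conv: "L ((u \<otimes>\<^bsub>SGA\<^esub> v) g) = (\<Sum>h\<in>G. u' h \<star> \<beta> h (v' (?i h g)))" if g: "g \<in> G" for g
  proof -
    have "(u \<otimes>\<^bsub>SGA\<^esub> v) g = (\<Oplus>h\<in>G. u h \<otimes> ract h (v (?i h g)))"
      using g by (simp add: skew_group_algebra_def Gp(1))
    also have "\<dots> = (\<Oplus>h\<in>G. K (u' h \<star> \<beta> h (v' (?i h g))))"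
      using D g inv_mult_G K by (intro finsum_cong') (auto simp: K_star K_\<beta> \<beta>_D ract_closed SGA_closed_at u v)
    also have "\<dots> = K (\<Sum>h\<in>G. u' h \<star> \<beta> h (v' (?i h g)))"
      using D g inv_mult_G finite_G by (intro K_sum[symmetric]) (auto simp: star_D \<beta>_D)
    finally show ?thesis
      using D g inv_mult_G by (auto simp: star_D \<beta>_D intro!: L_K sum_D)
  qed
  have "(\<Sum>g\<in>G. L ((u \<otimes>\<^bsub>SGA\<^esub> v) g) \<star> \<beta> g s) = (\<Sum>g\<in>G. \<Sum>h\<in>G. u' h \<star> \<beta> h (v' (?i h g)) \<star> \<beta> g s)"
    using D s inv_mult_G by (intro sum.cong refl) (auto simp: conv star_sum_left star_D \<beta>_D)
  also have "\<dots> = (\<Sum>h\<in>G. \<Sum>g\<in>G. u' h \<star> \<beta> h (v' (?i h g)) \<star> \<beta> g s)"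
    by (rule sum.swap)
  \<comment> \<open>Reindexing by \<open>g = h \<circ> k\<close> turns the convolution of the skew
    group algebra into a composition of two maps.\<close>
  also have "\<dots> = (\<Sum>h\<in>G. \<Sum>k\<in>G. u' h \<star> \<beta> h (v' k) \<star> \<beta> (h \<circ> k) s)"
  proof (rule sum.cong[OF refl])
    fix h assume h: "h \<in> G"
    have "?i h (h \<circ> k) = k" if "k \<in> G" for k
      using h that Gp.inv_solve_left[of k h "h \<circ> k"] by (metis Gp(1,2) Gp.inv_closed Gp.l_inv Gp.l_one Gp.m_assoc)
    then have "(\<Sum>k\<in>G. u' h \<star> \<beta> h (v' k) \<star> \<beta> (h \<circ> k) s) = (\<Sum>k\<in>G. u' h \<star> \<beta> h (v' (?i h (h \<circ> k))) \<star> \<beta> (h \<circ> k) s)"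
      by (intro sum.cong) auto
    then show "(\<Sum>g\<in>G. u' h \<star> \<beta> h (v' (?i h g)) \<star> \<beta> g s) = (\<Sum>k\<in>G. u' h \<star> \<beta> h (v' k) \<star> \<beta> (h \<circ> k) s)"
      using sum_translate[OF h, of "\<lambda>g. u' h \<star> \<beta> h (v' (?i h g)) \<star> \<beta> g s"] by simp
  qed
  also have "\<dots> = (\<Sum>h\<in>G. u' h \<star> \<beta> h (\<Sum>k\<in>G. v' k \<star> \<beta> k s))"
    using D s by (intro sum.cong refl)
      (simp add: \<beta>_sum star_sum_right star_D \<beta>_D \<beta>_star \<beta>_comp star_assoc)
  finally have "(\<Sum>g\<in>G. L ((u \<otimes>\<^bsub>SGA\<^esub> v) g) \<star> \<beta> g s) = (\<Sum>h\<in>G. L (u h) \<star> \<beta> h (\<Sum>k\<in>G. L (v k) \<star> \<beta> k s))"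
    by (simp add: u'_def v'_def)
  then show "K (\<Sum>g\<in>G. L ((u \<otimes>\<^bsub>SGA\<^esub> v) g) \<star> \<beta> g s) = (N u \<otimes>\<^bsub>ER\<^esub> N v) (K s)"
    using s by (simp add: E_simps[OF FS_subset smult_one_FS] compose_def natural_map_K u v natural_map_sum_D K_closed)
qed

lemma natural_map_hom:
  "N \<one>\<^bsub>SGA\<^esub> = \<one>\<^bsub>ER\<^esub>" "N \<zero>\<^bsub>SGA\<^esub> = \<zero>\<^bsub>ER\<^esub>"
  "u \<in> carrier SGA \<Longrightarrow> v \<in> carrier SGA \<Longrightarrow> N (u \<oplus>\<^bsub>SGA\<^esub> v) = N u \<oplus>\<^bsub>ER\<^esub> N v"
  "u \<in> carrier SGA \<Longrightarrow> N (c \<odot>\<^bsub>SGA\<^esub> u) = c \<odot>\<^bsub>ER\<^esub> N u"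
proof -
  note E = E_simps[OF FS_subset smult_one_FS] and Ecl = E_closed[OF FS_subset smult_one_FS]
  note eqI = E_eqI[OF FS_subset smult_one_FS]
  have L0: "L \<zero> = 0" and L1: "L \<one> = 1" using L_K[of 0] L_K[of 1] by (simp_all add: K_zero K_one)
  have L_add: "L (x \<oplus> y) = L x + L y" if "x \<in> carrier R" "y \<in> carrier R" for x y
    using L_K[of "L x + L y"] that by (simp add: K_add L_D K_L add_D)
  have L_smult: "L (c \<odot> x) = cst c * L x" if "x \<in> carrier R" for c x
    using L_K[of "cst c * L x"] that by (simp add: K_cst_mult L_D K_L cst_mult_D)
  have one_star: "1 \<star> t = t" if "t \<in> D" for t
    using that by (simp add: K_closed K_one K_star star_D flip: K_eq_iff)
  have cst_star: "cst c * s \<star> t = cst c * (s \<star> t)" if "s \<in> D" "t \<in> D" for c s t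
    using that by (simp add: K_closed K_cst_mult K_star star_D cst_mult_D smult_mult_left flip: K_eq_iff)
  show "N \<one>\<^bsub>SGA\<^esub> = \<one>\<^bsub>ER\<^esub>"
  proof (rule natural_map_eqI[OF SGA_closed(1) Ecl(1)])
    fix s assume s: "s \<in> D"
    have "L (\<one>\<^bsub>SGA\<^esub> g) = (if g = id then 1 else 0)" if "g \<in> G" for g
      using that by (simp add: skew_group_algebra_def Gp L0 L1)
    then have "(\<Sum>g\<in>G. L (\<one>\<^bsub>SGA\<^esub> g) \<star> \<beta> g s) = (\<Sum>g\<in>G. if g = id then s else 0)"
      using s by (intro sum.cong) (auto simp: one_star star_zero_left \<beta>_id)
    then show "K (\<Sum>g\<in>G. L (\<one>\<^bsub>SGA\<^esub> g) \<star> \<beta> g s) = \<one>\<^bsub>ER\<^esub> (K s)"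
      using s finite_G id_G by (simp add: E K_closed)
  qed
  show "N \<zero>\<^bsub>SGA\<^esub> = \<zero>\<^bsub>ER\<^esub>"
    by (rule natural_map_eqI[OF SGA_closed(2) Ecl(2)])
       (simp add: skew_group_algebra_def Gp L0 star_zero_left E K_zero K_closed)
  show "N (u \<oplus>\<^bsub>SGA\<^esub> v) = N u \<oplus>\<^bsub>ER\<^esub> N v" if u: "u \<in> carrier SGA" and v: "v \<in> carrier SGA"
  proof (rule natural_map_eqI[OF SGA_closed(4)[OF u v] Ecl(4)[OF natural_map_closed[OF u] natural_map_closed[OF v]]])
    fix s assume s: "s \<in> D"
    have "L ((u \<oplus>\<^bsub>SGA\<^esub> v) g) = L (u g) + L (v g)" if "g \<in> G" for g
      using that u v by (simp add: skew_group_algebra_def Gp L_add SGA_closed_at)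
    then show "K (\<Sum>g\<in>G. L ((u \<oplus>\<^bsub>SGA\<^esub> v) g) \<star> \<beta> g s) = (N u \<oplus>\<^bsub>ER\<^esub> N v) (K s)"
      using s u v by (simp add: E K_closed natural_map_K natural_map_sum_D star_add_left sum.distrib flip: K_add)
  qed
  show "N (c \<odot>\<^bsub>SGA\<^esub> u) = c \<odot>\<^bsub>ER\<^esub> N u" if u: "u \<in> carrier SGA"
  proof (rule natural_map_eqI[OF SGA_closed(5)[OF u] Ecl(5)[OF natural_map_closed[OF u]]])
    fix s assume s: "s \<in> D"
    have "L ((c \<odot>\<^bsub>SGA\<^esub> u) g) = cst c * L (u g)" if "g \<in> G" for g
      using that u by (simp add: skew_group_algebra_def Gp L_smult SGA_closed_at)
    then show "K (\<Sum>g\<in>G. L ((c \<odot>\<^bsub>SGA\<^esub> u) g) \<star> \<beta> g s) = (c \<odot>\<^bsub>ER\<^esub> N u) (K s)"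
      using s u by (simp add: E K_closed natural_map_K natural_map_sum_D cst_star SGA_L_D \<beta>_D sum_distrib_left flip: K_cst_mult)
  qed
qed

theorem algebra_iso_natural_map: "algebra_iso SGA ER N"
proof -
  have "k_algebra SGA"
    by (rule k_algebra_transport[OF k_algebra_ER natural_map_bij])
       (simp_all add: SGA_closed natural_map_hom natural_map_mult)
  moreover have "N \<in> ring_iso SGA ER"
    using natural_map_bij natural_map_closed
    by (auto simp: ring_iso_def ring_hom_def natural_map_hom natural_map_mult)
  ultimately show ?thesis
    by (simp add: algebra_iso_def k_algebra_ER natural_map_hom)
qed

end

section \<open>Enveloping algebras\<close>

lemma (in finite_dimensional_lie_algebra) exists_coordinates:
  "\<exists>d bv coord. lie_coordinates scale bracket d bv coord"
proof -
  obtain B where "finite_dimensional_vector_space scale B" using finite_dimensional by blast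
  then interpret B: finite_dimensional_vector_space scale B .
  obtain f where f: "bij_betw f {0..<card B} B" using ex_bij_betw_nat_finite[OF B.finite_Basis] by blast
  define bv where "bv i = (if i < card B then f i else 0)" for i
  define coord where "coord x k = (if k < card B then representation B x (f k) else 0)" for x k
  have span: "x \<in> span B" for x using B.span_Basis by simp
  have fB: "f i \<in> B" if "i < card B" for i using f that by (auto simp: bij_betw_def)
  have "lie_coordinates scale bracket (card B) bv coord"
  proof (intro lie_coordinates.intro lie_coordinates_axioms.intro)
    show "lie_algebra scale bracket" by unfold_locales
    show "coord (x + y) k = coord x k + coord y k" for x y k
      by (simp add: coord_def representation_add[OF B.independent_Basis span span])
    show "coord (scale c x) k = c * coord x k" for c x k
      by (simp add: coord_def representation_scale[OF B.independent_Basis span])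
    show "coord (bv i) k = (if i = k then 1 else 0)" if "i < card B" "k < card B" for i k
    proof -
      have "f k = f i \<longleftrightarrow> i = k" using f that by (auto simp: bij_betw_def inj_on_def)
      then show ?thesis
        using that fB by (simp add: coord_def bv_def representation_basis[OF B.independent_Basis])
    qed
    show "x = (\<Sum>k<card B. scale (coord x k) (bv k))" for x
    proof -
      have "x = (\<Sum>b\<in>B. scale (representation B x b) b)"
        using sum_representation_eq[OF B.independent_Basis span B.finite_Basis order_refl] by simp
      also have "\<dots> = (\<Sum>k\<in>{0..<card B}. scale (representation B x (f k)) (f k))"
        by (rule sum.reindex_bij_betw[OF f, symmetric])
      also have "\<dots> = (\<Sum>k<card B. scale (coord x k) (bv k))"
        by (intro sum.cong) (auto simp: coord_def bv_def)
      finally show ?thesis .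
    qed
  qed (simp add: bv_def)
  then show ?thesis by blast
qed

text \<open>Two powers coincide, and injectivity cancels the lower one. It supplies the finite order
  that belongs to the notion of a pseudo-reflection.\<close>

lemma finite_power_id:
  assumes "finite G" "\<And>n. (f ^^ n) \<in> G" "inj f"
  shows "\<exists>n>0. f ^^ n = id"
proof -
  have "\<not> inj (\<lambda>n. f ^^ n)"
    using assms(1,2) by (meson finite_imageD finite_subset image_subsetI infinite_UNIV_nat)
  then obtain i j where ij: "i < j" "f ^^ i = f ^^ j" unfolding inj_def by (metis linorder_neqE_nat)
  have "inj (f ^^ i)" by (rule inj_fn[OF assms(3)])
  moreover have "(f ^^ i) ((f ^^ (j - i)) x) = (f ^^ i) x" for x
    using ij by (metis add_diff_inverse_nat comp_apply funpow_add not_less_iff_gr_or_eq)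
  ultimately have "(f ^^ (j - i)) x = x" for x by (simp add: inj_eq)
  then show ?thesis using ij by (intro exI[of _ "j - i"]) (auto simp: fun_eq_iff)
qed

text \<open>By \<open>dep\<close> every displacement is a multiple of one nonzero displacement
  \<open>f v - v\<close>. Hence every vector is fixed by \<open>f\<close> after subtracting a
  multiple of \<open>v\<close>, and the fixed space is a hyperplane.\<close>

lemma (in finite_dimensional_vector_space) pseudo_reflection_if_rank_one:
  assumes "f \<in> general_linear scale" "f \<noteq> id" "\<exists>n>0. f ^^ n = id"
    and dep: "\<And>x y. \<exists>a c. (a, c) \<noteq> (0, 0) \<and> scale a (f x - x) + scale c (f y - y) = 0"
  shows "pseudo_reflection scale f"
proof -
  interpret f: Vector_Spaces.linear scale scale f
    using assms(1) by (simp add: general_linear_def)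
  obtain v where v: "f v \<noteq> v" using assms(2) by (auto simp: fun_eq_iff)
  define H where "H = {x. f x = x}"
  have H: "subspace H"
    by (rule subspaceI) (auto simp: H_def f.add f.scale f.zero)
  have "x \<in> span (insert v H)" for x
  proof -
    obtain a c where ac: "(a, c) \<noteq> (0, 0)" "scale a (f v - v) + scale c (f x - x) = 0"
      using dep by blast
    then have "c \<noteq> 0" using v by auto
    have "scale c (f x - x) = scale (- a) (f v - v)" using ac(2) by (simp add: eq_neg_iff_add_eq_0 add.commute)
    then have "scale (1 / c) (scale c (f x - x)) = scale (1 / c) (scale (- a) (f v - v))" by simp
    then have "f x - x = scale (- a / c) (f v - v)" using \<open>c \<noteq> 0\<close> by simp
    then have "x - scale (- a / c) v \<in> H"
      by (simp add: H_def f.add f.diff f.scale scale_right_diff_distrib algebra_simps)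
    then have "x - scale (- a / c) v \<in> span H" by (rule span_base)
    then show ?thesis unfolding span_insert by blast
  qed
  then have "span (insert v H) = UNIV" by blast
  then have "dim UNIV = dim (insert v H)" by (metis dim_span)
  moreover have "v \<notin> span H" using v H by (simp add: span_eq_iff[THEN iffD2]) (simp add: H_def)
  ultimately have "hyperplane scale H"
    using H by (simp add: hyperplane_def dim_insert)
  then show ?thesis
    unfolding pseudo_reflection_def using assms(1-3) by (auto simp: H_def)
qed

lemma group_lie_aut_group:
  assumes "lie_algebra scale bracket"
  shows "Group.group (lie_aut_group scale bracket)"
proof -
  interpret lie_algebra scale bracket by fact
  have lin: "Vector_Spaces.linear scale scale f \<longleftrightarrow> (\<forall>x y. f (x + y) = f x + f y) \<and> (\<forall>c x. f (scale c x) = scale c (f x))" for f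
    using vector_space_axioms by (simp add: Vector_Spaces.linear_iff)
  show ?thesis
  proof (rule groupI)
    fix f assume f: "f \<in> carrier (lie_aut_group scale bracket)"
    then have bij: "bij f" by (simp add: lie_aut_group_def general_linear_def)
    define h where "h = inv_into UNIV f"
    have inv: "f (h x) = x" "h (f x) = x" for x
      using bij by (simp_all add: h_def bij_is_surj surj_f_inv_f bij_is_inj)
    have h_eqI: "h y = x" if "f x = y" for x y using inv that by blast
    have "h (x + y) = h x + h y" "h (scale c x) = scale c (h x)"
      "h (bracket x y) = bracket (h x) (h y)" for x y c
      using f inv by (auto simp: lie_aut_group_def general_linear_def lin intro!: h_eqI)
    then have "h \<in> carrier (lie_aut_group scale bracket)"
      using bij_imp_bij_inv[OF bij] by (simp add: lie_aut_group_def general_linear_def lin flip: h_def)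
    moreover have "h \<circ> f = id" by (simp add: fun_eq_iff inv)
    ultimately show "\<exists>h\<in>carrier (lie_aut_group scale bracket). h \<otimes>\<^bsub>lie_aut_group scale bracket\<^esub> f = \<one>\<^bsub>lie_aut_group scale bracket\<^esub>"
      by (intro bexI[of _ h]) (simp_all add: lie_aut_group_def)
  qed (auto simp: lie_aut_group_def general_linear_def lin bij_comp comp_assoc)
qed

context lie_coordinates
begin

definition cl :: "('k, 'g) free_alg \<Rightarrow> ('k, 'g) free_alg set"
  where "cl p = I +>\<^bsub>free_algebra\<^esub> p"

lemma mem_cl: "q \<in> cl p \<longleftrightarrow> q - p \<in> I"
  by (auto simp: cl_def a_r_coset_def' intro: bexI[of _ "q - p"])

lemma cl_eq_iff: "cl p = cl q \<longleftrightarrow> p - q \<in> I"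
proof
  assume "cl p = cl q"
  then have "p \<in> cl q" by (simp add: mem_cl I_0 flip: \<open>cl p = cl q\<close>)
  then show "p - q \<in> I" by (simp add: mem_cl)
next
  assume pq: "p - q \<in> I"
  have "r - p \<in> I \<longleftrightarrow> r - q \<in> I" for r
    using I_add[OF _ pq, of "r - p"] I_diff[OF _ pq, of "r - q"] by (auto simp: algebra_simps)
  then show "cl p = cl q" by (auto simp: mem_cl)
qed

lemma cl_eq_pbw_iff: "cl p = cl q \<longleftrightarrow> pbw p = pbw q"
  by (simp add: cl_eq_iff pbw_eq_iff)

abbreviation U :: "('k, ('k, 'g) free_alg set) module"
  where "U \<equiv> universal_enveloping_algebra scale bracket"

lemma U_simps:
  "carrier U = range cl" "cl p \<otimes>\<^bsub>U\<^esub> cl q = cl (p * q)" "cl p \<oplus>\<^bsub>U\<^esub> cl q = cl (p + q)"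
  "\<one>\<^bsub>U\<^esub> = cl 1" "\<zero>\<^bsub>U\<^esub> = cl 0" "c \<odot>\<^bsub>U\<^esub> cl p = cl (cst c * p)"
proof -
  interpret ideal I free_algebra by (rule ideal_I)
  show "carrier U = range cl"
    by (auto simp: universal_enveloping_algebra_def Let_def FactRing_def A_RCOSETS_def' cl_def)
  show "cl p \<otimes>\<^bsub>U\<^esub> cl q = cl (p * q)"
    using rcoset_mult_add[of p q] by (simp add: universal_enveloping_algebra_def Let_def FactRing_def cl_def)
  show "cl p \<oplus>\<^bsub>U\<^esub> cl q = cl (p + q)"
    using a_rcos_sum[of p q] by (simp add: universal_enveloping_algebra_def Let_def FactRing_def cl_def)
  show "\<one>\<^bsub>U\<^esub> = cl 1" by (simp add: universal_enveloping_algebra_def Let_def FactRing_def cl_def)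
  show "\<zero>\<^bsub>U\<^esub> = cl 0"
    by (auto simp: universal_enveloping_algebra_def Let_def FactRing_def mem_cl)
  have "c \<odot>\<^bsub>U\<^esub> cl p = (\<Union>q\<in>cl p. cl (cst c * q))"
    by (simp add: universal_enveloping_algebra_def Let_def cl_def smult_free_algebra)
  \<comment> \<open>All representatives of the coset yield the same coset, so the union
    collapses.\<close>
  also have "\<dots> = (\<Union>q\<in>cl p. cl (cst c * p))"
    by (intro SUP_cong refl) (auto simp: cl_eq_iff mem_cl I_mult_left simp flip: right_diff_distrib)
  also have "\<dots> = cl (cst c * p)" using mem_cl[of p p] I_0 by auto
  finally show "c \<odot>\<^bsub>U\<^esub> cl p = cl (cst c * p)" .
qed

lemma enveloping_map_cl:
  assumes "Vector_Spaces.linear scale scale f" "\<And>x y. f (bracket x y) = bracket (f x) (f y)"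
  shows "enveloping_map scale bracket f (cl p) = cl (free_algebra_map f p)"
proof -
  have "enveloping_map scale bracket f (cl p) = (\<Union>q\<in>cl p. cl (free_algebra_map f q))"
    by (simp add: enveloping_map_def cl_def)
  also have "\<dots> = (\<Union>q\<in>cl p. cl (free_algebra_map f p))"
    using free_algebra_map_I[OF assms]
    by (intro SUP_cong refl) (auto simp: cl_eq_iff mem_cl simp flip: free_algebra_map_diff)
  also have "\<dots> = cl (free_algebra_map f p)" using mem_cl[of p p] I_0 by auto
  finally show ?thesis .
qed

lemma k_algebra_U: "k_algebra U"
proof (intro k_algebra.intro k_algebra_axioms.intro)
  show "ring U"
  proof (rule ringI)
    show "abelian_group U"
    proof (rule abelian_groupI)
      fix x assume "x \<in> carrier U"
      then obtain p where p: "x = cl p" by (auto simp: U_simps)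
      show "\<exists>y\<in>carrier U. y \<oplus>\<^bsub>U\<^esub> x = \<zero>\<^bsub>U\<^esub>"
        by (intro bexI[of _ "cl (- p)"]) (simp_all add: p U_simps)
    qed (auto simp: U_simps ac_simps)
    show "Group.monoid U" by (rule monoidI) (auto simp: U_simps mult.assoc)
  qed (auto simp: U_simps distrib_left distrib_right)
  show "x \<otimes>\<^bsub>U\<^esub> (c \<odot>\<^bsub>U\<^esub> y) = c \<odot>\<^bsub>U\<^esub> (x \<otimes>\<^bsub>U\<^esub> y)" if "x \<in> carrier U" "y \<in> carrier U" for x y c
    using that by (auto simp: U_simps cst_left_commute)
qed (auto simp: U_simps cst_add cst_mult distrib_left distrib_right mult.assoc)

lemma pbw_lift_pbw: "pbw (lift (pbw p)) = pbw p"
  by (rule pbw_lift[OF pbw_vars_lt])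

definition star :: "'k mpoly \<Rightarrow> 'k mpoly \<Rightarrow> 'k mpoly"
  where "star s t = pbw (lift s * lift t)"

text \<open>Modulo the ideal, each factor may be replaced by the lift of its normal form.\<close>

lemma pbw_mult: "pbw (p * q) = star (pbw p) (pbw q)"
proof -
  have "(p - lift (pbw p)) * q + lift (pbw p) * (q - lift (pbw q)) \<in> I"
    by (intro I_add I_mult_left I_mult_right minus_lift_pbw)
  then show ?thesis by (simp add: star_def pbw_eq_iff algebra_simps)
qed

lemma pbw_cst: "pbw (cst c) = cst c"
proof -
  have "pbw 1 = 1"
    using pbw_word[of "[]"] by (simp add: straighten_sorted)
  then show ?thesis using pbw_cst_mult[of c 1] by simp
qed

text \<open>In top degree \<open>pbw\<close> agrees with the multiplicative map \<open>abel\<close>,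
  both on the product and on the two factors.\<close>

lemma star_hpart:
  assumes "s \<in> vars_lt d" "t \<in> vars_lt d" "s \<in> deg_le i" "t \<in> deg_le j"
  shows "star s t \<in> deg_le (i + j)" "hpart (i + j) (star s t) = hpart i s * hpart j t"
proof -
  have le: "lift s \<in> words_le i" "lift t \<in> words_le j" using assms words_le_lift by auto
  note sym = pbw_symbol[OF words_le_mult[OF le]] pbw_symbol[OF le(1)] pbw_symbol[OF le(2)]
  show "star s t \<in> deg_le (i + j)" using sym(1) by (simp add: star_def)
  show "hpart (i + j) (star s t) = hpart i s * hpart j t"
    using sym(3) hpart_mult[OF sym(5,8)] sym(6,9) assms by (simp add: star_def abel_mult pbw_lift)
qed

definition twist :: "('g \<Rightarrow> 'g) \<Rightarrow> 'k mpoly \<Rightarrow> 'k mpoly"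
  where "twist g s = pbw (free_algebra_map g (lift s))"

lemma pbw_free_algebra_map:
  assumes "Vector_Spaces.linear scale scale g" "\<And>x y. g (bracket x y) = bracket (g x) (g y)"
  shows "pbw (free_algebra_map g p) = twist g (pbw p)"
  using free_algebra_map_I[OF assms minus_lift_pbw[of p]]
  by (simp add: twist_def pbw_eq_iff free_algebra_map_diff)

lemma twist_hpart:
  assumes "Vector_Spaces.linear scale scale g" "s \<in> vars_lt d" "s \<in> deg_le n"
  shows "twist g s \<in> deg_le n" "hpart n (twist g s) = sym_map g (hpart n s)"
proof -
  have le: "lift s \<in> words_le n" using assms words_le_lift by auto
  note sym = pbw_symbol[OF le] pbw_symbol[OF words_le_free_algebra_map[OF le, of g]]
  show "twist g s \<in> deg_le n" using sym(4) by (simp add: twist_def)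
  have "hpart n (twist g s) = hpart n (sym_map g (abel (lift s)))"
    using sym(6) by (simp add: twist_def abel_free_algebra_map[OF assms(1)])
  also have "\<dots> = sym_map g (hpart n (abel (lift s)))"
    unfolding sym_map_def by (rule hpart_subst) (rule lin_homog)
  finally show "hpart n (twist g s) = sym_map g (hpart n s)"
    using sym(3) assms by (simp add: pbw_lift)
qed

lemma lin_diff: "lin (x - y) = lin x - lin y"
  using lin_add[of "x - y" y] by simp

lemma lookup_Var: "lookup (Var k) (single j 1) = (if j = k then 1 else 0)"
proof -
  have "j = k" if "single k (1::nat) = single j 1"
    using arg_cong[OF that, of keys] by simp
  then show ?thesis by (auto simp: Var_def lookup_single when_def)
qed

lemma lin_eq_0: "lin x = 0 \<Longrightarrow> x = 0"
proof -
  assume x: "lin x = 0"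
  have "coord x j = 0" if "j < d" for j
  proof -
    have "lookup (lin x) (single j 1) = (\<Sum>k<d. if j = k then coord x k else 0)"
      unfolding lin_def lookup_sum
      by (rule sum.cong[OF refl]) (simp add: lookup_cst_mult lookup_Var del: One_nat_def)
    then show ?thesis using that x by simp
  qed
  then show "x = 0" by (subst expand) simp
qed

lemma sym_map_id:
  assumes "s \<in> vars_lt d"
  shows "sym_map id s = s"
proof (induction s rule: mpoly_induct)
  case (Var i m)
  then have "i < d" using assms by (auto simp: vars_lt_def)
  then show ?case by (simp add: sym_map_def lin_bv)
qed (simp_all add: sym_map_def subst_add subst_mult)

lemma sym_map_vars_lt: "sym_map f s \<in> vars_lt d"
  unfolding sym_map_def by (rule subst_in_vars_lt) (rule lin_vars_lt)

text \<open>The substitution induced by a projection with kernel spanned by \<open>v\<close> has kernel generated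
  by \<open>lin v\<close>.\<close>

lemma lin_coprime:
  assumes indep: "\<And>a c. scale a v + scale c v' = 0 \<Longrightarrow> a = 0 \<and> c = 0"
    and u: "u \<in> vars_lt d" and eq: "lin v * w = lin v' * u"
  shows "\<exists>c\<in>vars_lt d. u = lin v * c"
proof -
  have "v \<noteq> 0" using indep[of 1 0] by auto
  have "\<exists>k<d. coord v k \<noteq> 0"
  proof (rule ccontr)
    assume "\<not> ?thesis"
    then have "v = 0" by (subst expand) simp
    with \<open>v \<noteq> 0\<close> show False by simp
  qed
  then obtain k where k: "k < d" "coord v k \<noteq> 0" by blast
  \<comment> \<open>The projection along \<open>v\<close> onto the vectors whose coordinate
    \<open>k\<close> is zero.\<close>
  define q where "q x = x - scale (coord x k / coord v k) v" for x
  have q: "Vector_Spaces.linear scale scale q"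
    using vector_space_axioms
    by (simp add: Vector_Spaces.linear_iff q_def coord_add coord_scale add_divide_distrib scale_left_distrib
        scale_right_diff_distrib)
  have qv: "q v = 0" using k by (simp add: q_def)
  have "q v' \<noteq> 0"
  proof
    assume "q v' = 0"
    then have "scale (- (coord v' k / coord v k)) v + scale 1 v' = 0" by (simp add: q_def)
    then show False using indep by fastforce
  qed
  \<comment> \<open>The identity and \<open>q\<close> differ by multiples of \<open>v\<close>, so
    the two substitutions agree modulo \<open>lin v\<close>.\<close>
  have "lin v dvd sym_map id u - sym_map q u"
    unfolding sym_map_def by (rule dvd_subst_diff) (simp add: q_def lin_diff lin_scale)
  moreover have "sym_map q u = 0"
  proof -
    have "sym_map q (lin v) * sym_map q w = sym_map q (lin v') * sym_map q u"
      using arg_cong[OF eq, of "sym_map q"] by (simp add: sym_map_def subst_mult)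
    then have "lin (q v') * sym_map q u = 0" by (simp add: sym_map_lin[OF q] qv)
    moreover have "lin (q v') \<noteq> 0" using lin_eq_0 \<open>q v' \<noteq> 0\<close> by blast
    ultimately show ?thesis by simp
  qed
  ultimately obtain c where "u = lin v * c"
    using sym_map_id[OF u] by (auto elim: dvdE)
  \<comment> \<open>The cofactor \<open>c\<close> may involve variables from \<open>d\<close> on.
    Applying \<open>sym_map id\<close> removes them and leaves \<open>u\<close> and
    \<open>lin v\<close> unchanged.\<close>
  then have "u = lin v * sym_map id c"
    using sym_map_id[OF u] sym_map_id[OF lin_vars_lt] by (metis subst_mult sym_map_def)
  then show ?thesis using sym_map_vars_lt by blast
qed

end

text \<open>The vectors \<open>p g\<close> and \<open>p' g\<close> have linearly independent
  displacements under \<open>g\<close>. This is the form in which the absence of pseudo-reflections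
  enters.\<close>

locale lie_coordinates_with_group = lie_coordinates scale bracket d bv coord
  for scale :: "'k::field_char_0 \<Rightarrow> 'g::ab_group_add \<Rightarrow> 'g" and bracket d bv coord +
  fixes G :: "('g \<Rightarrow> 'g) set" and p p' :: "('g \<Rightarrow> 'g) \<Rightarrow> 'g"
  assumes subgroup_G: "subgroup G (lie_aut_group scale bracket)"
    and finite_group: "finite G"
    and moves_plane: "g \<in> G \<Longrightarrow> g \<noteq> id \<Longrightarrow>
      scale a (g (p g) - p g) + scale c (g (p' g) - p' g) = 0 \<Longrightarrow> a = 0 \<and> c = 0"
begin

sublocale A: Group.group "lie_aut_group scale bracket"
  by (rule group_lie_aut_group) unfold_locales

lemma G_linear: "g \<in> G \<Longrightarrow> Vector_Spaces.linear scale scale g"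
  and G_bracket: "g \<in> G \<Longrightarrow> g (bracket x y) = bracket (g x) (g y)"
  using subgroup.subset[OF subgroup_G] by (auto simp: lie_aut_group_def general_linear_def)

lemma sym_map_lin_diff: "g \<in> G \<Longrightarrow> sym_map g (lin x) - lin x = lin (g x - x)"
  by (simp add: sym_map_lin[OF G_linear] lin_diff)

lemma first_displacement_nonzero: "g \<in> G \<Longrightarrow> g \<noteq> id \<Longrightarrow> g (p g) - p g \<noteq> 0"
  and second_displacement_nonzero: "g \<in> G \<Longrightarrow> g \<noteq> id \<Longrightarrow> g (p' g) - p' g \<noteq> 0"
  using moves_plane[of g 1 0] moves_plane[of g 0 1] by auto

sublocale finite_transformation_group G
proof
  show "finite G" by (rule finite_group)
  show "id \<in> G" using subgroup.one_closed[OF subgroup_G] by (simp add: lie_aut_group_def)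
  show "g \<circ> h \<in> G" if "g \<in> G" "h \<in> G" for g h
    using subgroup.m_closed[OF subgroup_G that] by (simp add: lie_aut_group_def)
  show "\<exists>h\<in>G. h \<circ> g = id \<and> g \<circ> h = id" if "g \<in> G" for g
  proof -
    let ?A = "lie_aut_group scale bracket"
    have g: "g \<in> carrier ?A" using subgroup.subset[OF subgroup_G] that by blast
    have "inv\<^bsub>?A\<^esub> g \<circ> g = id" "g \<circ> inv\<^bsub>?A\<^esub> g = id"
      using A.l_inv[OF g] A.r_inv[OF g] by (simp_all add: lie_aut_group_def)
    then show ?thesis using subgroup.m_inv_closed[OF subgroup_G that] by blast
  qed
qed

sublocale group_acting_on_domain G "vars_lt d" sym_map
proof
  show "sym_map g x \<in> vars_lt d" for g x by (rule sym_map_vars_lt)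
  show "sym_map (g \<circ> h) x = sym_map g (sym_map h x)" if "g \<in> G" for g h x
    by (simp add: sym_map_def subst_subst sym_map_lin[OF G_linear[OF that], unfolded sym_map_def])
  show "sym_map id x = x" if "x \<in> vars_lt d" for x using that by (rule sym_map_id)
qed (auto simp: vars_lt_add vars_lt_diff vars_lt_mult sym_map_def subst_add subst_mult)

sublocale filtered_deformation G d sym_map star twist "\<lambda>g. lin (p g)" "\<lambda>g. lin (p' g)"
proof
  show "hpart n (sym_map g s) = sym_map g (hpart n s)" for n g s
    unfolding sym_map_def by (rule hpart_subst) (rule lin_homog)
  show "star s t \<in> vars_lt d" for s t by (simp add: star_def pbw_vars_lt)
  show "star (s + s') t = star s t + star s' t" for s s' t
    by (simp add: star_def lift_add distrib_right pbw_add)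
  show "star s (t + t') = star s t + star s t'" for s t t'
    by (simp add: star_def lift_add distrib_left pbw_add)
  show "star (star s t) r = star s (star t r)" if "s \<in> vars_lt d" "t \<in> vars_lt d" "r \<in> vars_lt d" for s t r
    using pbw_mult[of "lift s * lift t" "lift r"] pbw_mult[of "lift s" "lift t * lift r"] that
    by (simp add: pbw_lift star_def[of s t] star_def[of t r] mult.assoc)
  show "star s (cst c) = cst c * s" if "s \<in> vars_lt d" for s c
    using pbw_mult[of "lift s" "cst c"] that by (simp add: pbw_lift pbw_cst pbw_cst_mult flip: cst_commute)
  show "twist g s \<in> vars_lt d" for g s by (simp add: twist_def pbw_vars_lt)
  show "twist g (s + t) = twist g s + twist g t" for g s t
    by (simp add: twist_def lift_add free_algebra_map_add pbw_add)
  show "twist g (cst c) = cst c" if "g \<in> G" for g c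
    using pbw_free_algebra_map[OF G_linear G_bracket, OF that that, of "cst c"] by (simp add: pbw_cst)
  show "twist g (star s t) = star (twist g s) (twist g t)" if "g \<in> G" for g s t
    using pbw_free_algebra_map[OF G_linear G_bracket, OF that that, of "lift s * lift t"]
    by (simp add: star_def[of s t] free_algebra_map_mult pbw_mult twist_def[of _ s] twist_def[of _ t])
  show "twist (g \<circ> h) s = twist g (twist h s)" if "g \<in> G" for g h s
    using pbw_free_algebra_map[OF G_linear G_bracket, OF that that, of "free_algebra_map h (lift s)"]
    by (simp add: twist_def[of h] twist_def[of "g \<circ> h"] free_algebra_map_comp)
  show "sym_map g (lin (p g)) \<noteq> lin (p g)" if "g \<in> G" "g \<noteq> id" for g
    using sym_map_lin_diff[OF that(1), of "p g"] first_displacement_nonzero[OF that] lin_eq_0 by fastforce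
  show "sym_map g (lin (p' g)) \<noteq> lin (p' g)" if "g \<in> G" "g \<noteq> id" for g
    using sym_map_lin_diff[OF that(1), of "p' g"] second_displacement_nonzero[OF that] lin_eq_0 by fastforce
  show "\<exists>c\<in>vars_lt d. u = (sym_map g (lin (p g)) - lin (p g)) * c"
    if "g \<in> G" "g \<noteq> id" "u \<in> vars_lt d"
      "(sym_map g (lin (p g)) - lin (p g)) * v = (sym_map g (lin (p' g)) - lin (p' g)) * u" for g u v
    using lin_coprime[OF moves_plane[OF that(1,2)] that(3)] that(4) by (simp add: sym_map_lin_diff that(1))
qed (use star_hpart twist_hpart G_linear lin_vars_lt in auto)

sublocale realized_deformation G d sym_map star twist "\<lambda>g. lin (p g)" "\<lambda>g. lin (p' g)"
  U "(lie_aut_group scale bracket)\<lparr>carrier := G\<rparr>" "\<lambda>s. cl (lift s)" "enveloping_map scale bracket"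
proof (intro realized_deformation.intro realized_deformation_axioms.intro)
  show "filtered_deformation G d sym_map star twist (\<lambda>g. lin (p g)) (\<lambda>g. lin (p' g))" by unfold_locales
  show "k_algebra U" by (rule k_algebra_U)
  show "Group.group ((lie_aut_group scale bracket)\<lparr>carrier := G\<rparr>)"
    by (rule subgroup.subgroup_is_group[OF subgroup_G]) unfold_locales
  show "twist id s = s" if "s \<in> vars_lt d" for s
    using that by (simp add: twist_def free_algebra_map_id pbw_lift)
  show "bij_betw (\<lambda>s. cl (lift s)) (vars_lt d) (carrier U)"
  proof (rule bij_betw_imageI)
    show "inj_on (\<lambda>s. cl (lift s)) (vars_lt d)"
      by (rule inj_onI) (metis cl_eq_pbw_iff pbw_lift)
    show "(\<lambda>s. cl (lift s)) ` vars_lt d = carrier U"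
    proof (intro equalityI subsetI)
      fix x assume "x \<in> carrier U"
      then obtain q where q: "x = cl q" by (auto simp: U_simps)
      then have "x = cl (lift (pbw q))" by (simp add: cl_eq_pbw_iff pbw_lift_pbw)
      then show "x \<in> (\<lambda>s. cl (lift s)) ` vars_lt d" using pbw_vars_lt by blast
    qed (auto simp: U_simps)
  qed
  show "cl (lift (s + t)) = cl (lift s) \<oplus>\<^bsub>U\<^esub> cl (lift t)" for s t by (simp add: U_simps lift_add)
  show "cl (lift (star s t)) = cl (lift s) \<otimes>\<^bsub>U\<^esub> cl (lift t)" for s t
    by (simp add: U_simps cl_eq_pbw_iff star_def pbw_lift_pbw)
  show "cl (lift 1) = \<one>\<^bsub>U\<^esub>"
    using pbw_cst[of 1] by (simp add: U_simps cl_eq_pbw_iff pbw_lift)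
  show "cl (lift (cst c * s)) = c \<odot>\<^bsub>U\<^esub> cl (lift s)" for c s by (simp add: U_simps lift_cst_mult)
  show "cl (lift (twist g s)) = enveloping_map scale bracket g (cl (lift s))" if "g \<in> G" for g s
    using that by (simp add: enveloping_map_cl G_linear G_bracket cl_eq_pbw_iff twist_def pbw_lift_pbw)
qed (simp_all add: lie_aut_group_def)

end

theorem theorem0p4:
  fixes scale :: "'k::field_char_0 \<Rightarrow> 'g::ab_group_add \<Rightarrow> 'g"
    and bracket :: "'g \<Rightarrow> 'g \<Rightarrow> 'g"
    and G :: "('g \<Rightarrow> 'g) set"
  assumes "finite_dimensional_lie_algebra scale bracket"
    and "subgroup G (lie_aut_group scale bracket)"
    and "finite G"
    and "small scale G"
  shows "let R = universal_enveloping_algebra scale bracket;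
             act = enveloping_map scale bracket;
             Gp = (lie_aut_group scale bracket)\<lparr>carrier := G\<rparr>
         in algebra_iso
              (skew_group_algebra R Gp act)
              (right_endomorphism_algebra R (fixed_subring R G act))
              (natural_map R Gp act)"
proof -
  interpret finite_dimensional_lie_algebra scale bracket by (rule assms(1))
  obtain B where "finite_dimensional_vector_space scale B" using finite_dimensional by blast
  then interpret B: finite_dimensional_vector_space scale B .
  obtain d bv coord where coords: "lie_coordinates scale bracket d bv coord"
    using exists_coordinates by blast
  \<comment> \<open>Otherwise any two displacements under \<open>g\<close> are dependent. Since the
    powers of \<open>g\<close> stay in the finite set \<open>G\<close>, it has finite order and
    would be a pseudo-reflection.\<close>
  have "\<exists>x y. \<forall>a c. scale a (g x - x) + scale c (g y - y) = 0 \<longrightarrow> a = 0 \<and> c = 0"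
    if g: "g \<in> G" "g \<noteq> id" for g
  proof (rule ccontr)
    assume dep: "\<not> ?thesis"
    have GL: "g \<in> general_linear scale"
      using subgroup.subset[OF assms(2)] g by (auto simp: lie_aut_group_def)
    have "g ^^ n \<in> G" for n
    proof (induction n)
      case 0
      show ?case using subgroup.one_closed[OF assms(2)] by (simp add: lie_aut_group_def id_def)
    next
      case (Suc n)
      then show ?case using subgroup.m_closed[OF assms(2) g(1) Suc] by (simp add: lie_aut_group_def comp_def)
    qed
    then have "\<exists>n>0. g ^^ n = id"
      using GL by (intro finite_power_id[OF assms(3)]) (auto simp: general_linear_def bij_is_inj)
    then have "pseudo_reflection scale g"
    proof (rule B.pseudo_reflection_if_rank_one[OF GL g(2)])
      fix x y
      have "\<exists>a c. scale a (g x - x) + scale c (g y - y) = 0 \<and> \<not> (a = 0 \<and> c = 0)" using dep by blast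
      then show "\<exists>a c. (a, c) \<noteq> (0, 0) \<and> scale a (g x - x) + scale c (g y - y) = 0" by auto
    qed
    then show False using assms(4) g by (auto simp: small_def)
  qed
  then obtain p p' where p: "\<And>g a c. g \<in> G \<Longrightarrow> g \<noteq> id \<Longrightarrow>
      scale a (g (p g) - p g) + scale c (g (p' g) - p' g) = 0 \<Longrightarrow> a = 0 \<and> c = 0"
    by metis
  interpret lie_coordinates_with_group scale bracket d bv coord G p p'
    using assms(2,3) p coords by (intro lie_coordinates_with_group.intro lie_coordinates_with_group_axioms.intro)
  show ?thesis
    using algebra_iso_natural_map by (simp add: Let_def)
qed

end
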